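(* Let $d\ge 1$ be an integer, $\alpha\in(0,2]$, $m>1$, and put $\lambda=\frac{1}{d(m-1)+\alpha}$. Define $\Phi_{\alpha,m}:\mathbb{R}^d\to\mathbb{R}$ by $$\Phi_{\alpha,m}(y)=\Big(k_{\alpha,d}\,(1-|y|^2)_+^{\frac{\alpha}{2}}\Big)^{\frac{1}{m-1}},\qquad k_{\alpha,d}=\frac{d\,\Gamma\left(\frac d2\right)}{(d(m-1)+\alpha)\,2^\alpha\,\Gamma\left(1+\frac\alpha2\right)\Gamma\left(\frac{d+\alpha}{2}\right)}.$$ Define $u:(0,\infty)\times\mathbb{R}^d\to[0,\infty)$ by $$u(t,x)=\frac{1}{t^{d\lambda}}\,\Phi_{\alpha,m}\left(\frac{x}{t^\lambda}\right).$$ Then, for every $0<\eta<T<\infty$, $u$ is a weak solution in $Q_{\eta,T}=(\eta,T)\times\mathbb{R}^d$ of the equation $$\partial_t u=\nabla\cdot\left(|u|\,\nabla^{\alpha-1}(|u|^{m-2}u)\right).$$ Moreover, $u(t,x)$ satisfies this equation in the pointwise sense for $|x|\neq t^{\frac{1}{d(m-1)+\alpha}}$, and $u$ is $\min\left\{\frac{\alpha}{2(m-1)},1\right\}$-Hölder continuous at the interface $|x|=t^{\frac{1}{d(m-1)+\alpha}}$.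
   Context: Here $w_+=\max\{0,w\}$ and $\Gamma$ is the Euler Gamma function. The operator $\nabla^{\alpha-1}$ denotes $\nabla(-\Delta)^{\frac\alpha2-1}$, i.e. the (vector-valued) Fourier multiplier with symbol $i\xi|\xi|^{\alpha-2}$, where $\mathcal{F}v(\xi)=(2\pi)^{-d/2}\int_{\mathbb{R}^d} v(x)e^{-ix\cdot\xi}\,dx$; for $\alpha=2$ it is the usual gradient. One has $\nabla\cdot\nabla^{\alpha-1}=-(-\Delta)^{\alpha/2}$, where $(-\Delta)^{\alpha/2}$ has symbol $|\xi|^\alpha$. Weak solution in $Q_{\eta,T}$: a function $u\in L^1(Q_{\eta,T})$ such that $\nabla^{\alpha-1}(|u|^{m-2}u)\in L^1_{\rm loc}(Q_{\eta,T})$, $|u|\nabla^{\alpha-1}(|u|^{m-2}u)\in L^1_{\rm loc}(Q_{\eta,T})$, and $$\int_\eta^T\!\!\int_{\mathbb{R}^d}\left(u\,\partial_t\varphi-|u|\nabla^{\alpha-1}(|u|^{m-2}u)\cdot\nabla\varphi\right)dx\,dt+\int_{\mathbb{R}^d}u(\eta,x)\varphi(\eta,x)\,dx=0$$ for all test functions $\varphi\in C^\infty(Q_{\eta,T})\cap C(\overline{Q_{\eta,T}})$ such that $\varphi$ has compact support in the space variable $x$ and vanishes near $t=T$. *)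

theory Defs
  imports "HOL-Analysis.Analysis"
begin

text \<open>
  Euclidean space of dimension d is a type \<open>'a :: euclidean_space\<close> with d = \<open>DIM('a)\<close>, which is
  at least 1.  Functions of time and space are functions on \<open>real \<times> 'a\<close>.
\<close>


subsection \<open>Differential calculus\<close>

primrec Ck_on :: "nat \<Rightarrow> 'a::real_normed_vector set \<Rightarrow> ('a \<Rightarrow> 'b::real_normed_vector) \<Rightarrow> bool" where
  "Ck_on 0 S f \<longleftrightarrow> continuous_on S f"
| "Ck_on (Suc k) S f \<longleftrightarrow> (\<forall>x\<in>S. f differentiable (at x)) \<and>
     (\<forall>v. Ck_on k S (\<lambda>x. frechet_derivative f (at x) v))"

definition smooth_on :: "'a::real_normed_vector set \<Rightarrow> ('a \<Rightarrow> 'b::real_normed_vector) \<Rightarrow> bool" where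
  "smooth_on S f \<longleftrightarrow> (\<forall>k. Ck_on k S f)"

primrec iterated_deriv :: "'a::real_normed_vector list \<Rightarrow> ('a \<Rightarrow> 'b::real_normed_vector) \<Rightarrow> 'a \<Rightarrow> 'b" where
  "iterated_deriv [] f = f"
| "iterated_deriv (v # vs) f = (\<lambda>x. frechet_derivative (iterated_deriv vs f) (at x) v)"

definition gradient :: "('a::euclidean_space \<Rightarrow> real) \<Rightarrow> 'a \<Rightarrow> 'a" where
  "gradient f x = (\<Sum>b\<in>Basis. frechet_derivative f (at x) b *\<^sub>R b)"

definition divergence :: "('a::euclidean_space \<Rightarrow> 'a) \<Rightarrow> 'a \<Rightarrow> real" where
  "divergence F x = (\<Sum>b\<in>Basis. frechet_derivative F (at x) b \<bullet> b)"


subsection \<open>Fourier transform and the fractional gradient\<close>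

definition schwartz :: "('a::euclidean_space \<Rightarrow> complex) \<Rightarrow> bool" where
  "schwartz \<psi> \<longleftrightarrow> smooth_on UNIV \<psi> \<and>
     (\<forall>n vs. bounded (range (\<lambda>x. norm x ^ n *\<^sub>R iterated_deriv vs \<psi> x)))"

definition fourier :: "('a::euclidean_space \<Rightarrow> complex) \<Rightarrow> 'a \<Rightarrow> complex" where
  "fourier v \<xi> = (2 * pi) powr (- real DIM('a) / 2) *\<^sub>R
     (LBINT x. v x * exp (- \<i> * complex_of_real (x \<bullet> \<xi>)))"

text \<open>
  \<open>has_fourier v V\<close>: the function \<open>V\<close> is the Fourier transform of the function \<open>v\<close> in the sense
  of tempered distributions.  For integrable \<open>v\<close> this says \<open>V = fourier v\<close> almost everywhere.
\<close>

definition has_fourier ::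
  "('a::euclidean_space \<Rightarrow> complex) \<Rightarrow> ('a \<Rightarrow> complex) \<Rightarrow> bool" where
  "has_fourier v V \<longleftrightarrow> (\<forall>\<psi>. schwartz \<psi> \<longrightarrow>
     integrable lborel (\<lambda>x. v x * fourier \<psi> x) \<and>
     integrable lborel (\<lambda>\<xi>. V \<xi> * \<psi> \<xi>) \<and>
     (LBINT \<xi>. V \<xi> * \<psi> \<xi>) = (LBINT x. v x * fourier \<psi> x))"

text \<open>
  \<open>is_frac_grad \<alpha> v w\<close>: the vector field \<open>w\<close> is the image of \<open>v\<close> under the Fourier multiplier
  with the vector-valued symbol \<open>\<i> \<xi> |\<xi>|\<^sup>\<alpha>\<^sup>-\<^sup>2\<close>, required component by component.  This is a
  relation because it determines \<open>w\<close> only up to null sets.  At \<open>\<xi> = 0\<close> the symbol takes the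
  value 0, which is its usual value there for \<open>\<alpha> = 2\<close>.
\<close>

definition is_frac_grad ::
  "real \<Rightarrow> ('a::euclidean_space \<Rightarrow> real) \<Rightarrow> ('a \<Rightarrow> 'a) \<Rightarrow> bool" where
  "is_frac_grad \<alpha> v w \<longleftrightarrow> (\<exists>V. has_fourier (\<lambda>x. complex_of_real (v x)) V \<and>
     (\<forall>b\<in>Basis. has_fourier (\<lambda>x. complex_of_real (w x \<bullet> b))
        (\<lambda>\<xi>. \<i> * complex_of_real ((\<xi> \<bullet> b) * norm \<xi> powr (\<alpha> - 2)) * V \<xi>)))"


subsection \<open>Solutions of the equation\<close>

definition loc_integrable_on ::
  "'a::euclidean_space set \<Rightarrow> ('a \<Rightarrow> 'b::{banach, second_countable_topology}) \<Rightarrow> bool" where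
  "loc_integrable_on S f \<longleftrightarrow> (\<forall>K. compact K \<and> K \<subseteq> S \<longrightarrow> set_integrable lborel K f)"

definition pressure :: "real \<Rightarrow> (real \<times> 'a \<Rightarrow> real) \<Rightarrow> real \<Rightarrow> 'a \<Rightarrow> real" where
  "pressure m u t x = \<bar>u (t, x)\<bar> powr (m - 2) * u (t, x)"

definition test_function :: "real \<Rightarrow> real \<Rightarrow> (real \<times> 'a::euclidean_space \<Rightarrow> real) \<Rightarrow> bool" where
  "test_function \<eta> T \<phi> \<longleftrightarrow>
     smooth_on ({\<eta><..<T} \<times> UNIV) \<phi> \<and> continuous_on ({\<eta>..T} \<times> UNIV) \<phi> \<and>
     (\<exists>K. compact K \<and> (\<forall>t\<in>{\<eta>..T}. \<forall>x. x \<notin> K \<longrightarrow> \<phi> (t, x) = 0)) \<and>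
     (\<exists>\<tau><T. \<forall>t\<in>{\<eta>..T}. \<tau> < t \<longrightarrow> (\<forall>x. \<phi> (t, x) = 0))"

text \<open>
  A test function is only continuous up to \<open>t = \<eta>\<close>, so its derivatives may fail to be integrable
  there, and the local integrability conditions control the integrand only away from \<open>t = \<eta>\<close>.
  The time integral is therefore improper at \<open>\<eta>\<close>; whenever the integrand is integrable over all
  of \<open>(\<eta>, T) \<times> \<real>\<^sup>d\<close>, the limit is the ordinary Lebesgue integral.  The field \<open>w\<close> is the
  fractional gradient of the pressure.
\<close>

definition weak_solution ::
  "real \<Rightarrow> real \<Rightarrow> real \<Rightarrow> real \<Rightarrow> (real \<times> 'a::euclidean_space \<Rightarrow> real) \<Rightarrow> bool" where
  "weak_solution \<alpha> m \<eta> T u \<longleftrightarrow>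
     set_integrable lborel ({\<eta><..<T} \<times> UNIV) u \<and>
     (\<exists>w :: real \<times> 'a \<Rightarrow> 'a.
        (AE t in lborel. t \<in> {\<eta><..<T} \<longrightarrow> is_frac_grad \<alpha> (pressure m u t) (\<lambda>x. w (t, x))) \<and>
        loc_integrable_on ({\<eta><..<T} \<times> UNIV) w \<and>
        loc_integrable_on ({\<eta><..<T} \<times> UNIV) (\<lambda>p. \<bar>u p\<bar> *\<^sub>R w p) \<and>
        (\<forall>\<phi>. test_function \<eta> T \<phi> \<longrightarrow>
           integrable lborel (\<lambda>x. u (\<eta>, x) * \<phi> (\<eta>, x)) \<and>
           ((\<lambda>s. (LBINT t:{s<..<T}. LBINT x.
                    u (t, x) * deriv (\<lambda>t. \<phi> (t, x)) t
                    - (\<bar>u (t, x)\<bar> *\<^sub>R w (t, x)) \<bullet> gradient (\<lambda>x. \<phi> (t, x)) x)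
                + (LBINT x. u (\<eta>, x) * \<phi> (\<eta>, x))) \<longlongrightarrow> 0) (at_right \<eta>)))"

text \<open>
  In the pointwise notion, continuity of \<open>w\<close> on the open set \<open>S\<close> singles out the representative
  of the fractional gradient whose values are meant.
\<close>

definition pointwise_solution_on ::
  "real \<Rightarrow> real \<Rightarrow> (real \<times> 'a::euclidean_space) set \<Rightarrow> (real \<times> 'a \<Rightarrow> real) \<Rightarrow> bool" where
  "pointwise_solution_on \<alpha> m S u \<longleftrightarrow>
     (\<exists>w :: real \<times> 'a \<Rightarrow> 'a.
        (\<forall>t \<in> fst ` S. is_frac_grad \<alpha> (pressure m u t) (\<lambda>x. w (t, x))) \<and>
        continuous_on S w \<and>
        (\<forall>(t, x) \<in> S.
           (\<lambda>x. \<bar>u (t, x)\<bar> *\<^sub>R w (t, x)) differentiable (at x) \<and>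
           ((\<lambda>t. u (t, x)) has_real_derivative
              divergence (\<lambda>x. \<bar>u (t, x)\<bar> *\<^sub>R w (t, x)) x) (at t)))"

definition holder_continuous_at ::
  "real \<Rightarrow> ('a::metric_space \<Rightarrow> 'b::metric_space) \<Rightarrow> 'a \<Rightarrow> bool" where
  "holder_continuous_at \<gamma> f p \<longleftrightarrow> (\<exists>r>0. \<exists>C. \<forall>q\<in>ball p r. \<forall>q'\<in>ball p r.
     dist (f q) (f q') \<le> C * dist q q' powr \<gamma>)"


subsection \<open>The self-similar profile\<close>

definition sim_exponent :: "nat \<Rightarrow> real \<Rightarrow> real \<Rightarrow> real" where
  "sim_exponent d \<alpha> m = 1 / (real d * (m - 1) + \<alpha>)"

definition k_const :: "nat \<Rightarrow> real \<Rightarrow> real \<Rightarrow> real" where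
  "k_const d \<alpha> m = real d * Gamma (real d / 2) /
     ((real d * (m - 1) + \<alpha>) * 2 powr \<alpha> * Gamma (1 + \<alpha> / 2) * Gamma ((real d + \<alpha>) / 2))"

definition profile :: "real \<Rightarrow> real \<Rightarrow> 'a::euclidean_space \<Rightarrow> real" where
  "profile \<alpha> m y =
     (k_const DIM('a) \<alpha> m * max 0 (1 - (norm y)\<^sup>2) powr (\<alpha> / 2)) powr (1 / (m - 1))"

text \<open>Only the values at positive times are meaningful.\<close>

definition barenblatt :: "real \<Rightarrow> real \<Rightarrow> real \<times> 'a::euclidean_space \<Rightarrow> real" where
  "barenblatt \<alpha> m = (\<lambda>(t, x).
     1 / t powr (real DIM('a) * sim_exponent DIM('a) \<alpha> m) *
     profile \<alpha> m (x /\<^sub>R t powr sim_exponent DIM('a) \<alpha> m))"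

end

theory Submission
  imports Defs
begin

text \<open>
Write \<open>d\<close> for the dimension, \<open>D = d / 2\<close>, \<open>a = \<alpha> / 2\<close>, \<open>l\<close> for the similarity exponent and
\<open>r = t powr l\<close>.  By the choice of \<open>l\<close> the pressure \<open>u powr (m - 1)\<close> is
\<open>(k / t) (r\<^sup>2 - |x|\<^sup>2)\<^sub>+ powr a\<close>, a multiple of a truncated power.  Everything rests on one fact: inside the
ball \<open>|x| < r\<close> the fractional gradient \<open>w\<close> of the pressure is the linear field \<open>- (l / t) x\<close>; the value of
\<open>k\<close> is what makes the factor \<open>l / t\<close>.  As \<open>u\<close> vanishes outside this ball, the flux is
\<open>|u| w = - (l / t) u x\<close> everywhere (\<open>barenblatt_flux\<close>), and the fractional operator has disappeared from the
equation.

Given this flux, all three claims are elementary.  Off the interface the equation is checked by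
differentiation.  In the weak form the substitution \<open>x = t powr l y\<close> turns the integral over space into the
integral of the profile, which does not depend on \<open>t\<close>, against \<open>d/dt \<phi> (t, t powr l y)\<close>, so that the
integral over time is given by the fundamental theorem of calculus (\<open>weak_formulation_barenblatt\<close>).  Near the
interface \<open>u\<close> is a smooth function of \<open>t\<close> times the power \<open>a / (m - 1)\<close> of the positive part of a Lipschitz
function.

The fractional gradient of \<open>(\<rho> - |y|\<^sup>2)\<^sub>+ powr a\<close> with \<open>a < 1\<close> is found as a superposition of balls,
\<open>w(y) = - 2 c y \<mu> {Q. |y|\<^sup>2 < \<rho> Q}\<close>, where \<open>\<mu>\<close> has the density \<open>Q powr (- D - 1) (Q - 1) powr (- a)\<close>
on \<open>Q > 1\<close>.  All these balls contain the ball \<open>|y|\<^sup>2 < \<rho>\<close>, which is why \<open>w\<close> is linear there.  Since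
\<open>- 2 y\<close> on the ball \<open>|y|\<^sup>2 < Q\<close> is the gradient of \<open>(Q - |y|\<^sup>2)\<^sub>+\<close>, the claim about \<open>w\<close> is the identity
\<open>|\<xi>| powr (2 a - 2) * F[(\<rho> - |y|\<^sup>2)\<^sub>+ powr a] \<xi> = c * (\<integral> F[(\<rho> Q - |y|\<^sup>2)\<^sub>+] \<xi> d\<mu>(Q))\<close> for \<open>\<xi> \<noteq> 0\<close>
of Fourier transforms (\<open>riesz_potential_truncated_power\<close>); in terms of Bessel functions it is Sonine's second
integral.  It is proved without Bessel functions.  Both sides are radial and continuous for \<open>\<xi> \<noteq> 0\<close>, so by
Weierstrass approximation in the variable \<open>exp (- |\<xi>|\<^sup>2)\<close> they agree once their integrals against
\<open>|\<xi>|\<^sup>2 exp (- s |\<xi>|\<^sup>2)\<close> agree for \<open>s = 1, 2, \<dots>\<close> (\<open>radial_gaussian_moments_zero\<close>).  Parseval moves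
these integrals to the variable \<open>y\<close>, where both of them reduce to the incomplete Gamma integral
\<open>\<integral> q powr (D + a - 1) exp (- q / (4 s)) dq\<close> over \<open>0 < q < \<rho>\<close> by changes of the order of integration
(\<open>gaussian_test_tail_potential\<close>, \<open>gaussian_test_riesz_potential\<close>).  The exchange of the \<open>\<mu>\<close>-integral
with the \<open>\<xi>\<close>-integral needs the decay of \<open>F[(Q - |y|\<^sup>2)\<^sub>+]\<close> proved in \<open>cosine_transform_decay\<close>.  For
\<open>\<alpha> = 2\<close> the fractional gradient is the classical one and only the gradient of \<open>(Q - |y|\<^sup>2)\<^sub>+\<close> is needed.
\<close>

section \<open>Integration on Euclidean space\<close>

lemma (in pair_sigma_finite) integrable_dominated_by_product:
  fixes f :: "'a \<Rightarrow> 'b \<Rightarrow> 'c::{banach, second_countable_topology}"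
  assumes f [measurable]: "case_prod f \<in> borel_measurable (M1 \<Otimes>\<^sub>M M2)"
    and g: "integrable M1 g" and h: "integrable M2 h"
    and bound: "\<And>x y. norm (f x y) \<le> g x * (h y :: real)"
  shows "integrable (M1 \<Otimes>\<^sub>M M2) (case_prod f)"
proof -
  note [measurable] = borel_measurable_integrable[OF g] borel_measurable_integrable[OF h]
  have "integrable (M1 \<Otimes>\<^sub>M M2) (\<lambda>(x, y). g x * h y)"
  proof (rule Fubini_integrable)
    have "integrable M1 (\<lambda>x. \<bar>g x\<bar> * (\<integral>y. \<bar>h y\<bar> \<partial>M2))"
      using g by (intro integrable_mult_left integrable_abs)
    then show "integrable M1 (\<lambda>x. \<integral>y. norm (case (x, y) of (x, y) \<Rightarrow> g x * h y) \<partial>M2)"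
      by (simp add: abs_mult)
    show "AE x in M1. integrable M2 (\<lambda>y. case (x, y) of (x, y) \<Rightarrow> g x * h y)"
      using h by auto
  qed measurable
  then show ?thesis
    by (rule Bochner_Integration.integrable_bound)
      (auto intro!: AE_I2 order_trans[OF bound abs_ge_self])
qed

lemma lborel_distr_uminus_euclidean:
  "distr lborel borel uminus = (lborel :: 'a::euclidean_space measure)"
  by (subst (2) lborel_affine[of "-1" "0::'a"]) (simp_all add: density_1 one_ennreal_def[symmetric])

lemma integral_lborel_uminus:
  fixes f :: "'a::euclidean_space \<Rightarrow> 'b::{banach, second_countable_topology}"
  assumes [measurable]: "f \<in> borel_measurable borel"
  shows "(LBINT x. f (- x)) = (LBINT x. f x)"
  by (subst (2) lborel_distr_uminus_euclidean[symmetric]) (simp add: integral_distr)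

lemma integral_lborel_odd:
  fixes f :: "'a::euclidean_space \<Rightarrow> 'b::{banach, second_countable_topology}"
  assumes [measurable]: "f \<in> borel_measurable borel" and "\<And>x. f (- x) = - f x"
  shows "(LBINT x. f x) = 0"
proof -
  have "(LBINT x. f x) = - (LBINT x. f x)"
    using integral_lborel_uminus[of f] assms by simp
  then have "2 *\<^sub>R (LBINT x. f x) = 0"
    by (metis add.right_inverse scaleR_2)
  then show ?thesis by simp
qed

lemma integral_lborel_translate:
  fixes f :: "'a::euclidean_space \<Rightarrow> 'b::{banach, second_countable_topology}"
  assumes [measurable]: "f \<in> borel_measurable borel"
  shows "(LBINT x. f (x + c)) = (LBINT x. f x)"
  by (subst (2) lborel_distr_plus[of c, symmetric]) (simp add: integral_distr add.commute)

lemma integrable_lborel_translate: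
  fixes f :: "'a::euclidean_space \<Rightarrow> 'b::{banach, second_countable_topology}"
  assumes "integrable lborel f"
  shows "integrable lborel (\<lambda>x. f (x + c))"
proof -
  have [measurable]: "f \<in> borel_measurable borel"
    using assms by auto
  have "integrable (distr lborel borel ((+) c)) f"
    using assms by (simp add: lborel_distr_plus)
  then show ?thesis
    by (subst (asm) integrable_distr_eq) (simp_all add: add.commute)
qed

lemma nn_integral_Gamma:
  fixes z p :: real
  assumes "0 < z" "0 < p"
  shows "(\<integral>\<^sup>+x\<in>{0<..}. ennreal (x powr (z - 1) * exp (- (p * x))) \<partial>lborel) = ennreal (Gamma z / p powr z)"
proof -
  have "ennreal (Gamma z) = (\<integral>\<^sup>+x. ennreal (indicator {0..} x * x powr (z - 1) / exp x) \<partial>lborel)"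
    using assms by (subst Gamma_conv_nn_integral_real) simp_all
  also have "\<dots> = (\<integral>\<^sup>+x. ennreal (indicator {0<..} x * x powr (z - 1) * exp (- x)) \<partial>lborel)"
    by (intro nn_integral_cong) (auto simp: exp_minus field_simps split: split_indicator)
  also have "\<dots> = ennreal p * (\<integral>\<^sup>+x. ennreal (indicator {0<..} (p * x) * (p * x) powr (z - 1) * exp (- (p * x))) \<partial>lborel)"
    using assms by (subst nn_integral_real_affine[of _ p 0]) simp_all
  also have "\<dots> = (\<integral>\<^sup>+x. ennreal (p powr z) * (ennreal (x powr (z - 1) * exp (- (p * x))) * indicator {0<..} x) \<partial>lborel)"
    using assms
    by (subst nn_integral_cmult[symmetric], measurable)
      (auto intro!: nn_integral_cong simp: indicator_def powr_mult zero_less_mult_iff powr_diff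
         ennreal_mult'[symmetric])
  also have "\<dots> = ennreal (p powr z) * (\<integral>\<^sup>+x\<in>{0<..}. ennreal (x powr (z - 1) * exp (- (p * x))) \<partial>lborel)"
    by (intro nn_integral_cmult) measurable
  finally have *: "ennreal (Gamma z) = ennreal (p powr z) * (\<integral>\<^sup>+x\<in>{0<..}. ennreal (x powr (z - 1) * exp (- (p * x))) \<partial>lborel)" .
  have "ennreal (Gamma z / p powr z) = ennreal (1 / p powr z) * ennreal (Gamma z)"
    using assms by (simp add: ennreal_mult'[symmetric])
  also have "\<dots> = (ennreal (1 / p powr z) * ennreal (p powr z)) * (\<integral>\<^sup>+x\<in>{0<..}. ennreal (x powr (z - 1) * exp (- (p * x))) \<partial>lborel)"
    unfolding * by (simp add: mult.assoc)
  also have "ennreal (1 / p powr z) * ennreal (p powr z) = 1"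
    using assms by (simp add: ennreal_mult'[symmetric])
  finally show ?thesis by simp
qed

text \<open>
  The value does not depend on \<open>Y\<close> because the two exponents add up to \<open>-1\<close>.
\<close>

lemma nn_integral_Beta_complement:
  fixes a Y :: real
  assumes "0 < a" "a < 1" "0 < Y"
  shows "(\<integral>\<^sup>+y\<in>{0<..<Y}. ennreal (y powr (- a) * (Y - y) powr (a - 1)) \<partial>lborel)
      = ennreal (Gamma a * Gamma (1 - a))"
proof -
  have "((\<lambda>t. t powr ((1 - a) - 1) * (1 - t) powr (a - 1)) has_integral Beta (1 - a) a) {0<..<1}"
    using has_integral_Beta_real[of "1 - a" a] assms by (simp only: has_integral_Icc_iff_Ioo)
  then have "((\<lambda>t. if t \<in> {0<..<1} then t powr (- a) * (1 - t) powr (a - 1) else 0) has_integral Beta (1 - a) a) UNIV"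
    by (subst has_integral_restrict_UNIV) simp
  then have "((\<lambda>t. indicator {0<..<1} t * (t powr (- a) * (1 - t) powr (a - 1))) has_integral Beta (1 - a) a) UNIV"
    by (rule has_integral_eq[rotated]) auto
  then have "(\<integral>\<^sup>+t. ennreal (indicator {0<..<1} t * (t powr (- a) * (1 - t) powr (a - 1))) \<partial>lborel) = ennreal (Beta (1 - a) a)"
    by (intro nn_integral_has_integral_lborel) auto
  also have "Beta (1 - a) a = Gamma a * Gamma (1 - a)"
    by (simp add: Beta_def)
  finally have *: "(\<integral>\<^sup>+t. ennreal (indicator {0<..<1} t * (t powr (- a) * (1 - t) powr (a - 1))) \<partial>lborel) = ennreal (Gamma a * Gamma (1 - a))" .
  have "(\<integral>\<^sup>+y\<in>{0<..<Y}. ennreal (y powr (- a) * (Y - y) powr (a - 1)) \<partial>lborel)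
     = ennreal Y * (\<integral>\<^sup>+t. ennreal ((Y * t) powr (- a) * (Y - Y * t) powr (a - 1)) * indicator {0<..<Y} (Y * t) \<partial>lborel)"
    using assms by (subst nn_integral_real_affine[of _ Y 0]) simp_all
  also have "\<dots> = (\<integral>\<^sup>+t. ennreal Y * (ennreal ((Y * t) powr (- a) * (Y - Y * t) powr (a - 1)) * indicator {0<..<Y} (Y * t)) \<partial>lborel)"
    by (intro nn_integral_cmult[symmetric]) measurable
  also have "\<dots> = (\<integral>\<^sup>+t. ennreal (indicator {0<..<1} t * (t powr (- a) * (1 - t) powr (a - 1))) \<partial>lborel)"
  proof (intro nn_integral_cong)
    fix t :: real
    have "Y * t < Y \<longleftrightarrow> t < 1"
      using mult_less_cancel_left_pos[of Y t 1] assms by simp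
    moreover have "Y * ((Y * t) powr (- a) * (Y - Y * t) powr (a - 1)) = t powr (- a) * (1 - t) powr (a - 1)"
      if "0 < t" "t < 1"
    proof -
      have "(Y - Y * t) powr (a - 1) = Y powr (a - 1) * (1 - t) powr (a - 1)"
        using that assms by (subst powr_mult[symmetric]) (auto simp: algebra_simps)
      moreover have "(Y * t) powr (- a) = Y powr (-a) * t powr (- a)"
        using that assms by (simp add: powr_mult)
      moreover have "Y * (Y powr (-a) * Y powr (a - 1)) = 1"
      proof -
        have "Y powr (-a) * Y powr (a - 1) = Y powr (- 1)"
          by (subst powr_add[symmetric]) simp
        also have "\<dots> = inverse Y"
          using assms by (simp add: powr_minus)
        finally show ?thesis using assms by simp
      qed
      moreover have "Y * ((Y powr (-a) * t powr (- a)) * (Y powr (a - 1) * (1 - t) powr (a - 1)))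
          = (Y * (Y powr (-a) * Y powr (a - 1))) * (t powr (- a) * (1 - t) powr (a - 1))"
        by (simp only: mult_ac)
      ultimately show ?thesis by simp
    qed
    ultimately show "ennreal Y * (ennreal ((Y * t) powr (- a) * (Y - Y * t) powr (a - 1)) * indicator {0<..<Y} (Y * t))
       = ennreal (indicator {0<..<1} t * (t powr (- a) * (1 - t) powr (a - 1)))"
      using assms by (auto simp: indicator_def zero_less_mult_iff ennreal_mult'[symmetric] simp del: mult_less_cancel_left1)
  qed
  finally show ?thesis using * by simp
qed

text \<open>
  Density of the image of Lebesgue measure under \<open>y \<mapsto> |y|\<^sup>2\<close> in dimension \<open>2 D\<close>, that is, the derivative
  of the volume of the ball of radius \<open>sqrt q\<close> with respect to \<open>q\<close>.
\<close>

definition norm_sq_density :: "real \<Rightarrow> real \<Rightarrow> real" where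
  "norm_sq_density D q = (if 0 < q then pi powr D / Gamma D * q powr (D - 1) else 0)"

lemma norm_sq_density_nonneg: "0 < D \<Longrightarrow> 0 \<le> norm_sq_density D q"
  by (simp add: norm_sq_density_def Gamma_real_pos less_imp_le)

lemma measurable_norm_sq_density [measurable]: "norm_sq_density D \<in> borel_measurable borel"
  unfolding norm_sq_density_def by measurable

lemma distr_norm_sq:
  "distr lborel borel (\<lambda>y::'a::euclidean_space. (norm y)\<^sup>2)
     = density lborel (\<lambda>q. ennreal (norm_sq_density (real DIM('a) / 2) q))" (is "?L = ?R")
proof (rule measure_eqI_generator_eq)
  let ?D = "real DIM('a) / 2"
  have D: "0 < ?D" by simp
  show "Int_stable (range (\<lambda>a::real. {..a}))"
    by (auto simp: Int_stable_def)
  show "range (\<lambda>a::real. {..a}) \<subseteq> Pow UNIV" by simp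
  show "sets ?L = sigma_sets UNIV (range (\<lambda>a::real. {..a}))"
    by (simp add: borel_eq_atMost)
  show "sets ?R = sigma_sets UNIV (range (\<lambda>a::real. {..a}))"
    by (simp add: borel_eq_atMost)
  show "range (\<lambda>i::nat. {..real i}) \<subseteq> range (\<lambda>a::real. {..a})" by auto
  show "(\<Union>i. {..real i}) = UNIV"
    using real_arch_simple by auto
  have L: "emeasure ?L {..c} = ennreal (if 0 \<le> c then unit_ball_vol DIM('a) * c powr ?D else 0)" for c :: real
  proof (cases "0 \<le> c")
    case True
    have "emeasure ?L {..c} = emeasure lborel (cball (0::'a) (sqrt c))"
    proof -
      have "(norm y)\<^sup>2 \<le> c \<longleftrightarrow> norm y \<le> sqrt c" for y :: 'a
        using real_le_rsqrt[of "norm y" c] sqrt_ge_absD[of "norm y" c] by auto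
      then have "(\<lambda>y::'a. (norm y)\<^sup>2) -` {..c} = cball 0 (sqrt c)"
        by auto
      then show ?thesis by (subst emeasure_distr) simp_all
    qed
    also have "\<dots> = ennreal (unit_ball_vol DIM('a) * sqrt c ^ DIM('a))"
      using True by (intro emeasure_cball) simp
    also have "sqrt c ^ DIM('a) = c powr ?D"
    proof (cases "c = 0")
      case False
      then show ?thesis using True
        by (simp add: powr_half_sqrt[symmetric] powr_realpow[symmetric] powr_powr)
    qed simp
    finally show ?thesis using True by simp
  next
    case False
    then have "(\<lambda>y::'a. (norm y)\<^sup>2) -` {..c} = {}"
      by (auto simp: not_le) (meson not_less order_trans zero_le_power2)
    then show ?thesis using False
      by (subst emeasure_distr) auto
  qed
  show "emeasure ?L {..real i} \<noteq> \<infinity>" for i :: nat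
    unfolding L by simp
  fix X assume "X \<in> range (\<lambda>a::real. {..a})"
  then obtain c where X: "X = {..c}" by auto
  have "emeasure ?R {..c} = (\<integral>\<^sup>+q. ennreal (norm_sq_density ?D q * indicator {..c} q) \<partial>lborel)"
    by (subst emeasure_density) (auto intro!: nn_integral_cong split: split_indicator)
  also have "\<dots> = ennreal (if 0 \<le> c then pi powr ?D / Gamma ?D * (c powr ?D / ?D) else 0)"
  proof (cases "0 \<le> c")
    case True
    have "((\<lambda>x. x powr (?D - 1)) has_integral (c powr ((?D - 1) + 1) / ((?D - 1) + 1))) {0..c}"
      using True by (intro has_integral_powr_from_0) simp_all
    then have "((\<lambda>x. pi powr ?D / Gamma ?D * x powr (?D - 1)) has_integral pi powr ?D / Gamma ?D * (c powr ?D / ?D)) {0..c}"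
      by (intro has_integral_mult_right) simp
    then have "((\<lambda>x. if x \<in> {0..c} then pi powr ?D / Gamma ?D * x powr (?D - 1) else 0) has_integral pi powr ?D / Gamma ?D * (c powr ?D / ?D)) UNIV"
      by (subst has_integral_restrict_UNIV)
    then have "((\<lambda>q. norm_sq_density ?D q * indicator {..c} q) has_integral pi powr ?D / Gamma ?D * (c powr ?D / ?D)) UNIV"
      by (rule has_integral_eq[rotated]) (auto simp: norm_sq_density_def split: split_indicator)
    then show ?thesis using True norm_sq_density_nonneg[OF D]
      by (subst nn_integral_has_integral_lborel) auto
  next
    case False
    then have "norm_sq_density ?D q * indicator {..c} q = 0" for q
      by (auto simp: norm_sq_density_def split: split_indicator)
    then have "(\<integral>\<^sup>+q. ennreal (norm_sq_density ?D q * indicator {..c} q) \<partial>lborel) = (\<integral>\<^sup>+(q::real). 0 \<partial>lborel)"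
      by (intro nn_integral_cong) (simp only: ennreal_0)
    then show ?thesis using False by simp
  qed
  also have "pi powr ?D / Gamma ?D * (c powr ?D / ?D) = unit_ball_vol DIM('a) * c powr ?D"
  proof -
    have "Gamma (?D + 1) = ?D * Gamma ?D"
      using D by (intro Gamma_plus1) (auto dest: nonpos_Ints_nonpos)
    then show ?thesis
      unfolding unit_ball_vol_def by (simp only: times_divide_times_eq times_divide_eq_left times_divide_eq_right divide_divide_eq_left) (simp only: mult_ac)
  qed
  finally show "emeasure ?L X = emeasure ?R X"
    unfolding X L by simp
qed

lemma nn_integral_radial:
  fixes h :: "real \<Rightarrow> ennreal"
  assumes [measurable]: "h \<in> borel_measurable borel"
  shows "(\<integral>\<^sup>+y. h ((norm (y::'a::euclidean_space))\<^sup>2) \<partial>lborel)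
     = (\<integral>\<^sup>+q. ennreal (norm_sq_density (real DIM('a) / 2) q) * h q \<partial>lborel)"
proof -
  have "(\<integral>\<^sup>+y. h ((norm (y::'a))\<^sup>2) \<partial>lborel) = (\<integral>\<^sup>+q. h q \<partial>distr lborel borel (\<lambda>y::'a. (norm y)\<^sup>2))"
    by (subst nn_integral_distr) simp_all
  also have "\<dots> = (\<integral>\<^sup>+q. ennreal (norm_sq_density (real DIM('a) / 2) q) * h q \<partial>lborel)"
    unfolding distr_norm_sq by (subst nn_integral_density) simp_all
  finally show ?thesis .
qed

lemma integral_radial:
  fixes h :: "real \<Rightarrow> real"
  assumes [measurable]: "h \<in> borel_measurable borel"
  shows "(LBINT y. h ((norm (y::'a::euclidean_space))\<^sup>2))
     = (LBINT q. norm_sq_density (real DIM('a) / 2) q * h q)"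
proof -
  have "(LBINT y. h ((norm (y::'a))\<^sup>2)) = (\<integral>q. h q \<partial>distr lborel borel (\<lambda>y::'a. (norm y)\<^sup>2))"
    by (subst integral_distr) simp_all
  also have "\<dots> = (LBINT q. norm_sq_density (real DIM('a) / 2) q * h q)"
    unfolding distr_norm_sq
    by (subst integral_density) (auto simp: norm_sq_density_nonneg)
  finally show ?thesis .
qed

lemma nn_integral_gaussian:
  fixes s :: real
  assumes "0 < s"
  shows "(\<integral>\<^sup>+y. ennreal (exp (- (s * (norm (y::'a::euclidean_space))\<^sup>2))) \<partial>lborel)
     = ennreal ((pi / s) powr (real DIM('a) / 2))"
proof -
  let ?D = "real DIM('a) / 2"
  have "(\<integral>\<^sup>+y. ennreal (exp (- (s * (norm (y::'a))\<^sup>2))) \<partial>lborel)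
      = (\<integral>\<^sup>+q. ennreal (norm_sq_density ?D q) * ennreal (exp (- (s * q))) \<partial>lborel)"
    by (subst nn_integral_radial[of "\<lambda>q. ennreal (exp (- (s * q)))"]) simp_all
  also have "\<dots> = (\<integral>\<^sup>+q. ennreal (pi powr ?D / Gamma ?D) * (ennreal (q powr (?D - 1) * exp (- (s * q))) * indicator {0<..} q) \<partial>lborel)"
    by (intro nn_integral_cong)
      (auto simp: norm_sq_density_def ennreal_mult'[symmetric] Gamma_real_pos less_imp_le split: split_indicator)
  also have "\<dots> = ennreal (pi powr ?D / Gamma ?D) * ennreal (Gamma ?D / s powr ?D)"
    using assms by (subst nn_integral_cmult) (simp_all add: nn_integral_Gamma)
  also have "\<dots> = ennreal ((pi / s) powr ?D)"
  proof -
    have *: "pi powr ?D / G * (G / s powr ?D) = (pi / s) powr ?D" if "0 < G" for G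
      using assms that by (simp add: powr_divide)
    have "0 < Gamma ?D" by (intro Gamma_real_pos) simp
    then show ?thesis
      using *[of "Gamma ?D"] by (subst ennreal_mult'[symmetric]) simp_all
  qed
  finally show ?thesis .
qed

lemma integrable_gaussian:
  assumes "0 < (s::real)"
  shows "integrable lborel (\<lambda>y::'a::euclidean_space. exp (- (s * (norm y)\<^sup>2)))"
  using assms by (intro integrableI_bounded) (simp_all add: nn_integral_gaussian)

lemma integral_gaussian:
  assumes "0 < (s::real)"
  shows "(LBINT y. exp (- (s * (norm (y::'a::euclidean_space))\<^sup>2))) = (pi / s) powr (real DIM('a) / 2)"
  using assms by (subst integral_eq_nn_integral) (simp_all add: nn_integral_gaussian)

text \<open>
  Integrating the fundamental theorem of calculus on the segments from \<open>x\<close> to \<open>x + b\<close> over all \<open>x\<close> gives on one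
  side the difference of two equal integrals of \<open>f\<close>, on the other side, by Fubini, the integral of \<open>f'\<close>.  The
  exceptional sets \<open>S x\<close> admit functions with a kink along a sphere.  All integrations by parts in the
  space variable below are instances of this lemma.
\<close>

lemma integral_directional_derivative_eq_0:
  fixes f f' :: "'a::euclidean_space \<Rightarrow> 'b::euclidean_space"
  assumes f: "integrable lborel f" and f': "integrable lborel f'"
    and cont: "\<And>x. continuous_on {0..1} (\<lambda>t. f (x + t *\<^sub>R b))"
    and fin: "\<And>x. finite (S x)"
    and der: "\<And>x t. t \<in> {0<..<1} - S x \<Longrightarrow>
      ((\<lambda>t. f (x + t *\<^sub>R b)) has_vector_derivative f' (x + t *\<^sub>R b)) (at t)"
  shows "(LBINT x. f' x) = 0"
proof -
  have [measurable]: "f \<in> borel_measurable borel" "f' \<in> borel_measurable borel"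
    using f f' by auto
  define g where "g = (\<lambda>(t::real) x. indicator {0..1} t *\<^sub>R f' (x + t *\<^sub>R b))"
  have int: "integrable (lborel \<Otimes>\<^sub>M lborel) (case_prod g)"
  proof (rule lborel_pair.Fubini_integrable)
    show "case_prod g \<in> borel_measurable (lborel \<Otimes>\<^sub>M lborel)"
      unfolding g_def by measurable
    have "(LBINT x. norm (case (t, x) of (t, x) \<Rightarrow> g t x)) = (LBINT x. norm (f' x)) * indicator {0..1} t" for t
      using integral_lborel_translate[of "\<lambda>x. norm (f' x)" "t *\<^sub>R b"] unfolding g_def
      by (auto split: split_indicator)
    then show "integrable lborel (\<lambda>t. LBINT x. norm (case (t, x) of (t, x) \<Rightarrow> g t x))"
      by simp
    show "AE t in lborel. integrable lborel (\<lambda>x. case (t, x) of (t, x) \<Rightarrow> g t x)"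
      unfolding g_def using integrable_lborel_translate[OF f'] by auto
  qed
  have "AE x in lborel. (LBINT t. g t x) = f (x + b) - f x"
    using lborel_pair.AE_integrable_snd[OF int]
  proof eventually_elim
    fix x assume "integrable lborel (\<lambda>t. g t x)"
    then have "((\<lambda>t. g t x) has_integral (LBINT t. g t x)) UNIV"
      by (rule has_integral_integral_lborel)
    moreover have "((\<lambda>t. f' (x + t *\<^sub>R b)) has_integral f (x + 1 *\<^sub>R b) - f (x + 0 *\<^sub>R b)) {0..1}"
      by (rule fundamental_theorem_of_calculus_interior_strong[of "S x"]) (use fin der cont in auto)
    then have "((\<lambda>t. if t \<in> {0..1} then f' (x + t *\<^sub>R b) else 0) has_integral f (x + b) - f x) UNIV"
      by (subst has_integral_restrict_UNIV) simp
    then have "((\<lambda>t. g t x) has_integral f (x + b) - f x) UNIV"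
      by (rule has_integral_eq[rotated]) (auto simp: g_def)
    ultimately show "(LBINT t. g t x) = f (x + b) - f x"
      by (rule has_integral_unique)
  qed
  then have "(LBINT x. LBINT t. g t x) = (LBINT x. f (x + b) - f x)"
    by (intro integral_cong_AE) (auto simp: g_def)
  also have "\<dots> = 0"
    using f integrable_lborel_translate[OF f, of b] integral_lborel_translate[of f b] by simp
  finally have "0 = (LBINT t. LBINT x. g t x)"
    using lborel_pair.Fubini_integral[OF int] by simp
  also have "(\<lambda>t. LBINT x. g t x) = (\<lambda>t. indicator {0..1} t *\<^sub>R (LBINT x. f' x))"
    using integral_lborel_translate[of f'] unfolding g_def by simp
  also have "(LBINT (t::real). indicator {0..1} t *\<^sub>R (LBINT x. f' x)) = (LBINT x. f' x)"
    by (subst integral_scaleR_left) simp_all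
  finally show ?thesis by simp
qed

lemma has_real_derivative_integral:
  fixes f f' :: "real \<Rightarrow> 'a \<Rightarrow> real"
  assumes int: "\<And>t. t \<in> {a<..<b} \<Longrightarrow> integrable M (f t)"
    and der: "\<And>t x. t \<in> {a<..<b} \<Longrightarrow> ((\<lambda>t. f t x) has_real_derivative f' t x) (at t)"
    and bound: "\<And>t x. t \<in> {a<..<b} \<Longrightarrow> \<bar>f' t x\<bar> \<le> g x"
    and g: "integrable M g" and f': "f' t0 \<in> borel_measurable M" and t0: "t0 \<in> {a<..<b}"
  shows "((\<lambda>t. \<integral>x. f t x \<partial>M) has_real_derivative (\<integral>x. f' t0 x \<partial>M)) (at t0)"
  unfolding has_field_derivative_iff
proof (rule Lim_transform_within_open[where s="{a<..<b}"])
  let ?q = "\<lambda>t x. (f t x - f t0 x) / (t - t0)"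
  have q_bound: "\<bar>?q t x\<bar> \<le> g x" if t: "t \<in> {a<..<b}" for t x
  proof (cases "t = t0")
    case True
    with bound[OF t0, of x] show ?thesis by simp
  next
    case False
    have "norm (f t x - f t0 x) \<le> g x * norm (t - t0)"
    proof (rule field_differentiable_bound[where S="{a<..<b}"])
      show "convex {a<..<b}" by simp
      show "((\<lambda>t. f t x) has_field_derivative f' t x) (at t within {a<..<b})" if "t \<in> {a<..<b}" for t
        using der[OF that] by (rule has_field_derivative_at_within)
    qed (use bound t t0 in auto)
    then show ?thesis using False by (simp add: divide_simps)
  qed
  show "((\<lambda>t. \<integral>x. (if t \<in> {a<..<b} then ?q t x else 0) \<partial>M) \<longlongrightarrow> (\<integral>x. f' t0 x \<partial>M)) (at t0)"
    unfolding tendsto_at_iff_sequentially comp_def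
  proof (intro allI impI)
    fix X :: "nat \<Rightarrow> real" assume X: "\<forall>i. X i \<in> UNIV - {t0}" "X \<longlonglongrightarrow> t0"
    have ev: "eventually (\<lambda>i. X i \<in> {a<..<b}) sequentially"
      using topological_tendstoD[OF X(2), of "{a<..<b}"] t0 by auto
    show "(\<lambda>i. \<integral>x. (if X i \<in> {a<..<b} then ?q (X i) x else 0) \<partial>M) \<longlonglongrightarrow> (\<integral>x. f' t0 x \<partial>M)"
    proof (rule integral_dominated_convergence[where w=g])
      show "AE x in M. (\<lambda>i. if X i \<in> {a<..<b} then ?q (X i) x else 0) \<longlonglongrightarrow> f' t0 x"
      proof (rule AE_I2)
        fix x
        have "((\<lambda>t. ?q t x) \<longlongrightarrow> f' t0 x) (at t0)"
          using der[OF t0, of x] by (simp add: has_field_derivative_iff)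
        then have "(\<lambda>i. ?q (X i) x) \<longlonglongrightarrow> f' t0 x"
          using X unfolding tendsto_at_iff_sequentially comp_def by blast
        then show "(\<lambda>i. if X i \<in> {a<..<b} then ?q (X i) x else 0) \<longlonglongrightarrow> f' t0 x"
          by (rule Lim_transform_eventually) (use ev in eventually_elim, auto)
      qed
      show "AE x in M. norm (if X i \<in> {a<..<b} then ?q (X i) x else 0) \<le> g x" for i
        using q_bound[of "X i"] q_bound[OF t0] by auto
      show "(\<lambda>x. if X i \<in> {a<..<b} then ?q (X i) x else 0) \<in> borel_measurable M" for i
        using int[of "X i"] int[OF t0] by (cases "X i \<in> {a<..<b}") auto
    qed (use g f' in auto)
  qed
  show "(\<integral>x. (if t \<in> {a<..<b} then ?q t x else 0) \<partial>M) = ((\<integral>x. f t x \<partial>M) - (\<integral>x. f t0 x \<partial>M)) / (t - t0)"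
    if "t \<in> {a<..<b}" "t \<noteq> t0" for t
    using that int[OF that(1)] int[OF t0] by simp
qed (use t0 in auto)

text \<open>
  The moments are integrals against powers of \<open>exp (- X)\<close>, which takes values in \<open>[0, 1]\<close>; by Weierstrass
  approximation the powers may be replaced by any continuous function of \<open>exp (- X)\<close>.
\<close>

lemma exponential_moments_zero:
  fixes f X :: "'a \<Rightarrow> real" and \<phi> :: "real \<Rightarrow> real"
  assumes [measurable]: "X \<in> borel_measurable M" and X: "\<And>x. 0 \<le> X x"
    and int: "integrable M (\<lambda>x. f x * exp (- X x))"
    and moments: "\<And>n::nat. (\<integral>x. f x * exp (- (real (Suc n) * X x)) \<partial>M) = 0"
    and \<phi>: "continuous_on {0..1} \<phi>" and [measurable]: "(\<lambda>x. \<phi> (exp (- X x))) \<in> borel_measurable M"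
  shows "(\<integral>x. f x * exp (- X x) * \<phi> (exp (- X x)) \<partial>M) = 0"
proof -
  let ?g = "\<lambda>x. f x * exp (- X x)" and ?z = "\<lambda>x. exp (- X x)"
  have z: "?z x \<in> {0..1}" for x using X by auto
  obtain C where C: "\<And>z. z \<in> {0..1} \<Longrightarrow> \<bar>\<phi> z\<bar> \<le> C"
  proof -
    have "bounded (\<phi> ` {0..1})"
      using compact_imp_bounded[OF compact_continuous_image[OF \<phi>]] by simp
    then obtain C where "\<forall>z\<in>\<phi> ` {0..1}. norm z \<le> C"
      by (auto simp: bounded_iff)
    then show ?thesis using that[of C] by auto
  qed
  have int_mult: "integrable M (\<lambda>x. ?g x * h x)"
    if [measurable]: "h \<in> borel_measurable M" and h: "\<And>x. \<bar>h x\<bar> \<le> B" for h :: "'a \<Rightarrow> real" and B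
  proof (rule Bochner_Integration.integrable_bound[OF integrable_mult_right[OF int, of B]])
    show "AE x in M. norm (?g x * h x) \<le> norm (B * ?g x)"
      using order_trans[OF h abs_ge_self]
      by (intro AE_I2) (simp add: abs_mult mult.commute[of "\<bar>B\<bar>"] mult_left_mono)
  qed (use int in measurable)
  have "\<bar>\<integral>x. ?g x * \<phi> (?z x) \<partial>M\<bar> \<le> e * (\<integral>x. \<bar>?g x\<bar> \<partial>M)" if e: "0 < e" for e
  proof -
    obtain p where p: "real_polynomial_function p" "\<And>z. z \<in> {0..1} \<Longrightarrow> \<bar>\<phi> z - p z\<bar> < e"
      by (rule Stone_Weierstrass_real_polynomial_function[OF compact_Icc \<phi> e]) blast
    obtain c n where pc: "p = (\<lambda>z. \<Sum>i\<le>(n::nat). c i * z ^ i)"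
      using p(1) unfolding real_polynomial_function_iff_sum by blast
    have pow: "integrable M (\<lambda>x. ?g x * ?z x ^ i)" for i
      by (rule int_mult[where B=1]) (use X in \<open>auto simp: power_le_one\<close>)
    have "?g x * ?z x ^ i = f x * exp (- (real (Suc i) * X x))" for i x
      by (simp add: exp_of_nat_mult[symmetric] mult.assoc mult_exp_exp) (simp add: algebra_simps)
    then have "(\<integral>x. ?g x * ?z x ^ i \<partial>M) = 0" for i
      using moments[of i] by (simp only:)
    moreover have "?g x * p (?z x) = (\<Sum>i\<le>n. c i * (?g x * ?z x ^ i))" for x
      unfolding pc sum_distrib_left by (intro sum.cong refl) (simp only: mult_ac)
    moreover have "integrable M (\<lambda>x. c i * (?g x * ?z x ^ i))" for i
      by (intro integrable_mult_right pow)
    ultimately have p0: "(\<integral>x. ?g x * p (?z x) \<partial>M) = 0" and pint: "integrable M (\<lambda>x. ?g x * p (?z x))"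
      by (simp_all only: Bochner_Integration.integral_sum Bochner_Integration.integrable_sum
          integral_mult_right_zero mult_zero_right sum.neutral_const)
    have \<phi>int: "integrable M (\<lambda>x. ?g x * \<phi> (?z x))"
      by (rule int_mult[where B=C]) (use C[OF z] in auto)
    have eq: "(\<integral>x. ?g x * \<phi> (?z x) \<partial>M) = (\<integral>x. ?g x * \<phi> (?z x) - ?g x * p (?z x) \<partial>M)"
      using p0 pint \<phi>int by simp
    have "\<bar>\<integral>x. ?g x * \<phi> (?z x) \<partial>M\<bar> \<le> (\<integral>x. \<bar>?g x * \<phi> (?z x) - ?g x * p (?z x)\<bar> \<partial>M)"
      using integral_norm_bound[of M "\<lambda>x. ?g x * \<phi> (?z x) - ?g x * p (?z x)"]
      unfolding eq real_norm_def .
    also have "\<dots> \<le> (\<integral>x. e * \<bar>?g x\<bar> \<partial>M)"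
    proof (rule integral_mono)
      show "\<bar>?g x * \<phi> (?z x) - ?g x * p (?z x)\<bar> \<le> e * \<bar>?g x\<bar>" for x
      proof -
        have "\<bar>g * (\<phi> (?z x) - p (?z x))\<bar> \<le> \<bar>g\<bar> * e" for g
          unfolding abs_mult by (intro mult_left_mono less_imp_le p z abs_ge_zero)
        from this[of "?g x"] show ?thesis
          unfolding right_diff_distrib[symmetric] mult.commute[of e] .
      qed
    qed (intro integrable_abs integrable_mult_right Bochner_Integration.integrable_diff pint \<phi>int int)+
    finally show ?thesis by simp
  qed
  then have "\<bar>\<integral>x. ?g x * \<phi> (?z x) \<partial>M\<bar> \<le> 0 + e" if "0 < e" for e
  proof -
    let ?I = "\<integral>x. \<bar>?g x\<bar> \<partial>M"
    have I0: "0 \<le> ?I" by simp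
    then have I: "0 < ?I + 1" by linarith
    have "\<bar>\<integral>x. ?g x * \<phi> (?z x) \<partial>M\<bar> \<le> e / (?I + 1) * ?I"
      using that I by (intro \<open>\<And>e. 0 < e \<Longrightarrow> \<bar>\<integral>x. ?g x * \<phi> (?z x) \<partial>M\<bar> \<le> e * ?I\<close> divide_pos_pos)
    also have "\<dots> \<le> e"
      using that I0 I by (simp add: pos_divide_le_eq mult_left_mono)
    finally show ?thesis by simp
  qed
  then have "\<bar>\<integral>x. ?g x * \<phi> (?z x) \<partial>M\<bar> \<le> 0"
    by (rule field_le_epsilon)
  then show ?thesis by simp
qed

section \<open>Gaussians\<close>

lemma integrable_gaussian_moments:
  fixes s :: real
  assumes "0 < s"
  shows "integrable lborel (\<lambda>y::'a::euclidean_space. (1 + (norm y)\<^sup>2) * exp (- (s * (norm y)\<^sup>2)))"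
proof (rule Bochner_Integration.integrable_bound)
  show "integrable lborel (\<lambda>y::'a. (1 + 2 / s) * exp (- ((s/2) * (norm y)\<^sup>2)))"
    using assms by (intro integrable_mult_right integrable_gaussian) simp
  have "norm ((1 + q) * exp (- (s * q))) \<le> norm ((1 + 2 / s) * exp (- ((s/2) * q)))" if "0 \<le> q" for q
  proof -
    have "1 + q \<le> (1 + 2 / s) * exp ((s/2) * q)"
    proof -
      have "(s/2) * q \<le> exp ((s/2) * q)" "1 \<le> exp ((s/2) * q)"
        using exp_ge_add_one_self[of "(s/2) * q"] that assms by (linarith, simp)
      then have "q \<le> (2 / s) * exp ((s/2) * q)"
        using assms by (simp add: field_simps)
      with \<open>1 \<le> exp ((s/2) * q)\<close> show ?thesis
        unfolding distrib_right mult_1_left by (rule add_mono)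
    qed
    then have "(1 + q) * exp (- (s * q)) \<le> (1 + 2 / s) * exp ((s/2) * q) * exp (- (s * q))"
      by (intro mult_right_mono) auto
    also have "\<dots> = (1 + 2 / s) * exp (- ((s/2) * q))"
      by (simp add: exp_add[symmetric])
    finally show ?thesis using that assms by simp
  qed
  then show "AE y::'a in lborel. norm ((1 + (norm y)\<^sup>2) * exp (- (s * (norm y)\<^sup>2))) \<le> norm ((1 + 2 / s) * exp (- ((s/2) * (norm y)\<^sup>2)))"
    by simp
qed measurable

lemma integrable_gaussian_bounded:
  fixes s :: real and f :: "'a::euclidean_space \<Rightarrow> real"
  assumes "0 < s" and [measurable]: "f \<in> borel_measurable borel"
    and f: "\<And>y. \<bar>f y\<bar> \<le> C * ((1 + (norm y)\<^sup>2) * exp (- (s * (norm y)\<^sup>2)))"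
  shows "integrable lborel f"
  by (rule Bochner_Integration.integrable_bound[OF integrable_mult_right[OF integrable_gaussian_moments[OF assms(1)], of C]])
    (use order_trans[OF f abs_ge_self] in auto)

lemma norm_le_one_plus_square: "norm x \<le> 1 + (norm x)\<^sup>2"
proof -
  have "0 \<le> (norm x - 1/2)\<^sup>2" by simp
  then show ?thesis by (simp add: power2_diff) (simp add: power2_eq_square)
qed

text \<open>
  As a function \<open>G l\<close> of a dilation \<open>l\<close> of \<open>y\<close>, the transform satisfies the ODE
  \<open>G' l = - l |y|\<^sup>2 / (2 s) G l\<close>, by one integration by parts in the direction \<open>y\<close>.
\<close>

lemma gaussian_cosine_transform:
  fixes s :: real and y :: "'a::euclidean_space"
  assumes s: "0 < s"
  shows "(LBINT \<xi>. exp (- (s * (norm \<xi>)\<^sup>2)) * cos (y \<bullet> \<xi>))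
     = (pi / s) powr (real DIM('a) / 2) * exp (- ((norm y)\<^sup>2 / (4 * s)))"
proof -
  let ?E = "\<lambda>\<xi>::'a. exp (- (s * (norm \<xi>)\<^sup>2))"
  define G where "G = (\<lambda>l. LBINT \<xi>. ?E \<xi> * cos (l * (y \<bullet> \<xi>)))"
  have int_cos: "integrable lborel (\<lambda>\<xi>. ?E \<xi> * cos (l * (y \<bullet> \<xi>)))" for l
    by (rule integrable_gaussian_bounded[OF s, where C=1]) (auto simp: abs_mult intro!: mult_mono order_trans[OF abs_cos_le_one])
  have bd: "\<bar>?E \<xi> * (y \<bullet> \<xi>) * sin r\<bar> \<le> norm y * ((1 + (norm \<xi>)\<^sup>2) * ?E \<xi>)" for \<xi> r
  proof -
    have "\<bar>?E \<xi> * (y \<bullet> \<xi>) * sin r\<bar> \<le> ?E \<xi> * (norm y * (1 + (norm \<xi>)\<^sup>2)) * 1"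
      unfolding abs_mult
      by (intro mult_mono order_trans[OF Cauchy_Schwarz_ineq2] norm_le_one_plus_square) auto
    then show ?thesis by (simp add: mult_ac)
  qed
  have int_sin: "integrable lborel (\<lambda>\<xi>. ?E \<xi> * (y \<bullet> \<xi>) * sin (l * (y \<bullet> \<xi>)))" for l
    by (rule integrable_gaussian_bounded[OF s _ bd]) measurable
  have G': "(G has_real_derivative - (LBINT \<xi>. ?E \<xi> * (y \<bullet> \<xi>) * sin (l * (y \<bullet> \<xi>)))) (at l)" for l
  proof -
    have "(G has_real_derivative (LBINT \<xi>. - (?E \<xi> * (y \<bullet> \<xi>) * sin (l * (y \<bullet> \<xi>))))) (at l)"
      unfolding G_def
    proof (rule has_real_derivative_integral[where a="l - 1" and b="l + 1"])
      show "integrable lborel (\<lambda>\<xi>. norm y * ((1 + (norm \<xi>)\<^sup>2) * ?E \<xi>))"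
        by (intro integrable_mult_right integrable_gaussian_moments s)
    qed (use int_cos bd in \<open>auto intro!: derivative_eq_intros\<close>)
    then show ?thesis by simp
  qed
  have parts: "(LBINT \<xi>. ?E \<xi> * (y \<bullet> \<xi>) * sin (l * (y \<bullet> \<xi>))) = l * (norm y)\<^sup>2 / (2 * s) * G l" for l
  proof -
    let ?f' = "\<lambda>\<xi>. - (2 * s) * (?E \<xi> * (y \<bullet> \<xi>) * sin (l * (y \<bullet> \<xi>))) + l * (norm y)\<^sup>2 * (?E \<xi> * cos (l * (y \<bullet> \<xi>)))"
    have "(LBINT \<xi>. ?f' \<xi>) = 0"
    proof (rule integral_directional_derivative_eq_0[where f="\<lambda>\<xi>. ?E \<xi> * sin (l * (y \<bullet> \<xi>))" and b=y and S="\<lambda>_. {}"])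
      show "integrable lborel (\<lambda>\<xi>. ?E \<xi> * sin (l * (y \<bullet> \<xi>)))"
        by (rule integrable_gaussian_bounded[OF s, where C=1]) (auto simp: abs_mult intro!: mult_mono order_trans[OF abs_sin_le_one])
      show "integrable lborel ?f'"
        by (intro Bochner_Integration.integrable_add integrable_mult_right int_cos int_sin)
      show "continuous_on {0..1} (\<lambda>t. ?E (x + t *\<^sub>R y) * sin (l * (y \<bullet> (x + t *\<^sub>R y))))" for x
        by (intro continuous_intros)
      show "((\<lambda>t. ?E (x + t *\<^sub>R y) * sin (l * (y \<bullet> (x + t *\<^sub>R y)))) has_vector_derivative ?f' (x + t *\<^sub>R y)) (at t)"
        if "t \<in> {0<..<1} - {}" for x t
        unfolding has_real_derivative_iff_has_vector_derivative[symmetric] power2_norm_eq_inner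
        by (auto intro!: derivative_eq_intros simp: inner_simps inner_commute algebra_simps)
    qed auto
    moreover have "(LBINT \<xi>. ?f' \<xi>) = - (2 * s) * (LBINT \<xi>. ?E \<xi> * (y \<bullet> \<xi>) * sin (l * (y \<bullet> \<xi>))) + l * (norm y)\<^sup>2 * G l"
      unfolding G_def using int_cos int_sin by (subst Bochner_Integration.integral_add) auto
    ultimately show ?thesis using s by (simp add: field_simps)
  qed
  define F where "F = (\<lambda>l. G l * exp (l\<^sup>2 * (norm y)\<^sup>2 / (4 * s)))"
  have "(F has_real_derivative 0) (at l)" for l
    unfolding F_def using G'[of l] s unfolding parts
    by (auto intro!: derivative_eq_intros simp: field_simps)
  then have "F 1 = F 0"
    using DERIV_isconst_all[of F 1 0] by blast
  moreover have "F 0 = (pi / s) powr (real DIM('a) / 2)"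
    using integral_gaussian[OF s, where 'a='a] by (simp add: F_def G_def)
  ultimately have "G 1 * exp ((norm y)\<^sup>2 / (4 * s)) = (pi / s) powr (real DIM('a) / 2)"
    by (simp add: F_def)
  then have "G 1 = (pi / s) powr (real DIM('a) / 2) * exp (- ((norm y)\<^sup>2 / (4 * s)))"
    by (simp add: exp_minus field_simps)
  then show ?thesis by (simp add: G_def)
qed

text \<open>
  Minus the derivative in \<open>s\<close> of the preceding formula.
\<close>

lemma gaussian_moment_cosine_transform:
  fixes s :: real and y :: "'a::euclidean_space"
  assumes s: "0 < s"
  defines "D \<equiv> real DIM('a) / 2"
  shows "(LBINT \<xi>. (norm \<xi>)\<^sup>2 * exp (- (s * (norm \<xi>)\<^sup>2)) * cos (y \<bullet> \<xi>))
     = pi powr D * s powr (- D - 1) * (D - (norm y)\<^sup>2 / (4 * s)) * exp (- ((norm y)\<^sup>2 / (4 * s)))"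
proof -
  let ?G = "\<lambda>s. LBINT \<xi>. exp (- (s * (norm \<xi>)\<^sup>2)) * cos (y \<bullet> \<xi>)"
  have "(?G has_real_derivative (LBINT \<xi>. - ((norm \<xi>)\<^sup>2 * exp (- (s * (norm \<xi>)\<^sup>2)) * cos (y \<bullet> \<xi>)))) (at s)"
  proof (rule has_real_derivative_integral[where a="s / 2" and b="2 * s"])
    show "integrable lborel (\<lambda>\<xi>::'a. (1 + (norm \<xi>)\<^sup>2) * exp (- ((s/2) * (norm \<xi>)\<^sup>2)))"
      using s by (intro integrable_gaussian_moments) simp
    show "integrable lborel (\<lambda>\<xi>. exp (- (t * (norm \<xi>)\<^sup>2)) * cos (y \<bullet> \<xi>))" if "t \<in> {s / 2 <..< 2 * s}" for t
      by (rule integrable_gaussian_bounded[where C=1 and s=t])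
        (use that s in \<open>auto simp: abs_mult intro!: mult_mono order_trans[OF abs_cos_le_one]\<close>)
    show "\<bar>- ((norm \<xi>)\<^sup>2 * exp (- (t * (norm \<xi>)\<^sup>2)) * cos (y \<bullet> \<xi>))\<bar> \<le> (1 + (norm \<xi>)\<^sup>2) * exp (- ((s/2) * (norm \<xi>)\<^sup>2))"
      if "t \<in> {s / 2 <..< 2 * s}" for t and \<xi> :: 'a
    proof -
      have "(s/2) * (norm \<xi>)\<^sup>2 \<le> t * (norm \<xi>)\<^sup>2"
        using that by (intro mult_right_mono) auto
      then have "(norm \<xi>)\<^sup>2 * exp (- (t * (norm \<xi>)\<^sup>2)) * \<bar>cos (y \<bullet> \<xi>)\<bar>
         \<le> (1 + (norm \<xi>)\<^sup>2) * exp (- ((s/2) * (norm \<xi>)\<^sup>2)) * 1"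
        by (intro mult_mono) auto
      then show ?thesis by (simp add: abs_mult)
    qed
    show "((\<lambda>t. exp (- (t * (norm \<xi>)\<^sup>2)) * cos (y \<bullet> \<xi>)) has_real_derivative
        - ((norm \<xi>)\<^sup>2 * exp (- (t * (norm \<xi>)\<^sup>2)) * cos (y \<bullet> \<xi>))) (at t)" for t and \<xi> :: 'a
      by (auto intro!: derivative_eq_intros)
  qed (use s in auto)
  moreover have "(?G has_real_derivative
      - (pi powr D * s powr (- D - 1) * (D - (norm y)\<^sup>2 / (4 * s)) * exp (- ((norm y)\<^sup>2 / (4 * s))))) (at s)"
  proof (rule has_field_derivative_transform_within_open[where S="{0<..}"])
    show "((\<lambda>s. pi powr D * s powr (- D) * exp (- ((norm y)\<^sup>2 / (4 * s)))) has_real_derivative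
      - (pi powr D * s powr (- D - 1) * (D - (norm y)\<^sup>2 / (4 * s)) * exp (- ((norm y)\<^sup>2 / (4 * s))))) (at s)"
      using s by (auto intro!: derivative_eq_intros simp: powr_diff field_simps power2_eq_square)
    show "pi powr D * t powr (- D) * exp (- ((norm y)\<^sup>2 / (4 * t))) = ?G t" if "t \<in> {0<..}" for t
      using that gaussian_cosine_transform[of t y]
      by (simp add: D_def powr_divide powr_minus_divide)
  qed (use s in auto)
  ultimately show ?thesis
    using DERIV_unique by fastforce
qed

section \<open>Cosine transforms of truncated powers\<close>

definition cosine_transform :: "('a::euclidean_space \<Rightarrow> real) \<Rightarrow> 'a \<Rightarrow> real" where
  "cosine_transform f \<xi> = (LBINT y. f y * cos (y \<bullet> \<xi>))"

definition truncated_power :: "real \<Rightarrow> real \<Rightarrow> 'a::euclidean_space \<Rightarrow> real" where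
  "truncated_power a Q y = max 0 (Q - (norm y)\<^sup>2) powr a"

lemma measurable_truncated_power [measurable]: "truncated_power a Q \<in> borel_measurable borel"
  unfolding truncated_power_def by measurable

lemma truncated_power_nonneg: "0 \<le> truncated_power a Q y"
  by (simp add: truncated_power_def)

lemma truncated_power_le:
  assumes "0 < a" "0 \<le> Q"
  shows "truncated_power a Q y \<le> Q powr a * indicator (cball 0 (sqrt Q)) y"
proof (cases "(norm y)\<^sup>2 \<le> Q")
  case True
  then have "norm y \<le> sqrt Q" by (rule real_le_rsqrt)
  then show ?thesis using assms True
    by (auto simp: truncated_power_def intro!: powr_mono2)
next
  case False
  then show ?thesis by (simp add: truncated_power_def)
qed

lemma integral_indicator_cball:
  assumes "0 \<le> r"
  shows "(LBINT y. indicator (cball (0::'a::euclidean_space) r) y :: real) = unit_ball_vol DIM('a) * r ^ DIM('a)"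
  using assms emeasure_cball[of r "0::'a"] by (simp add: measure_def)

lemma integral_indicator_ball:
  assumes "0 \<le> r"
  shows "(LBINT y. indicator (ball (0::'a::euclidean_space) r) y :: real) = unit_ball_vol DIM('a) * r ^ DIM('a)"
  using assms emeasure_ball[of r "0::'a"] by (simp add: measure_def)

lemma sqrt_power_DIM: "0 \<le> Q \<Longrightarrow> sqrt Q ^ n = Q powr (real n / 2)" if "0 < n" for Q
proof (cases "Q = 0")
  case True then show ?thesis using that by (simp add: zero_power)
next
  case False
  assume "0 \<le> Q"
  with False show ?thesis
    by (simp add: powr_half_sqrt[symmetric] powr_realpow[symmetric] powr_powr)
qed

lemma integrable_indicator_cball: "integrable lborel (\<lambda>y::'a::euclidean_space. indicator (cball 0 r) y :: real)"
  by (rule integrable_real_indicator) (use emeasure_lborel_cball_finite[of "0::'a" r] in simp_all)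

lemma integrable_indicator_ball: "integrable lborel (\<lambda>y::'a::euclidean_space. indicator (ball 0 r) y :: real)"
  by (rule integrable_real_indicator) (use emeasure_lborel_ball_finite[of "0::'a" r] in simp_all)

lemma integrable_truncated_power:
  assumes "0 < a" "0 \<le> Q"
  shows "integrable lborel (truncated_power a Q :: 'a::euclidean_space \<Rightarrow> real)"
  by (rule Bochner_Integration.integrable_bound[OF integrable_mult_right[OF integrable_indicator_cball[of "sqrt Q"], of "Q powr a"]])
    (auto simp: abs_of_nonneg truncated_power_nonneg truncated_power_le[OF assms] simp del: indicator_simps intro!: AE_I2 order_trans[OF truncated_power_le[OF assms] abs_ge_self])

lemma integral_truncated_power_le:
  assumes "0 < a" "0 \<le> Q"
  shows "(LBINT y. truncated_power a Q (y::'a::euclidean_space)) \<le> unit_ball_vol DIM('a) * Q powr (real DIM('a) / 2 + a)"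
proof -
  have "(LBINT y. truncated_power a Q (y::'a)) \<le> (LBINT y. Q powr a * indicator (cball (0::'a) (sqrt Q)) y)"
    by (intro integral_mono integrable_truncated_power integrable_mult_right integrable_indicator_cball assms truncated_power_le)
  also have "\<dots> = Q powr a * (unit_ball_vol DIM('a) * Q powr (real DIM('a) / 2))"
    using assms integral_indicator_cball[of "sqrt Q", where 'a='a] by (simp add: sqrt_power_DIM)
  finally show ?thesis by (simp add: powr_add mult_ac)
qed

lemma integrable_cosine:
  assumes "integrable lborel f"
  shows "integrable lborel (\<lambda>y. f y * cos (y \<bullet> \<xi>))"
  by (rule Bochner_Integration.integrable_bound[OF assms])
    (use assms in \<open>auto simp: abs_mult intro!: mult_left_le\<close>)

lemma abs_cosine_transform_le:
  assumes "integrable lborel f"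
  shows "\<bar>cosine_transform f \<xi>\<bar> \<le> (LBINT y. \<bar>f y\<bar>)"
proof -
  have "\<bar>cosine_transform f \<xi>\<bar> \<le> (LBINT y. \<bar>f y * cos (y \<bullet> \<xi>)\<bar>)"
    unfolding cosine_transform_def by (rule integral_abs_bound)
  also have "\<dots> \<le> (LBINT y. \<bar>f y\<bar>)"
    by (intro integral_mono integrable_abs integrable_cosine assms) (simp add: abs_mult mult_left_le)
  finally show ?thesis .
qed

lemma continuous_cosine_transform:
  assumes f: "integrable lborel f"
  shows "isCont (cosine_transform f) \<xi>"
  unfolding continuous_at_sequentially comp_def
proof (intro allI impI)
  fix X assume X: "X \<longlonglongrightarrow> \<xi>"
  have [measurable]: "f \<in> borel_measurable borel" using f by auto
  show "(\<lambda>n. cosine_transform f (X n)) \<longlonglongrightarrow> cosine_transform f \<xi>"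
    unfolding cosine_transform_def
  proof (rule integral_dominated_convergence[where w="\<lambda>y. \<bar>f y\<bar>"])
    show "AE y in lborel. (\<lambda>n. f y * cos (y \<bullet> X n)) \<longlonglongrightarrow> f y * cos (y \<bullet> \<xi>)"
      using X by (intro AE_I2 tendsto_intros)
    show "AE y in lborel. norm (f y * cos (y \<bullet> X n)) \<le> \<bar>f y\<bar>" for n
      by (auto simp: abs_mult intro!: mult_left_le)
  qed (use f in auto)
qed

text \<open>
  The Gaussian transform depends only on the norm of the frequency, hence so do all integrals of
  \<open>cos (y \<bullet> \<xi>)\<close> against powers of \<open>exp (- |y|\<^sup>2)\<close>, and hence, by \<open>exponential_moments_zero\<close>,
  against every continuous function of \<open>exp (- |y|\<^sup>2)\<close> that vanishes near \<open>0\<close>.  This replaces rotation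
  invariance of Lebesgue measure.
\<close>

lemma cosine_transform_radial:
  fixes \<xi> \<xi>' :: "'a::euclidean_space"
  assumes a: "0 < a" and Q: "0 \<le> Q" and eq: "norm \<xi> = norm \<xi>'"
  shows "cosine_transform (truncated_power a Q) \<xi> = cosine_transform (truncated_power a Q) \<xi>'"
proof -
  let ?f = "\<lambda>y::'a. cos (y \<bullet> \<xi>) - cos (y \<bullet> \<xi>')"
  let ?X = "\<lambda>y::'a. (norm y)\<^sup>2"
  define c where "c = exp (- Q)"
  \<comment> \<open>\<open>z * \<phi> z\<close> is the truncated power at \<open>|y|\<^sup>2 = - ln z\<close>; below \<open>c\<close> it vanishes, which removes
    the singularity of the logarithm at \<open>0\<close>.\<close>
  define \<phi> where "\<phi> = (\<lambda>z. max 0 (Q + ln (max z c)) powr a / max z c)"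
  have c: "0 < c" by (simp add: c_def)
  have c': "0 < max z c" for z using c by auto
  have int: "integrable lborel (\<lambda>y::'a. cos (y \<bullet> \<zeta>) * exp (- (s * ?X y)))" if "0 < s" for s \<zeta>
    using integrable_cosine[OF integrable_gaussian[OF that], of \<zeta>] by (simp add: mult.commute)
  have val: "(LBINT y. cos (y \<bullet> \<zeta>) * exp (- (s * ?X y))) = (pi / s) powr (real DIM('a) / 2) * exp (- ((norm \<zeta>)\<^sup>2 / (4 * s)))"
    if "0 < s" for s and \<zeta> :: 'a
    using gaussian_cosine_transform[OF that, of \<zeta>] by (simp add: mult.commute inner_commute)
  have "(LBINT y. ?f y * exp (- ?X y) * \<phi> (exp (- ?X y))) = 0"
  proof (rule exponential_moments_zero)
    show "integrable lborel (\<lambda>y. ?f y * exp (- ?X y))"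
      using int[of 1 \<xi>] int[of 1 \<xi>'] by (simp add: left_diff_distrib)
    show "(LBINT y. ?f y * exp (- (real (Suc n) * ?X y))) = 0" for n
    proof -
      have "0 < real (Suc n)" by simp
      from int[OF this] val[OF this] show ?thesis
        unfolding left_diff_distrib by (subst Bochner_Integration.integral_diff) (auto simp only: eq)
    qed
    have "continuous_on UNIV \<phi>"
      unfolding \<phi>_def using c' less_imp_neq[OF c'] a
      by (intro continuous_intros continuous_on_powr') (auto simp del: max_less_iff_conj less_max_iff_disj)
    then show "continuous_on {0..1} \<phi>"
      by (rule continuous_on_subset) simp
    have [measurable]: "\<phi> \<in> borel_measurable borel"
      using \<open>continuous_on UNIV \<phi>\<close> by (rule borel_measurable_continuous_onI)
    show "(\<lambda>y. \<phi> (exp (- ?X y))) \<in> borel_measurable lborel"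
      by measurable
  qed auto
  moreover have "exp (- ?X y) * \<phi> (exp (- ?X y)) = truncated_power a Q y" for y
  proof (cases "?X y \<le> Q")
    case True
    then have "max (exp (- ?X y)) c = exp (- ?X y)" by (simp add: c_def)
    then show ?thesis by (simp add: \<phi>_def truncated_power_def)
  next
    case False
    then have "max (exp (- ?X y)) c = c" by (simp add: c_def)
    then show ?thesis using False by (simp add: \<phi>_def truncated_power_def c_def)
  qed
  ultimately have "(LBINT y. truncated_power a Q y * cos (y \<bullet> \<xi>) - truncated_power a Q y * cos (y \<bullet> \<xi>')) = 0"
    by (simp add: mult.assoc left_diff_distrib mult.commute[of "truncated_power a Q _"])
  then show ?thesis
    unfolding cosine_transform_def
    using integrable_cosine[OF integrable_truncated_power[OF a Q], of \<xi>]
      integrable_cosine[OF integrable_truncated_power[OF a Q], of \<xi>'] by simp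
qed

text \<open>
  Up to the boundary terms, which vanish because \<open>D\<close> and \<open>a\<close> are positive, the integrand of \<open>I\<close> is
  \<open>(Q - q) powr a\<close> times the derivative of \<open>q powr D * exp (- q / (4 s))\<close>.  The new integrand is nonnegative,
  so that from here on all integrals can be exchanged freely.
\<close>

lemma truncated_power_gaussian_by_parts:
  fixes a Q D s I :: real
  assumes a: "0 < a" and Q: "0 < Q" and D: "0 < D" and s: "0 < s"
    and int: "integrable lborel (\<lambda>q. norm_sq_density D q * (max 0 (Q - q) powr a * ((D - q / (4 * s)) * exp (- (q / (4 * s))))))"
    and I: "I = (LBINT q. norm_sq_density D q * (max 0 (Q - q) powr a * ((D - q / (4 * s)) * exp (- (q / (4 * s))))))"
  shows "0 \<le> I"
    and "ennreal I = ennreal (pi powr D / Gamma D * a) *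
      (\<integral>\<^sup>+q\<in>{0<..<Q}. ennreal ((Q - q) powr (a - 1) * q powr D * exp (- (q / (4 * s)))) \<partial>lborel)"
proof -
  define c where "c = pi powr D / Gamma D"
  have c: "0 < c" using D by (simp add: c_def Gamma_real_pos)
  define f1 where "f1 = (\<lambda>q. norm_sq_density D q * (max 0 (Q - q) powr a * ((D - q / (4 * s)) * exp (- (q / (4 * s))))))"
  \<comment> \<open>\<open>f1 - f2\<close> is the derivative of \<open>F\<close>; integrability of \<open>f2\<close>, unbounded at \<open>Q\<close> for
    \<open>a < 1\<close>, is a consequence.\<close>
  define f2 where "f2 = (\<lambda>q. indicator {0<..<Q} q * (c * (a * (Q - q) powr (a - 1)) * (q powr D * exp (- (q / (4 * s))))))"
  define F where "F = (\<lambda>q. c * (Q - q) powr a * (q powr D * exp (- (q / (4 * s)))))"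
  have "((\<lambda>q. f1 q - f2 q) has_integral F Q - F 0) {0..Q}"
  proof (rule fundamental_theorem_of_calculus_interior)
    show "continuous_on {0..Q} F"
      unfolding F_def using a D s by (intro continuous_intros continuous_on_powr') auto
    show "(F has_vector_derivative f1 q - f2 q) (at q)" if q: "q \<in> {0<..<Q}" for q
    proof -
      let ?E = "exp (- (q / (4 * s)))"
      have d1: "((\<lambda>q. q powr D) has_real_derivative D * q powr (D - 1)) (at q)"
        using q by (intro has_real_derivative_powr) simp
      have d2: "((\<lambda>q. (Q - q) powr a) has_real_derivative a * (Q - q) powr (a - 1) * (0 - 1)) (at q)"
        using q by (intro DERIV_chain2[OF has_real_derivative_powr] DERIV_diff DERIV_const DERIV_ident) simp
      have d3: "((\<lambda>q. exp (- (q / (4 * s)))) has_real_derivative - (1 / (4 * s)) * ?E) (at q)"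
        using s by (auto intro!: derivative_eq_intros)
      have "c * (a * Y * (0 - 1)) * (q * P * E) + (D * P * E + - (1 / (4 * s)) * E * (q * P)) * (c * X)
          = c * P * (X * ((D - q / (4 * s)) * E)) - c * (a * Y) * (q * P * E)" for X Y P E
        by (simp add: algebra_simps)
      from this[of "(Q - q) powr (a - 1)" "q powr (D - 1)" ?E "(Q - q) powr a"]
      have "c * (a * (Q - q) powr (a - 1) * (0 - 1)) * (q powr D * ?E)
          + (D * q powr (D - 1) * ?E + - (1 / (4 * s)) * ?E * q powr D) * (c * (Q - q) powr a) = f1 q - f2 q"
        using q by (simp add: f1_def f2_def norm_sq_density_def c_def powr_diff)
      with DERIV_mult[OF DERIV_cmult[OF d2, of c] DERIV_mult[OF d1 d3]] show ?thesis
        unfolding has_real_derivative_iff_has_vector_derivative[symmetric] F_def by simp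
    qed
  qed (use Q in simp)
  then have "((\<lambda>q. f1 q - f2 q) has_integral 0) {0..Q}"
    using a D by (simp add: F_def)
  then have "((\<lambda>q. if q \<in> {0..Q} then f1 q - f2 q else 0) has_integral 0) UNIV"
    by (subst has_integral_restrict_UNIV)
  then have "((\<lambda>q. f1 q - f2 q) has_integral 0) UNIV"
    by (rule has_integral_eq[rotated]) (auto simp: f1_def f2_def norm_sq_density_def split: split_indicator)
  moreover have "(f1 has_integral I) UNIV"
    unfolding I f1_def using int by (rule has_integral_integral_lborel)
  ultimately have "((\<lambda>q. f1 q - (f1 q - f2 q)) has_integral I - 0) UNIV"
    by (intro has_integral_diff)
  then have f2: "(f2 has_integral I) UNIV" by simp
  have f2_nonneg: "0 \<le> f2 q" for q
    using c a by (auto simp: f2_def split: split_indicator)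
  show "0 \<le> I"
    using f2 f2_nonneg by (rule has_integral_nonneg)
  have "ennreal I = (\<integral>\<^sup>+q. ennreal (f2 q) \<partial>lborel)"
    using f2 f2_nonneg by (subst nn_integral_has_integral_lborel) (auto simp: f2_def)
  also have "\<dots> = (\<integral>\<^sup>+q. ennreal (c * a) * (ennreal ((Q - q) powr (a - 1) * q powr D * exp (- (q / (4 * s)))) * indicator {0<..<Q} q) \<partial>lborel)"
    using c a by (intro nn_integral_cong) (auto simp: f2_def ennreal_mult'[symmetric] mult_ac split: split_indicator)
  also have "\<dots> = ennreal (c * a) * (\<integral>\<^sup>+q\<in>{0<..<Q}. ennreal ((Q - q) powr (a - 1) * q powr D * exp (- (q / (4 * s)))) \<partial>lborel)"
    by (intro nn_integral_cmult) measurable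
  finally show "ennreal I = ennreal (pi powr D / Gamma D * a) *
      (\<integral>\<^sup>+q\<in>{0<..<Q}. ennreal ((Q - q) powr (a - 1) * q powr D * exp (- (q / (4 * s)))) \<partial>lborel)"
    by (simp add: c_def)
qed

text \<open>
  The integral of \<open>|\<xi>|\<^sup>2 exp (- s |\<xi>|\<^sup>2)\<close> against the cosine transform of a truncated power, up to a
  factor that depends only on \<open>D\<close>, \<open>a\<close> and \<open>s\<close>; see \<open>gaussian_test_truncated_power\<close>.
\<close>

definition gaussian_test :: "real \<Rightarrow> real \<Rightarrow> real \<Rightarrow> real \<Rightarrow> ennreal" where
  "gaussian_test D a Q s =
     (\<integral>\<^sup>+q\<in>{0<..<Q}. ennreal ((Q - q) powr (a - 1) * q powr D * exp (- (q / (4 * s)))) \<partial>lborel)"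

text \<open>
  By Fubini the Gaussian weight is transformed instead of the truncated power; the result is a radial integral.
\<close>

lemma gaussian_test_truncated_power:
  fixes a Q s :: real
  assumes a: "0 < a" and Q: "0 < Q" and s: "0 < s"
  defines "D \<equiv> real DIM('a::euclidean_space) / 2"
  defines "I \<equiv> (LBINT \<xi>. (norm \<xi>)\<^sup>2 * exp (- (s * (norm \<xi>)\<^sup>2)) * cosine_transform (truncated_power a Q) (\<xi>::'a))"
  shows "0 \<le> I"
    and "ennreal I = ennreal (pi powr (2 * D) / Gamma D * a * s powr (- D - 1)) * gaussian_test D a Q s"
proof -
  have D: "0 < D" by (simp add: D_def)
  define k where "k = pi powr D * s powr (- D - 1)"
  have k: "0 < k" using s by (simp add: k_def)
  let ?w = "\<lambda>\<xi>::'a. (norm \<xi>)\<^sup>2 * exp (- (s * (norm \<xi>)\<^sup>2))"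
  let ?p = "truncated_power a Q :: 'a \<Rightarrow> real"
  let ?h = "\<lambda>q. max 0 (Q - q) powr a * ((D - q / (4 * s)) * exp (- (q / (4 * s))))"
  have w: "integrable lborel ?w"
    by (rule integrable_gaussian_bounded[OF s, where C=1]) auto
  have p: "integrable lborel ?p"
    using a Q by (intro integrable_truncated_power) auto
  have int: "integrable (lborel \<Otimes>\<^sub>M lborel) (\<lambda>(\<xi>, y). ?w \<xi> * (?p y * cos (y \<bullet> \<xi>)))"
  proof (rule lborel_pair.integrable_dominated_by_product[OF _ w p])
    show "norm (?w \<xi> * (?p y * cos (y \<bullet> \<xi>))) \<le> ?w \<xi> * ?p y" for \<xi> y
      using truncated_power_nonneg[of a Q y]
      by (auto simp: abs_mult intro!: mult_left_mono mult_left_le)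
  qed measurable
  have "I = (LBINT \<xi>. LBINT y. ?w \<xi> * (?p y * cos (y \<bullet> \<xi>)))"
    by (simp add: I_def cosine_transform_def)
  also have "\<dots> = (LBINT y. LBINT \<xi>. ?w \<xi> * (?p y * cos (y \<bullet> \<xi>)))"
    using lborel_pair.Fubini_integral[OF int] by simp
  also have "\<dots> = (LBINT y. ?p y * (LBINT \<xi>. ?w \<xi> * cos (y \<bullet> \<xi>)))"
    by (subst integral_mult_right_zero[symmetric]) (simp add: mult_ac)
  also have "\<dots> = (LBINT y. k * ?h ((norm (y::'a))\<^sup>2))"
    unfolding gaussian_moment_cosine_transform[OF s]
    by (simp add: k_def D_def truncated_power_def mult_ac)
  finally have Ih: "I = (LBINT y. k * ?h ((norm (y::'a))\<^sup>2))" .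
  then have I1: "I / k = (LBINT q. norm_sq_density D q * ?h q)"
    using k integral_radial[of ?h, where 'a='a] by (simp add: D_def)
  have "integrable lborel (\<lambda>y::'a. ?h ((norm y)\<^sup>2))"
  proof (rule integrable_gaussian_bounded[where s="1 / (4 * s)" and C="Q powr a * (D + 1 / (4 * s))"])
    fix y :: 'a
    let ?q = "(norm y)\<^sup>2"
    have "\<bar>D - ?q / (4 * s)\<bar> \<le> (D + 1 / (4 * s)) * (1 + ?q)"
      using D s by (intro abs_leI) (auto simp: field_simps intro!: add_nonneg_nonneg)
    moreover have "max 0 (Q - ?q) powr a \<le> Q powr a"
      using a Q by (intro powr_mono2) auto
    ultimately have "max 0 (Q - ?q) powr a * (\<bar>D - ?q / (4 * s)\<bar> * exp (- (?q / (4 * s))))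
       \<le> Q powr a * ((D + 1 / (4 * s)) * (1 + ?q) * exp (- (?q / (4 * s))))"
      by (intro mult_mono) auto
    then show "\<bar>?h ?q\<bar> \<le> Q powr a * (D + 1 / (4 * s)) * ((1 + ?q) * exp (- (1 / (4 * s) * ?q)))"
      by (simp add: abs_mult mult_ac)
  qed (use s in auto)
  then have "integrable (distr lborel borel (\<lambda>y::'a. (norm y)\<^sup>2)) ?h"
    by (subst integrable_distr_eq) simp_all
  then have int1: "integrable lborel (\<lambda>q. norm_sq_density D q * ?h q)"
    unfolding distr_norm_sq
    by (subst (asm) integrable_density) (auto simp: norm_sq_density_nonneg D_def)
  note * = truncated_power_gaussian_by_parts[OF a Q D s int1 I1]
  from *(1) k show I: "0 \<le> I" by (simp add: zero_le_divide_iff)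
  have "ennreal I = ennreal k * ennreal (I / k)"
    using k by (simp add: ennreal_mult'[symmetric])
  also have "\<dots> = ennreal k * (ennreal (pi powr D / Gamma D * a) * gaussian_test D a Q s)"
    unfolding *(2) gaussian_test_def ..
  also have "\<dots> = ennreal (k * (pi powr D / Gamma D * a)) * gaussian_test D a Q s"
    using k by (subst ennreal_mult') (auto simp: mult.assoc)
  also have "k * (pi powr D / Gamma D * a) = pi powr (2 * D) / Gamma D * a * s powr (- D - 1)"
  proof -
    have "pi powr (2 * D) = pi powr D * pi powr D"
      by (simp flip: powr_add)
    then show ?thesis by (simp add: k_def)
  qed
  finally show "ennreal I = ennreal (pi powr (2 * D) / Gamma D * a * s powr (- D - 1)) * gaussian_test D a Q s" .
qed

lemma power_diff_le:
  fixes x y :: real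
  assumes "0 \<le> y" "y \<le> x"
  shows "x * (x ^ n - y ^ n) \<le> real n * x ^ n * (x - y)"
proof (induction n)
  case (Suc n)
  have "x * (x ^ Suc n - y ^ Suc n) = x * (x * (x ^ n - y ^ n)) + x * y ^ n * (x - y)"
    by (simp add: algebra_simps)
  also have "\<dots> \<le> x * (real n * x ^ n * (x - y)) + x * x ^ n * (x - y)"
    using assms Suc by (intro add_mono mult_left_mono mult_right_mono power_mono) auto
  also have "\<dots> = real (Suc n) * x ^ Suc n * (x - y)"
    by (simp add: algebra_simps)
  finally show ?case .
qed simp

text \<open>
  Well inside the ball the second difference of a quadratic is constant, well outside it is \<open>0\<close>, and near the
  sphere the Lipschitz bound is enough because the shell has volume of order \<open>norm h * R ^ (d - 1)\<close>.
\<close>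

lemma second_difference_truncated:
  fixes y h :: "'a::euclidean_space"
  assumes R: "0 < R" and h: "norm h \<le> R"
  defines "f \<equiv> truncated_power 1 (R\<^sup>2)"
  shows "\<bar>f (y + h) + f (y - h) - 2 * f y\<bar>
    \<le> 2 * (norm h)\<^sup>2 * indicator (cball 0 R) y
      + 10 * R * norm h * (indicator (cball 0 (R + norm h)) y - indicator (ball 0 (R - norm h)) y)"
proof -
  have f: "f z = max 0 (R\<^sup>2 - (norm z)\<^sup>2)" for z
    by (simp add: f_def truncated_power_def)
  have sq: "(norm z)\<^sup>2 \<le> R\<^sup>2 \<longleftrightarrow> norm z \<le> R" for z :: 'a
    using R by (simp add: abs_le_square_iff[symmetric])
  consider "norm y < R - norm h" | "R + norm h < norm y" | "R - norm h \<le> norm y" "norm y \<le> R + norm h"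
    by linarith
  then show ?thesis
  proof cases
    case 1
    have "norm (y + h) \<le> R" "norm (y - h) \<le> R" "norm y \<le> R"
      using norm_triangle_ineq[of y h] norm_triangle_ineq4[of y h] norm_ge_zero[of h] 1 by linarith+
    then have "f (y + h) = R\<^sup>2 - (norm (y + h))\<^sup>2" "f (y - h) = R\<^sup>2 - (norm (y - h))\<^sup>2" "f y = R\<^sup>2 - (norm y)\<^sup>2"
      unfolding f using sq by auto
    moreover have "(norm (y + h))\<^sup>2 + (norm (y - h))\<^sup>2 = 2 * (norm y)\<^sup>2 + 2 * (norm h)\<^sup>2"
      unfolding power2_norm_eq_inner by (simp add: inner_simps inner_commute)
    ultimately have "f (y + h) + f (y - h) - 2 * f y = - (2 * (norm h)\<^sup>2)"
      by simp
    moreover have "norm y \<le> R + norm h"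
      using \<open>norm y \<le> R\<close> by (simp add: add_increasing2)
    ultimately show ?thesis using 1 \<open>norm y \<le> R\<close> by simp
  next
    case 2
    have "norm y \<le> norm (y + h) + norm h" "norm y \<le> norm (y - h) + norm h"
      using norm_triangle_ineq4[of "y + h" h] norm_triangle_ineq[of "y - h" h] by simp_all
    then have "R < norm (y + h)" "R < norm (y - h)" "R < norm y"
      using norm_ge_zero[of h] 2 by linarith+
    then have "\<not> (norm (y + h))\<^sup>2 \<le> R\<^sup>2" "\<not> (norm (y - h))\<^sup>2 \<le> R\<^sup>2" "\<not> (norm y)\<^sup>2 \<le> R\<^sup>2"
      unfolding sq by simp_all
    then have "f (y + h) = 0" "f (y - h) = 0" "f y = 0"
      unfolding f by simp_all
    moreover have "\<not> norm y < R - norm h"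
      using 2 norm_ge_zero[of h] by linarith
    ultimately show ?thesis using 2 R by simp
  next
    case 3
    have *: "\<bar>f (y + k) - f y\<bar> \<le> 5 * R * norm h" if k: "norm k = norm h" for k
    proof -
      have "\<bar>f (y + k) - f y\<bar> \<le> \<bar>(norm (y + k))\<^sup>2 - (norm y)\<^sup>2\<bar>"
      proof -
        have "\<bar>max 0 (S - u) - max 0 (S - v)\<bar> \<le> \<bar>u - v\<bar>" for S u v :: real
          by linarith
        then show ?thesis unfolding f .
      qed
      also have "\<dots> = \<bar>norm (y + k) - norm y\<bar> * (norm (y + k) + norm y)"
        by (simp add: power2_eq_square square_diff_square_factored abs_mult)
      also have "\<dots> \<le> norm h * (5 * R)"
      proof (rule mult_mono)
        show "\<bar>norm (y + k) - norm y\<bar> \<le> norm h"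
          using norm_triangle_ineq3[of "y + k" y] k by simp
        show "norm (y + k) + norm y \<le> 5 * R"
          using norm_triangle_ineq[of y k] k 3 h by linarith
      qed auto
      finally show ?thesis by (simp add: mult_ac)
    qed
    have "\<bar>f (y + h) + f (y - h) - 2 * f y\<bar> \<le> 10 * R * norm h"
      using *[of h] *[of "- h"] by simp
    moreover have "indicator (cball 0 (R + norm h)) y - indicator (ball 0 (R - norm h)) y = (1::real)"
      using 3 by simp
    ultimately show ?thesis by (simp add: add_increasing)
  qed
qed

text \<open>
  A translation by \<open>h\<close> with \<open>h \<bullet> \<xi> = pi\<close> changes the sign of \<open>cos (y \<bullet> \<xi>)\<close>, so the transform is
  \<open>-1/4\<close> of the transform of a second difference with step of length \<open>pi / norm \<xi>\<close>.  The order \<open>Q powr D\<close>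
  in \<open>Q\<close> is what makes the bound integrable against \<open>tail_measure\<close>.
\<close>

lemma cosine_transform_decay:
  fixes \<xi> :: "'a::euclidean_space"
  assumes Q: "0 < Q" and \<xi>: "\<xi> \<noteq> 0"
  shows "\<bar>cosine_transform (truncated_power 1 Q) \<xi>\<bar>
    \<le> unit_ball_vol DIM('a) * (1 + 5 * real DIM('a) * 2 ^ DIM('a)) * pi\<^sup>2 * Q powr (real DIM('a) / 2) / (norm \<xi>)\<^sup>2"
proof -
  define R where "R = sqrt Q"
  have R: "0 < R" "R\<^sup>2 = Q" using Q by (auto simp: R_def)
  define h where "h = (pi / (norm \<xi>)\<^sup>2) *\<^sub>R \<xi>"
  have h\<xi>: "h \<bullet> \<xi> = pi" using \<xi> by (simp add: h_def power2_norm_eq_inner)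
  have nh: "norm h = pi / norm \<xi>" using \<xi> by (simp add: h_def power2_eq_square)
  let ?f = "truncated_power 1 Q :: 'a \<Rightarrow> real"
  let ?N = "cosine_transform ?f \<xi>" and ?\<omega> = "unit_ball_vol DIM('a)" and ?n = "DIM('a)"
  have f: "integrable lborel ?f" using Q by (intro integrable_truncated_power) auto
  have RD: "Q powr (real ?n / 2) = R ^ ?n"
    using Q by (simp add: R_def sqrt_power_DIM)
  have "\<bar>?N\<bar> \<le> ?\<omega> * (1 + 5 * real ?n * 2 ^ ?n) * (norm h)\<^sup>2 * R ^ ?n"
  proof (cases "norm h \<le> R")
    case True
    let ?g = "\<lambda>y::'a. 2 * (norm h)\<^sup>2 * indicator (cball 0 R) y
      + 10 * R * norm h * (indicator (cball 0 (R + norm h)) y - indicator (ball 0 (R - norm h)) y)"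
    have shift: "(LBINT y. ?f (y + k) * cos (y \<bullet> \<xi>)) = - ?N" if k: "k = h \<or> k = - h" for k
    proof -
      have "cos ((y + k) \<bullet> \<xi>) = - cos (y \<bullet> \<xi>)" for y
        using k by (elim disjE) (simp_all add: inner_add_left inner_diff_left h\<xi> cos_add cos_diff)
      then have "(LBINT y. ?f (y + k) * cos (y \<bullet> \<xi>)) = - (LBINT y. ?f (y + k) * cos ((y + k) \<bullet> \<xi>))"
        by simp
      also have "(LBINT y. ?f (y + k) * cos ((y + k) \<bullet> \<xi>)) = ?N"
        unfolding cosine_transform_def
        by (rule integral_lborel_translate[of "\<lambda>y. ?f y * cos (y \<bullet> \<xi>)"]) measurable
      finally show ?thesis .
    qed
    have int: "integrable lborel (\<lambda>y. ?f (y + k) * cos (y \<bullet> \<xi>))" for k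
      by (intro integrable_cosine integrable_lborel_translate f)
    have "- 4 * ?N = (LBINT y. ?f (y + h) * cos (y \<bullet> \<xi>)) + (LBINT y. ?f (y + - h) * cos (y \<bullet> \<xi>)) - 2 * (LBINT y. ?f (y + 0) * cos (y \<bullet> \<xi>))"
      by (subst (1 2) shift) (auto simp: cosine_transform_def)
    also have "\<dots> = (LBINT y. ?f (y + h) * cos (y \<bullet> \<xi>) + ?f (y + - h) * cos (y \<bullet> \<xi>) - 2 * (?f (y + 0) * cos (y \<bullet> \<xi>)))"
      using int by (simp only: Bochner_Integration.integral_add Bochner_Integration.integral_diff
         Bochner_Integration.integrable_add integrable_mult_right integral_mult_right_zero)
    also have "\<dots> = (LBINT y. (?f (y + h) + ?f (y - h) - 2 * ?f y) * cos (y \<bullet> \<xi>))"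
      by (simp add: algebra_simps)
    finally have N: "- 4 * ?N = (LBINT y. (?f (y + h) + ?f (y - h) - 2 * ?f y) * cos (y \<bullet> \<xi>))" .
    have "4 * \<bar>?N\<bar> = \<bar>- 4 * ?N\<bar>" by simp
    then have "4 * \<bar>?N\<bar> \<le> (LBINT y. \<bar>(?f (y + h) + ?f (y - h) - 2 * ?f y) * cos (y \<bullet> \<xi>)\<bar>)"
      unfolding N using integral_abs_bound by (rule ord_eq_le_trans)
    also have "\<dots> \<le> (LBINT y. ?g y)"
    proof (rule integral_mono)
      show "integrable lborel (\<lambda>y. \<bar>(?f (y + h) + ?f (y - h) - 2 * ?f y) * cos (y \<bullet> \<xi>)\<bar>)"
        using f integrable_lborel_translate[OF f, of h] integrable_lborel_translate[OF f, of "-h"]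
        by (intro integrable_abs integrable_cosine Bochner_Integration.integrable_diff
            Bochner_Integration.integrable_add integrable_mult_right) auto
      show "integrable lborel ?g"
        by (intro Bochner_Integration.integrable_diff
            Bochner_Integration.integrable_add integrable_mult_right integrable_indicator_cball integrable_indicator_ball)
      show "\<bar>(?f (y + h) + ?f (y - h) - 2 * ?f y) * cos (y \<bullet> \<xi>)\<bar> \<le> ?g y" for y
      proof -
        have "\<bar>X * cos r\<bar> \<le> \<bar>X\<bar>" for X r :: real
          by (simp add: abs_mult mult_left_le)
        from order_trans[OF this second_difference_truncated[OF R(1) True, of y, unfolded R(2)]]
        show ?thesis .
      qed
    qed
    also have "\<dots> = 2 * (norm h)\<^sup>2 * (?\<omega> * R ^ ?n) + 10 * R * norm h * (?\<omega> * (R + norm h) ^ ?n - ?\<omega> * (R - norm h) ^ ?n)"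
    proof -
      have V: "(LBINT y. indicator (cball (0::'a) R) y :: real) = ?\<omega> * R ^ ?n"
        "(LBINT y. indicator (cball (0::'a) (R + norm h)) y :: real) = ?\<omega> * (R + norm h) ^ ?n"
        "(LBINT y. indicator (ball (0::'a) (R - norm h)) y :: real) = ?\<omega> * (R - norm h) ^ ?n"
        using R True by (intro integral_indicator_cball integral_indicator_ball; simp)+
      have linear: "(LBINT y. A * f1 y + B * (f2 y - f3 y))
          = A * (LBINT y. f1 y) + B * ((LBINT y. f2 y) - (LBINT y. f3 y))"
        if "integrable lborel f1" "integrable lborel f2" "integrable lborel f3"
        for A B and f1 f2 f3 :: "'a \<Rightarrow> real"
        using that by simp
      show ?thesis
        unfolding linear[OF integrable_indicator_cball integrable_indicator_cball integrable_indicator_ball] V ..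
    qed
    also have "R * ((R + norm h) ^ ?n - (R - norm h) ^ ?n) \<le> (2 * R) ^ ?n * (2 * real ?n * norm h)"
    proof -
      have "R * ((R + norm h) ^ ?n - (R - norm h) ^ ?n) \<le> (R + norm h) * ((R + norm h) ^ ?n - (R - norm h) ^ ?n)"
        using True R by (intro mult_right_mono) (auto intro!: power_mono)
      also have "\<dots> \<le> real ?n * (R + norm h) ^ ?n * ((R + norm h) - (R - norm h))"
        using True R by (intro power_diff_le) auto
      also have "\<dots> \<le> real ?n * (2 * R) ^ ?n * ((R + norm h) - (R - norm h))"
        using True R by (intro mult_right_mono mult_left_mono power_mono) auto
      finally show ?thesis by (simp add: mult_ac)
    qed
    then have "10 * R * norm h * (?\<omega> * (R + norm h) ^ ?n - ?\<omega> * (R - norm h) ^ ?n)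
      \<le> 10 * norm h * ?\<omega> * ((2 * R) ^ ?n * (2 * real ?n * norm h))"
      using mult_left_mono[OF \<open>R * ((R + norm h) ^ ?n - (R - norm h) ^ ?n) \<le> (2 * R) ^ ?n * (2 * real ?n * norm h)\<close>, of "10 * norm h * ?\<omega>"]
      by (simp add: algebra_simps)
    then have "2 * (norm h)\<^sup>2 * (?\<omega> * R ^ ?n) + 10 * R * norm h * (?\<omega> * (R + norm h) ^ ?n - ?\<omega> * (R - norm h) ^ ?n)
      \<le> 2 * (norm h)\<^sup>2 * (?\<omega> * R ^ ?n) + 10 * norm h * ?\<omega> * ((2 * R) ^ ?n * (2 * real ?n * norm h))"
      by simp
    finally have "4 * \<bar>?N\<bar> \<le> 2 * (norm h)\<^sup>2 * (?\<omega> * R ^ ?n) + 10 * norm h * ?\<omega> * ((2 * R) ^ ?n * (2 * real ?n * norm h))" .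
    also have "\<dots> = ?\<omega> * (2 + 20 * real ?n * 2 ^ ?n) * (norm h)\<^sup>2 * R ^ ?n"
      by (simp add: power_mult_distrib power2_eq_square algebra_simps)
    also have "\<dots> \<le> ?\<omega> * (4 + 20 * real ?n * 2 ^ ?n) * (norm h)\<^sup>2 * R ^ ?n"
      using R by (intro mult_right_mono mult_left_mono) auto
    finally show ?thesis by (simp add: algebra_simps)
  next
    case False
    have "\<bar>?N\<bar> \<le> (LBINT y. \<bar>?f y\<bar>)" by (rule abs_cosine_transform_le[OF f])
    also have "\<dots> = (LBINT y. ?f y)" by (simp add: truncated_power_nonneg)
    also have "\<dots> \<le> ?\<omega> * Q powr (real ?n / 2 + 1)" using Q by (intro integral_truncated_power_le) auto
    also have "\<dots> = ?\<omega> * 1 * R\<^sup>2 * R ^ ?n" using Q RD by (simp add: powr_add R)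
    also have "\<dots> \<le> ?\<omega> * (1 + 5 * real ?n * 2 ^ ?n) * (norm h)\<^sup>2 * R ^ ?n"
      using False R by (intro mult_right_mono mult_mono power_mono) auto
    finally show ?thesis .
  qed
  then show ?thesis by (simp add: nh RD power_divide)
qed

section \<open>The potential of a truncated power\<close>

lemma nn_integral_Gamma_shifted:
  fixes a c \<theta> :: real
  assumes "a < 1" "0 < \<theta>"
  shows "(\<integral>\<^sup>+Q\<in>{c<..}. ennreal ((Q - c) powr (- a) * exp (- (\<theta> * Q))) \<partial>lborel)
    = ennreal (exp (- (\<theta> * c)) * (Gamma (1 - a) * \<theta> powr (a - 1)))"
proof -
  have "(\<integral>\<^sup>+Q\<in>{c<..}. ennreal ((Q - c) powr (- a) * exp (- (\<theta> * Q))) \<partial>lborel)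
     = (\<integral>\<^sup>+x. ennreal ((c + 1 * x - c) powr (- a) * exp (- (\<theta> * (c + 1 * x)))) * indicator {c<..} (c + 1 * x) \<partial>lborel)"
    by (subst nn_integral_real_affine[of _ 1 c]) simp_all
  also have "\<dots> = (\<integral>\<^sup>+x. ennreal (exp (- (\<theta> * c))) * (ennreal (x powr ((1 - a) - 1) * exp (- (\<theta> * x))) * indicator {0<..} x) \<partial>lborel)"
    by (intro nn_integral_cong)
      (auto simp: ennreal_mult'[symmetric] distrib_left exp_add mult_ac simp flip: exp_add split: split_indicator)
  also have "\<dots> = ennreal (exp (- (\<theta> * c))) * (\<integral>\<^sup>+x\<in>{0<..}. ennreal (x powr ((1 - a) - 1) * exp (- (\<theta> * x))) \<partial>lborel)"
    by (intro nn_integral_cmult) measurable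
  also have "\<dots> = ennreal (exp (- (\<theta> * c))) * ennreal (Gamma (1 - a) / \<theta> powr (1 - a))"
    using assms by (subst nn_integral_Gamma) simp_all
  also have "Gamma (1 - a) / \<theta> powr (1 - a) = Gamma (1 - a) * \<theta> powr (a - 1)"
    using powr_minus_divide[of \<theta> "1 - a"] by simp
  finally show ?thesis by (simp add: ennreal_mult'[symmetric])
qed

text \<open>
  Write \<open>Q powr (- e)\<close> as a Gamma integral of \<open>exp (- p Q)\<close> and integrate over \<open>Q\<close> first.
\<close>

lemma nn_integral_tail:
  fixes a e :: real
  assumes a: "a < 1" and e: "0 < e" "1 < e + a"
  shows "(\<integral>\<^sup>+Q\<in>{1<..}. ennreal (Q powr (- e) * (Q - 1) powr (- a)) \<partial>lborel)
    = ennreal (Gamma (1 - a) * Gamma (e + a - 1) / Gamma e)"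
proof -
  let ?F = "\<lambda>Q p. ennreal (indicator {1<..} Q * (Q - 1) powr (- a)) * (ennreal (p powr (e - 1) * exp (- (Q * p))) * indicator {0<..} p)"
  have G: "0 < Gamma e" "0 < Gamma (1 - a)" "0 < Gamma (e + a - 1)"
    using assms by (auto intro!: Gamma_real_pos)
  let ?T = "\<integral>\<^sup>+Q\<in>{1<..}. ennreal (Q powr (- e) * (Q - 1) powr (- a)) \<partial>lborel"
  have "ennreal (Gamma e) * ?T
     = (\<integral>\<^sup>+Q. ennreal (Gamma e) * (ennreal (Q powr (- e) * (Q - 1) powr (- a)) * indicator {1<..} Q) \<partial>lborel)"
    by (intro nn_integral_cmult[symmetric]) measurable
  also have "\<dots> = (\<integral>\<^sup>+Q. (\<integral>\<^sup>+p. ?F Q p \<partial>lborel) \<partial>lborel)"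
  proof (intro nn_integral_cong)
    fix Q :: real
    have "(\<integral>\<^sup>+p. ?F Q p \<partial>lborel)
        = ennreal (indicator {1<..} Q * (Q - 1) powr (- a)) * (\<integral>\<^sup>+p\<in>{0<..}. ennreal (p powr (e - 1) * exp (- (Q * p))) \<partial>lborel)"
      by (intro nn_integral_cmult) measurable
    moreover have "(\<integral>\<^sup>+p\<in>{0<..}. ennreal (p powr (e - 1) * exp (- (Q * p))) \<partial>lborel) = ennreal (Gamma e * Q powr (- e))" if "1 < Q"
      using nn_integral_Gamma[of e Q] that e by (simp add: powr_minus_divide)
    ultimately show "ennreal (Gamma e) * (ennreal (Q powr (- e) * (Q - 1) powr (- a)) * indicator {1<..} Q)
      = (\<integral>\<^sup>+p. ?F Q p \<partial>lborel)"
      using G by (cases "1 < Q") (simp_all add: ennreal_mult'[symmetric] mult_ac)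
  qed
  also have "\<dots> = (\<integral>\<^sup>+p. (\<integral>\<^sup>+Q. ?F Q p \<partial>lborel) \<partial>lborel)"
    by (rule lborel_pair.Fubini') measurable
  also have "\<dots> = (\<integral>\<^sup>+p. ennreal (Gamma (1 - a)) * (ennreal (p powr ((e + a - 1) - 1) * exp (- (1 * p))) * indicator {0<..} p) \<partial>lborel)"
  proof (intro nn_integral_cong)
    fix p :: real
    show "(\<integral>\<^sup>+Q. ?F Q p \<partial>lborel)
      = ennreal (Gamma (1 - a)) * (ennreal (p powr ((e + a - 1) - 1) * exp (- (1 * p))) * indicator {0<..} p)"
    proof (cases "0 < p")
      case True
      have "(\<integral>\<^sup>+Q. ?F Q p \<partial>lborel)
        = (\<integral>\<^sup>+Q. ennreal (p powr (e - 1)) * (ennreal ((Q - 1) powr (- a) * exp (- (p * Q))) * indicator {1<..} Q) \<partial>lborel)"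
        using True by (intro nn_integral_cong) (auto simp: ennreal_mult'[symmetric] mult_ac split: split_indicator)
      also have "\<dots> = ennreal (p powr (e - 1)) * ennreal (exp (- (p * 1)) * (Gamma (1 - a) * p powr (a - 1)))"
        using True a by (subst nn_integral_cmult) (simp_all only: nn_integral_Gamma_shifted, measurable)
      also have "\<dots> = ennreal (Gamma (1 - a) * (p powr ((e - 1) + (a - 1)) * exp (- (1 * p))))"
        unfolding powr_add by (simp add: ennreal_mult'[symmetric] mult_ac)
      finally show ?thesis using True G
        by (simp add: ennreal_mult'[symmetric] algebra_simps)
    qed simp
  qed
  also have "\<dots> = ennreal (Gamma (1 - a)) * (\<integral>\<^sup>+p\<in>{0<..}. ennreal (p powr ((e + a - 1) - 1) * exp (- (1 * p))) \<partial>lborel)"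
    by (intro nn_integral_cmult) measurable
  also have "\<dots> = ennreal (Gamma (1 - a)) * ennreal (Gamma (e + a - 1) / 1 powr (e + a - 1))"
    using e by (subst nn_integral_Gamma) simp_all
  finally have *: "ennreal (Gamma e) * ?T = ennreal (Gamma (1 - a) * Gamma (e + a - 1))"
    using G by (simp add: ennreal_mult'[symmetric])
  have "?T = (ennreal (1 / Gamma e) * ennreal (Gamma e)) * ?T"
    using G by (simp add: ennreal_mult'[symmetric])
  also have "\<dots> = ennreal (1 / Gamma e) * ennreal (Gamma (1 - a) * Gamma (e + a - 1))"
    unfolding mult.assoc * ..
  finally show ?thesis using G by (simp add: ennreal_mult'[symmetric])
qed

definition tail_density :: "real \<Rightarrow> real \<Rightarrow> real \<Rightarrow> real" where
  "tail_density a D Q = indicator {1<..} Q * (Q powr (- D - 1) * (Q - 1) powr (- a))"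

text \<open>
  The measure \<open>\<mu>\<close> that superposes the balls \<open>|y|\<^sup>2 < \<rho> Q\<close> to the fractional gradient.
\<close>

definition tail_measure :: "real \<Rightarrow> real \<Rightarrow> real measure" where
  "tail_measure a D = density lborel (\<lambda>Q. ennreal (tail_density a D Q))"

lemma tail_density_nonneg: "0 \<le> tail_density a D Q"
  by (simp add: tail_density_def)

lemma measurable_tail_density [measurable]: "tail_density a D \<in> borel_measurable borel"
  unfolding tail_density_def by measurable

lemma sets_tail_measure [measurable_cong, simp]: "sets (tail_measure a D) = sets borel"
  by (simp add: tail_measure_def)

lemma space_tail_measure [simp]: "space (tail_measure a D) = UNIV"
  by (simp add: tail_measure_def)

lemma nn_integral_tail_measure:
  assumes "f \<in> borel_measurable borel"
  shows "(\<integral>\<^sup>+Q. f Q \<partial>tail_measure a D) = (\<integral>\<^sup>+Q. ennreal (tail_density a D Q) * f Q \<partial>lborel)"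
  unfolding tail_measure_def using assms by (intro nn_integral_density) auto

lemma AE_tail_measure: "AE Q in tail_measure a D. 1 < Q"
  unfolding tail_measure_def
  by (subst AE_density) (auto simp: tail_density_def split: split_indicator)

lemma emeasure_tail_measure:
  assumes "a < 1" "0 < D" "0 < D + a"
  shows "emeasure (tail_measure a D) UNIV = ennreal (Gamma (1 - a) * Gamma (D + a) / Gamma (D + 1))"
proof -
  have "emeasure (tail_measure a D) UNIV = (\<integral>\<^sup>+Q. 1 \<partial>tail_measure a D)"
    by simp
  also have "\<dots> = (\<integral>\<^sup>+Q\<in>{1<..}. ennreal (Q powr (- (D + 1)) * (Q - 1) powr (- a)) \<partial>lborel)"
    by (subst nn_integral_tail_measure) (auto simp: tail_density_def intro!: nn_integral_cong split: split_indicator)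
  also have "\<dots> = ennreal (Gamma (1 - a) * Gamma (D + 1 + a - 1) / Gamma (D + 1))"
    using assms by (intro nn_integral_tail) auto
  finally show ?thesis by (simp add: algebra_simps)
qed

lemma finite_measure_tail_measure:
  assumes "a < 1" "0 < D" "0 < D + a"
  shows "finite_measure (tail_measure a D)"
  by (rule finite_measureI) (simp add: emeasure_tail_measure[OF assms])

lemma integrable_tail_measure_powr:
  assumes a: "a < 1" and e: "0 < e" "1 < e + a"
  shows "integrable (tail_measure a D) (\<lambda>Q. Q powr (D + 1 - e))"
proof (rule integrableI_bounded)
  have "(\<integral>\<^sup>+Q. ennreal (norm (Q powr (D + 1 - e))) \<partial>tail_measure a D)
      = (\<integral>\<^sup>+Q\<in>{1<..}. ennreal (Q powr (- e) * (Q - 1) powr (- a)) \<partial>lborel)"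
  proof (subst nn_integral_tail_measure)
    have "Q powr (- D - 1) * Q powr (D + 1 - e) = Q powr (- e)" for Q
      by (simp flip: powr_add)
    then show "(\<integral>\<^sup>+Q. ennreal (tail_density a D Q) * ennreal (norm (Q powr (D + 1 - e))) \<partial>lborel)
      = (\<integral>\<^sup>+Q\<in>{1<..}. ennreal (Q powr (- e) * (Q - 1) powr (- a)) \<partial>lborel)"
      by (intro nn_integral_cong)
        (auto simp: tail_density_def ennreal_mult'[symmetric] mult_ac split: split_indicator)
  qed measurable
  also have "\<dots> < \<infinity>"
    unfolding nn_integral_tail[OF assms] by simp
  finally show "(\<integral>\<^sup>+Q. ennreal (norm (Q powr (D + 1 - e))) \<partial>tail_measure a D) < \<infinity>" .
qed measurable

definition incomplete_gamma :: "real \<Rightarrow> real \<Rightarrow> real \<Rightarrow> real \<Rightarrow> ennreal" where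
  "incomplete_gamma D a \<rho> s = (\<integral>\<^sup>+q\<in>{0<..<\<rho>}. ennreal (q powr (D + a - 1) * exp (- (q / (4 * s)))) \<partial>lborel)"

text \<open>
  The substitution \<open>q \<mapsto> Q q\<close> makes the inner domain independent of \<open>Q\<close> and cancels the power of \<open>Q\<close>
  in the density; the remaining integral over \<open>Q\<close> is a Gamma integral.
\<close>

lemma gaussian_test_tail:
  fixes a D \<rho> s :: real
  assumes a: "0 < a" "a < 1" and D: "0 < D" and \<rho>: "0 < \<rho>" and s: "0 < s"
  shows "(\<integral>\<^sup>+Q. gaussian_test D 1 (\<rho> * Q) s \<partial>tail_measure a D)
    = ennreal (Gamma (1 - a) * (4 * s) powr (1 - a)) * incomplete_gamma D a \<rho> s"
proof -
  let ?F = "\<lambda>Q q. ennreal (indicator {1<..} Q * (Q - 1) powr (- a)) * (ennreal (q powr D * exp (- (q / (4 * s) * Q))) * indicator {0<..<\<rho>} q)"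
  have G: "0 < Gamma (1 - a)" using a by (intro Gamma_real_pos) simp
  have scale: "gaussian_test D 1 (\<rho> * Q) s
      = ennreal (Q powr (D + 1)) * (\<integral>\<^sup>+q\<in>{0<..<\<rho>}. ennreal (q powr D * exp (- (q / (4 * s) * Q))) \<partial>lborel)"
    if Q: "1 < Q" for Q
  proof -
    have "gaussian_test D 1 (\<rho> * Q) s
       = ennreal Q * (\<integral>\<^sup>+q. ennreal ((\<rho> * Q - Q * q) powr 0 * (Q * q) powr D * exp (- (Q * q / (4 * s)))) * indicator {0<..<\<rho> * Q} (Q * q) \<partial>lborel)"
      using Q unfolding gaussian_test_def by (subst nn_integral_real_affine[of _ Q 0]) simp_all
    also have "\<dots> = (\<integral>\<^sup>+q. ennreal Q * (ennreal ((\<rho> * Q - Q * q) powr 0 * (Q * q) powr D * exp (- (Q * q / (4 * s)))) * indicator {0<..<\<rho> * Q} (Q * q)) \<partial>lborel)"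
      by (intro nn_integral_cmult[symmetric]) measurable
    also have "\<dots> = (\<integral>\<^sup>+q. ennreal (Q powr (D + 1)) * (ennreal (q powr D * exp (- (q / (4 * s) * Q))) * indicator {0<..<\<rho>} q) \<partial>lborel)"
    proof (intro nn_integral_cong)
      fix q
      have "Q * q < \<rho> * Q \<longleftrightarrow> q < \<rho>" "0 < Q * q \<longleftrightarrow> 0 < q"
        using Q by (auto simp: mult.commute[of \<rho>] zero_less_mult_iff)
      moreover have "Q * ((\<rho> * Q - Q * q) powr 0 * (Q * q) powr D * exp (- (Q * q / (4 * s))))
          = Q powr (D + 1) * (q powr D * exp (- (q / (4 * s) * Q)))" if "0 < q" "q < \<rho>"
        using that Q by (simp add: powr_mult powr_add mult_ac)
      ultimately show "ennreal Q * (ennreal ((\<rho> * Q - Q * q) powr 0 * (Q * q) powr D * exp (- (Q * q / (4 * s)))) * indicator {0<..<\<rho> * Q} (Q * q))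
        = ennreal (Q powr (D + 1)) * (ennreal (q powr D * exp (- (q / (4 * s) * Q))) * indicator {0<..<\<rho>} q)"
        using Q by (auto simp: ennreal_mult'[symmetric] indicator_def simp del: powr_zero_eq_one)
    qed
    also have "\<dots> = ennreal (Q powr (D + 1)) * (\<integral>\<^sup>+q\<in>{0<..<\<rho>}. ennreal (q powr D * exp (- (q / (4 * s) * Q))) \<partial>lborel)"
      by (intro nn_integral_cmult) measurable
    finally show ?thesis .
  qed
  have meas: "(\<lambda>Q. gaussian_test D 1 (\<rho> * Q) s) \<in> borel_measurable borel"
    unfolding gaussian_test_def indicator_def greaterThanLessThan_iff by measurable
  have "(\<integral>\<^sup>+Q. gaussian_test D 1 (\<rho> * Q) s \<partial>tail_measure a D)
     = (\<integral>\<^sup>+Q. ennreal (tail_density a D Q) * gaussian_test D 1 (\<rho> * Q) s \<partial>lborel)"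
    using meas by (rule nn_integral_tail_measure)
  also have "\<dots> = (\<integral>\<^sup>+Q. (\<integral>\<^sup>+q. ?F Q q \<partial>lborel) \<partial>lborel)"
  proof (intro nn_integral_cong)
    fix Q :: real
    have "(\<integral>\<^sup>+q. ?F Q q \<partial>lborel)
       = ennreal (indicator {1<..} Q * (Q - 1) powr (- a)) * (\<integral>\<^sup>+q\<in>{0<..<\<rho>}. ennreal (q powr D * exp (- (q / (4 * s) * Q))) \<partial>lborel)"
      by (intro nn_integral_cmult) measurable
    moreover have "ennreal (tail_density a D Q) * ennreal (Q powr (D + 1)) = ennreal (indicator {1<..} Q * (Q - 1) powr (- a))" if "1 < Q"
    proof -
      have "Q powr (- D - 1) * Q powr (D + 1) = 1"
        using that by (simp flip: powr_add)
      then have "tail_density a D Q * Q powr (D + 1) = indicator {1<..} Q * (Q - 1) powr (- a)"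
        using that by (simp add: tail_density_def mult_ac)
      then show ?thesis by (simp only: ennreal_mult'[OF tail_density_nonneg, symmetric])
    qed
    ultimately show "ennreal (tail_density a D Q) * gaussian_test D 1 (\<rho> * Q) s
      = (\<integral>\<^sup>+q. ?F Q q \<partial>lborel)"
      by (cases "1 < Q") (simp_all add: scale mult.assoc[symmetric], simp_all add: tail_density_def)
  qed
  also have "\<dots> = (\<integral>\<^sup>+q. (\<integral>\<^sup>+Q. ?F Q q \<partial>lborel) \<partial>lborel)"
    by (rule lborel_pair.Fubini') measurable
  also have "\<dots> = (\<integral>\<^sup>+q. ennreal (Gamma (1 - a) * (4 * s) powr (1 - a)) * (ennreal (q powr (D + a - 1) * exp (- (q / (4 * s)))) * indicator {0<..<\<rho>} q) \<partial>lborel)"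
  proof (intro nn_integral_cong)
    fix q :: real
    show "(\<integral>\<^sup>+Q. ?F Q q \<partial>lborel)
      = ennreal (Gamma (1 - a) * (4 * s) powr (1 - a)) * (ennreal (q powr (D + a - 1) * exp (- (q / (4 * s)))) * indicator {0<..<\<rho>} q)"
    proof (cases "0 < q \<and> q < \<rho>")
      case True
      then have qs: "0 < q / (4 * s)" using s by simp
      have "(\<integral>\<^sup>+Q. ?F Q q \<partial>lborel)
        = (\<integral>\<^sup>+Q. ennreal (q powr D) * (ennreal ((Q - 1) powr (- a) * exp (- (q / (4 * s) * Q))) * indicator {1<..} Q) \<partial>lborel)"
        using True by (intro nn_integral_cong) (auto simp: ennreal_mult'[symmetric] mult_ac split: split_indicator)
      also have "\<dots> = ennreal (q powr D) * ennreal (exp (- (q / (4 * s) * 1)) * (Gamma (1 - a) * (q / (4 * s)) powr (a - 1)))"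
        using qs a by (subst nn_integral_cmult) (simp_all only: nn_integral_Gamma_shifted, measurable)
      also have "\<dots> = ennreal (q powr D * (exp (- (q / (4 * s) * 1)) * (Gamma (1 - a) * (q / (4 * s)) powr (a - 1))))"
        by (simp add: ennreal_mult')
      also have "q powr D * (exp (- (q / (4 * s) * 1)) * (Gamma (1 - a) * (q / (4 * s)) powr (a - 1)))
         = Gamma (1 - a) * (4 * s) powr (1 - a) * (q powr (D + a - 1) * exp (- (q / (4 * s))))"
      proof -
        have "(q / (4 * s)) powr (a - 1) = q powr (a - 1) * (4 * s) powr (1 - a)"
        proof -
          have "(4 * s) powr (1 - a) = 1 / (4 * s) powr (a - 1)"
            using powr_minus_divide[of "4 * s" "a - 1"] by simp
          moreover have "(q / c) powr (a - 1) = q powr (a - 1) / c powr (a - 1)" if "0 < c" for c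
            using True that by (simp add: powr_divide)
          ultimately show ?thesis using s by simp
        qed
        moreover have "q powr (D + a - 1) = q powr D * q powr (a - 1)"
          by (simp flip: powr_add add: algebra_simps)
        ultimately show ?thesis by simp
      qed
      finally show ?thesis using True G by (simp add: ennreal_mult'[symmetric])
    qed auto
  qed
  also have "\<dots> = ennreal (Gamma (1 - a) * (4 * s) powr (1 - a)) * incomplete_gamma D a \<rho> s"
    unfolding incomplete_gamma_def by (intro nn_integral_cmult) measurable
  finally show ?thesis .
qed

text \<open>
  The substitutions \<open>\<tau> = s y\<close> and \<open>q \<mapsto> (1 + y) q\<close> cancel all powers of \<open>1 + y\<close>.  What is left is, for
  fixed \<open>q\<close>, the scale-invariant Beta integral over \<open>0 < y < (\<rho> - q) / q\<close>.
\<close>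

lemma gaussian_test_potential:
  fixes a D \<rho> s :: real
  assumes a: "0 < a" "a < 1" and D: "0 < D" and \<rho>: "0 < \<rho>" and s: "0 < s"
  shows "(\<integral>\<^sup>+\<tau>\<in>{0<..}. ennreal (\<tau> powr (- a) * (s + \<tau>) powr (- D - 1)) * gaussian_test D a \<rho> (s + \<tau>) \<partial>lborel)
    = ennreal (Gamma a * Gamma (1 - a) * s powr (- a - D)) * incomplete_gamma D a \<rho> s"
proof -
  let ?g = "\<lambda>y q. indicator {0<..} q * indicator {..<\<rho>} ((1 + y) * q) * ((\<rho> - (1 + y) * q) powr (a - 1) * (q powr D * exp (- (q / (4 * s)))))"
  let ?h = "\<lambda>y q. (\<rho> - (1 + y) * q) powr (a - 1) * ((1 + y) * q) powr D * exp (- ((1 + y) * q / (4 * (s * (1 + y)))))"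
  have G: "0 < Gamma (1 - a)" "0 < Gamma a" using a by (auto intro!: Gamma_real_pos)
  let ?f = "\<lambda>y q. indicator {0<..} y * indicator {0<..} q * indicator {..<\<rho>} ((1 + y) * q) *
      (y powr (- a) * (\<rho> - (1 + y) * q) powr (a - 1) * (q powr D * exp (- (q / (4 * s)))))"
  have scale: "gaussian_test D a \<rho> (s * (1 + y))
      = ennreal ((1 + y) powr (D + 1)) *
        (\<integral>\<^sup>+q. ennreal (?g y q) \<partial>lborel)"
    if y: "0 < y" for y
  proof -
    have "gaussian_test D a \<rho> (s * (1 + y))
      = ennreal (1 + y) * (\<integral>\<^sup>+q. ennreal (?h y q) * indicator {0<..<\<rho>} ((1 + y) * q) \<partial>lborel)"
      using y unfolding gaussian_test_def by (subst nn_integral_real_affine[of _ "1 + y" 0]) simp_all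
    also have "\<dots> = (\<integral>\<^sup>+q. ennreal (1 + y) * (ennreal (?h y q) * indicator {0<..<\<rho>} ((1 + y) * q)) \<partial>lborel)"
      by (intro nn_integral_cmult[symmetric]) measurable
    also have "\<dots> = (\<integral>\<^sup>+q. ennreal ((1 + y) powr (D + 1)) * ennreal (?g y q) \<partial>lborel)"
    proof (intro nn_integral_cong)
      fix q
      have "0 < (1 + y) * q \<longleftrightarrow> 0 < q"
        using y by (auto simp: zero_less_mult_iff)
      then have ind: "indicator {0<..<\<rho>} ((1 + y) * q) = (indicator {0<..} q * indicator {..<\<rho>} ((1 + y) * q) :: real)"
        by (simp add: indicator_def)
      have "(1 + y) * q / (4 * (s * (1 + y))) = q / (4 * s)"
        using y s by (simp add: divide_simps) 
      moreover have "(1 + y) powr (D + 1) = (1 + y) * (1 + y) powr D"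
        using y by (simp add: powr_add)
      moreover have "((1 + y) * q) powr D = (1 + y) powr D * q powr D" if "0 < q"
        using y that by (simp add: powr_mult)
      ultimately have core: "(1 + y) * (?h y q)
         = (1 + y) powr (D + 1) * ((\<rho> - (1 + y) * q) powr (a - 1) * (q powr D * exp (- (q / (4 * s)))))" if "0 < q"
        using that by (simp only: mult_ac)
      have "(1 + y) * (?h y q) * indicator {0<..<\<rho>} ((1 + y) * q)
        = (1 + y) powr (D + 1) * (?g y q)"
      proof (cases "0 < q")
        case True
        have "A * (B * (1 * i)) = C * (1 * i * E)" if "A * B = C * E" for A B C E i :: real
          using that by (metis mult.assoc mult.commute mult_1)
        from this[OF core[OF True]] show ?thesis
          using True unfolding ind by (simp add: mult.assoc)
      qed (simp add: ind)
      then have *: "ennreal ((1 + y) * (?h y q) * indicator {0<..<\<rho>} ((1 + y) * q))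
        = ennreal ((1 + y) powr (D + 1) * (?g y q))"
        by (rule arg_cong)
      have e1: "ennreal A * (ennreal B * indicator S x) = ennreal (A * B * indicator S x)" if "0 \<le> A" for A B :: real and S and x :: real
        using that by (auto simp: ennreal_mult' split: split_indicator)
      have e2: "ennreal A * ennreal B = ennreal (A * B)" if "0 \<le> A" for A B :: real
        using that by (simp add: ennreal_mult')
      have "0 \<le> 1 + y" "0 \<le> (1 + y) powr (D + 1)" using y by simp_all
      from e1[OF this(1)] e2[OF this(2)] *
      show "ennreal (1 + y) * (ennreal (?h y q) * indicator {0<..<\<rho>} ((1 + y) * q))
        = ennreal ((1 + y) powr (D + 1)) * ennreal (?g y q)"
        by simp
    qed
    also have "\<dots> = ennreal ((1 + y) powr (D + 1)) * (\<integral>\<^sup>+q. ennreal (?g y q) \<partial>lborel)"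
      by (intro nn_integral_cmult) measurable
    finally show ?thesis .
  qed
  have meas: "(\<lambda>\<tau>. gaussian_test D a \<rho> (s + \<tau>)) \<in> borel_measurable borel"
    unfolding gaussian_test_def indicator_def greaterThanLessThan_iff by measurable
  let ?T = "\<lambda>\<tau>. ennreal (\<tau> powr (- a) * (s + \<tau>) powr (- D - 1)) * gaussian_test D a \<rho> (s + \<tau>) * indicator {0<..} \<tau>"
  have "(\<integral>\<^sup>+\<tau>. ?T \<tau> \<partial>lborel) = ennreal s * (\<integral>\<^sup>+y. ?T (s * y) \<partial>lborel)"
    using s meas by (subst nn_integral_real_affine[of _ s 0]) simp_all
  also have "\<dots> = (\<integral>\<^sup>+y. ennreal s * ?T (s * y) \<partial>lborel)"
    using meas by (intro nn_integral_cmult[symmetric]) simp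
  also have "\<dots> = (\<integral>\<^sup>+y. ennreal (s powr (- a - D)) * (\<integral>\<^sup>+q. ennreal (?f y q) \<partial>lborel) \<partial>lborel)"
  proof (intro nn_integral_cong)
    fix y :: real
    show "ennreal s * ?T (s * y) = ennreal (s powr (- a - D)) * (\<integral>\<^sup>+q. ennreal (?f y q) \<partial>lborel)"
    proof (cases "0 < y")
      case True
      let ?J = "\<integral>\<^sup>+q. ennreal (?g y q) \<partial>lborel"
      have eq: "s + s * y = s * (1 + y)" by (simp add: distrib_left)
      have pos: "0 < s * y" "0 < 1 + y" using True s by simp_all
      have "ennreal s * ?T (s * y) = ennreal s * (ennreal ((s * y) powr (- a) * (s * (1 + y)) powr (- D - 1)) * (ennreal ((1 + y) powr (D + 1)) * ?J))"
        using pos unfolding eq scale[OF True] by simp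
      also have "\<dots> = (ennreal s * ennreal ((s * y) powr (- a) * (s * (1 + y)) powr (- D - 1)) * ennreal ((1 + y) powr (D + 1))) * ?J"
        by (simp only: mult.assoc)
      also have "ennreal s * ennreal ((s * y) powr (- a) * (s * (1 + y)) powr (- D - 1)) * ennreal ((1 + y) powr (D + 1))
        = ennreal (s * ((s * y) powr (- a) * (s * (1 + y)) powr (- D - 1)) * (1 + y) powr (D + 1))"
        using s by (simp add: ennreal_mult')
      also have "s * ((s * y) powr (- a) * (s * (1 + y)) powr (- D - 1)) * (1 + y) powr (D + 1) = s powr (- a - D) * y powr (- a)"
      proof -
        have "(s * y) powr (- a) = s powr (- a) * y powr (- a)"
          using s True by (simp add: powr_mult)
        moreover have "(s * (1 + y)) powr (- D - 1) = s powr (- D - 1) * (1 + y) powr (- D - 1)"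
          using s pos by (simp add: powr_mult)
        moreover have "(1 + y) powr (- D - 1) * (1 + y) powr (D + 1) = 1"
          using pos by (simp flip: powr_add)
        moreover have "s powr (- a - D) = s * (s powr (- a) * s powr (- D - 1))"
        proof -
          have "s powr (1 + (- a + (- D - 1))) = s * (s powr (- a) * s powr (- D - 1))"
            using s by (simp only: powr_add powr_one)
          moreover have "1 + (- a + (- D - 1)) = - a - D" by simp
          ultimately show ?thesis by (simp only:)
        qed
        moreover have "s * (A * Y * (B * U)) * V = (s * (A * B)) * Y" if "U * V = 1" for A Y B U V
        proof -
          have "s * (A * Y * (B * U)) * V = (s * (A * B)) * Y * (U * V)" by (simp only: mult_ac)
          then show ?thesis using that by simp
        qed
        ultimately show ?thesis by simp
      qed
      also have "ennreal (s powr (- a - D) * y powr (- a)) * ?J = ennreal (s powr (- a - D)) * (ennreal (y powr (- a)) * ?J)"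
        by (simp add: ennreal_mult' mult.assoc)
      also have "ennreal (y powr (- a)) * ?J = (\<integral>\<^sup>+q. ennreal (y powr (- a)) * ennreal (?g y q) \<partial>lborel)"
        by (intro nn_integral_cmult[symmetric]) measurable
      also have "\<dots> = (\<integral>\<^sup>+q. ennreal (?f y q) \<partial>lborel)"
        using True by (intro nn_integral_cong) (simp add: ennreal_mult'[symmetric] mult_ac)
      finally show ?thesis .
    next
      case False
      then have "s * y \<le> 0" using s by (simp add: mult_le_0_iff)
      then show ?thesis using False by simp
    qed
  qed
  also have "\<dots> = ennreal (s powr (- a - D)) * (\<integral>\<^sup>+y. (\<integral>\<^sup>+q. ennreal (?f y q) \<partial>lborel) \<partial>lborel)"
    by (intro nn_integral_cmult) measurable
  also have "(\<integral>\<^sup>+y. (\<integral>\<^sup>+q. ennreal (?f y q) \<partial>lborel) \<partial>lborel) = (\<integral>\<^sup>+q. (\<integral>\<^sup>+y. ennreal (?f y q) \<partial>lborel) \<partial>lborel)"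
    by (rule lborel_pair.Fubini') measurable
  also have "\<dots> = (\<integral>\<^sup>+q. ennreal (Gamma a * Gamma (1 - a)) * (ennreal (q powr (D + a - 1) * exp (- (q / (4 * s)))) * indicator {0<..<\<rho>} q) \<partial>lborel)"
  proof (intro nn_integral_cong)
    fix q :: real
    consider "q \<le> 0" | "\<rho> \<le> q" "0 < q" | "0 < q" "q < \<rho>" by linarith
    then show "(\<integral>\<^sup>+y. ennreal (?f y q) \<partial>lborel) = ennreal (Gamma a * Gamma (1 - a)) * (ennreal (q powr (D + a - 1) * exp (- (q / (4 * s)))) * indicator {0<..<\<rho>} q)"
    proof cases
      case 1
      then show ?thesis by simp
    next
      case 2
      have f0: "?f y q = 0" for y
      proof (cases "0 < y")
        case True
        then have "q < (1 + y) * q" using 2 by simp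
        then have "\<not> (1 + y) * q < \<rho>" using 2 by linarith
        then show ?thesis by simp
      qed simp
      have "(\<integral>\<^sup>+y. ennreal (?f y q) \<partial>lborel) = (\<integral>\<^sup>+(y::real). 0 \<partial>lborel)"
        by (simp only: f0 ennreal_0)
      then show ?thesis using 2 by simp
    next
      case 3
      define Y where "Y = (\<rho> - q) / q"
      have Y: "0 < Y" using 3 by (simp add: Y_def)
      have eq: "\<rho> - (1 + y) * q = q * (Y - y)" for y
        using 3 by (simp add: Y_def field_simps)
      have lt: "(1 + y) * q < \<rho> \<longleftrightarrow> y < Y" for y
        using 3 by (simp add: Y_def field_simps)
      have f: "?f y q = q powr (D + a - 1) * exp (- (q / (4 * s))) * (indicator {0<..<Y} y * (y powr (- a) * (Y - y) powr (a - 1)))" for y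
      proof (cases "0 < y \<and> y < Y")
        case True
        have "(q * (Y - y)) powr (a - 1) = q powr (a - 1) * (Y - y) powr (a - 1)"
          using True 3 by (simp add: powr_mult)
        moreover have "q powr (D + a - 1) = q powr D * q powr (a - 1)"
          by (simp flip: powr_add add: algebra_simps)
        ultimately show ?thesis
          unfolding eq using True 3 lt by (simp add: mult_ac)
      next
        case False
        then show ?thesis using lt by (auto split: split_indicator)
      qed
      have "(\<integral>\<^sup>+y. ennreal (?f y q) \<partial>lborel) = (\<integral>\<^sup>+y. ennreal (q powr (D + a - 1) * exp (- (q / (4 * s)))) * (ennreal (y powr (- a) * (Y - y) powr (a - 1)) * indicator {0<..<Y} y) \<partial>lborel)"
        unfolding f by (intro nn_integral_cong) (auto simp: ennreal_mult'[symmetric] split: split_indicator)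
      also have "\<dots> = ennreal (q powr (D + a - 1) * exp (- (q / (4 * s)))) * ennreal (Gamma a * Gamma (1 - a))"
        using a Y by (subst nn_integral_cmult) (simp_all only: nn_integral_Beta_complement, measurable)
      finally show ?thesis using 3 by (simp add: mult.commute)
    qed
  qed
  also have "\<dots> = ennreal (Gamma a * Gamma (1 - a)) * incomplete_gamma D a \<rho> s"
    unfolding incomplete_gamma_def by (intro nn_integral_cmult) measurable
  also have "ennreal (s powr (- a - D)) * (ennreal (Gamma a * Gamma (1 - a)) * incomplete_gamma D a \<rho> s)
     = ennreal (Gamma a * Gamma (1 - a) * s powr (- a - D)) * incomplete_gamma D a \<rho> s"
    using G by (subst mult.assoc[symmetric]) (simp add: ennreal_mult'[symmetric] mult.commute)
  finally show ?thesis .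
qed

definition tail_potential :: "real \<Rightarrow> real \<Rightarrow> 'a::euclidean_space \<Rightarrow> real" where
  "tail_potential a \<rho> \<xi> =
     (\<integral>Q. cosine_transform (truncated_power 1 (\<rho> * Q)) \<xi> \<partial>tail_measure a (real DIM('a) / 2))"

lemma measurable_cosine_transform_truncated:
  "(\<lambda>(\<xi>::'a::euclidean_space, Q). cosine_transform (truncated_power 1 (\<rho> * Q)) \<xi>) \<in> borel_measurable (borel \<Otimes>\<^sub>M borel)"
  unfolding cosine_transform_def truncated_power_def by measurable

text \<open>
  Geometric mean of the trivial bound, by the integral of the truncated power, and \<open>cosine_transform_decay\<close>.  The
  freedom in \<open>\<theta>\<close> is needed because \<open>\<theta> = 0\<close> is not integrable in \<open>Q\<close> against \<open>\<mu>\<close>, and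
  \<open>\<theta> = 1\<close> is too singular at \<open>\<xi> = 0\<close> in dimension one.
\<close>

lemma cosine_transform_interpolated:
  assumes "0 < \<rho>"
  obtains C where "0 \<le> C"
    "\<And>\<theta> Q (\<xi>::'a::euclidean_space). 0 \<le> \<theta> \<Longrightarrow> \<theta> \<le> 1 \<Longrightarrow> 0 < Q \<Longrightarrow> \<xi> \<noteq> 0 \<Longrightarrow>
      \<bar>cosine_transform (truncated_power 1 (\<rho> * Q)) \<xi>\<bar>
        \<le> C * Q powr (real DIM('a) / 2 + 1 - \<theta>) * norm \<xi> powr (- 2 * \<theta>)"
proof -
  let ?n = "DIM('a)"
  define D where "D = real ?n / 2"
  define C1 where "C1 = unit_ball_vol ?n * \<rho> powr (D + 1)"
  define C2 where "C2 = unit_ball_vol ?n * (1 + 5 * real ?n * 2 ^ ?n) * pi\<^sup>2 * \<rho> powr D"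
  have C12: "0 < C1" "0 < C2"
    using assms by (auto simp: C1_def C2_def intro!: mult_pos_pos add_pos_nonneg)
  define C where "C = max C1 C2"
  show ?thesis
  proof
    show "0 \<le> C" using C12 by (simp add: C_def)
    fix \<theta> Q :: real and \<xi> :: 'a
    assume \<theta>: "0 \<le> \<theta>" "\<theta> \<le> 1" and Q: "0 < Q" and \<xi>: "\<xi> \<noteq> 0"
    let ?N = "\<bar>cosine_transform (truncated_power 1 (\<rho> * Q)) \<xi>\<bar>"
    have f: "integrable lborel (truncated_power 1 (\<rho> * Q) :: 'a \<Rightarrow> real)"
      using assms Q by (intro integrable_truncated_power) auto
    have "?N \<le> (LBINT y. \<bar>truncated_power 1 (\<rho> * Q) (y::'a)\<bar>)"
      by (rule abs_cosine_transform_le[OF f])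
    also have "\<dots> = (LBINT y. truncated_power 1 (\<rho> * Q) (y::'a))"
      by (simp add: truncated_power_nonneg)
    also have "\<dots> \<le> unit_ball_vol ?n * (\<rho> * Q) powr (real ?n / 2 + 1)"
      using assms Q by (intro integral_truncated_power_le) auto
    also have "\<dots> = C1 * Q powr (D + 1)"
      using assms Q by (simp add: C1_def D_def powr_mult)
    also have "\<dots> \<le> C * Q powr (D + 1)"
      by (intro mult_right_mono) (auto simp: C_def)
    finally have N1: "?N \<le> C * Q powr (D + 1)" .
    have "?N \<le> unit_ball_vol ?n * (1 + 5 * real ?n * 2 ^ ?n) * pi\<^sup>2 * (\<rho> * Q) powr (real ?n / 2) / (norm \<xi>)\<^sup>2"
      using assms Q \<xi> by (intro cosine_transform_decay) auto
    also have "\<dots> = C2 * Q powr D * norm \<xi> powr (- 2)"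
    proof -
      have "norm \<xi> powr (- 2) = 1 / (norm \<xi>)\<^sup>2"
        using \<xi> by (subst powr_neg_numeral) simp_all
      moreover have "(\<rho> * Q) powr D = \<rho> powr D * Q powr D"
        using assms Q by (simp add: powr_mult)
      ultimately show ?thesis by (simp add: C2_def D_def)
    qed
    also have "\<dots> \<le> C * Q powr D * norm \<xi> powr (- 2)"
      by (intro mult_right_mono) (auto simp: C_def)
    finally have N2: "?N \<le> C * Q powr D * norm \<xi> powr (- 2)" .
    show "?N \<le> C * Q powr (real ?n / 2 + 1 - \<theta>) * norm \<xi> powr (- 2 * \<theta>)"
    proof (cases "?N = 0")
      case True
      then show ?thesis using C12 by (simp add: C_def)
    next
      case False
      then have N0: "0 < ?N" by simp
      have "?N = ?N powr (1 - \<theta>) * ?N powr \<theta>"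
        using N0 by (simp flip: powr_add)
      also have "\<dots> \<le> (C * Q powr (D + 1)) powr (1 - \<theta>) * (C * Q powr D * norm \<xi> powr (- 2)) powr \<theta>"
        using \<theta> N1 N2 by (intro mult_mono powr_mono2) auto
      also have "\<dots> = (C powr (1 - \<theta>) * C powr \<theta>) * (Q powr ((D + 1) * (1 - \<theta>)) * Q powr (D * \<theta>)) * norm \<xi> powr (- 2 * \<theta>)"
        using C12 Q by (simp add: C_def powr_mult powr_powr mult_ac)
      also have "C powr (1 - \<theta>) * C powr \<theta> = C"
        using C12 by (simp add: C_def flip: powr_add)
      also have "Q powr ((D + 1) * (1 - \<theta>)) * Q powr (D * \<theta>) = Q powr (D + 1 - \<theta>)"
        by (simp flip: powr_add add: algebra_simps)
      finally show ?thesis by (simp add: D_def)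
    qed
  qed
qed

lemma integrable_tail_cosine_transform:
  fixes \<xi> :: "'a::euclidean_space"
  assumes a: "0 < a" "a < 1" and \<rho>: "0 < \<rho>" and \<xi>: "\<xi> \<noteq> 0"
  shows "integrable (tail_measure a (real DIM('a) / 2)) (\<lambda>Q. cosine_transform (truncated_power 1 (\<rho> * Q)) \<xi>)"
proof -
  obtain C where C: "0 \<le> C"
    "\<And>\<theta> Q (\<xi>::'a). 0 \<le> \<theta> \<Longrightarrow> \<theta> \<le> 1 \<Longrightarrow> 0 < Q \<Longrightarrow> \<xi> \<noteq> 0 \<Longrightarrow>
      \<bar>cosine_transform (truncated_power 1 (\<rho> * Q)) \<xi>\<bar>
        \<le> C * Q powr (real DIM('a) / 2 + 1 - \<theta>) * norm \<xi> powr (- 2 * \<theta>)"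
    using cosine_transform_interpolated[OF \<rho>] by blast
  have "integrable (tail_measure a (real DIM('a) / 2))
      (\<lambda>Q. C * norm \<xi> powr (- 2 * 1) * Q powr (real DIM('a) / 2 + 1 - 1))"
    using a by (intro integrable_mult_right integrable_tail_measure_powr) auto
  then show ?thesis
  proof (rule Bochner_Integration.integrable_bound)
    show "AE Q in tail_measure a (real DIM('a) / 2). norm (cosine_transform (truncated_power 1 (\<rho> * Q)) \<xi>)
      \<le> norm (C * norm \<xi> powr (- 2 * 1) * Q powr (real DIM('a) / 2 + 1 - 1))"
      using AE_tail_measure
    proof eventually_elim
      case (elim Q)
      show ?case
        using C(2)[of 1 Q \<xi>] elim \<xi> C(1) by (simp add: abs_mult mult_ac)
    qed
    have "(\<lambda>Q. (\<xi>, Q)) \<in> borel \<rightarrow>\<^sub>M borel \<Otimes>\<^sub>M borel" by measurable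
    from measurable_compose[OF this measurable_cosine_transform_truncated]
    show "(\<lambda>Q. cosine_transform (truncated_power 1 (\<rho> * Q)) \<xi>) \<in> borel_measurable (tail_measure a (real DIM('a) / 2))"
      by (simp add: measurable_cong_sets[OF sets_tail_measure refl])
  qed
qed

lemma continuous_tail_potential:
  fixes \<xi> :: "'a::euclidean_space"
  assumes a: "0 < a" "a < 1" and \<rho>: "0 < \<rho>" and \<xi>: "\<xi> \<noteq> 0"
  shows "isCont (tail_potential a \<rho>) \<xi>"
  unfolding continuous_at_sequentially comp_def
proof (intro allI impI)
  fix X assume X: "X \<longlonglongrightarrow> \<xi>"
  let ?N = "\<lambda>\<xi>::'a. \<lambda>Q. cosine_transform (truncated_power 1 (\<rho> * Q)) \<xi>"
  let ?\<mu> = "tail_measure a (real DIM('a) / 2)"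
  obtain C where C: "0 \<le> C"
    "\<And>\<theta> Q (\<xi>::'a). 0 \<le> \<theta> \<Longrightarrow> \<theta> \<le> 1 \<Longrightarrow> 0 < Q \<Longrightarrow> \<xi> \<noteq> 0 \<Longrightarrow>
      \<bar>?N \<xi> Q\<bar> \<le> C * Q powr (real DIM('a) / 2 + 1 - \<theta>) * norm \<xi> powr (- 2 * \<theta>)"
    using cosine_transform_interpolated[OF \<rho>] by blast
  define r where "r = norm \<xi> / 2"
  have r: "0 < r" "r < norm \<xi>" using \<xi> by (auto simp: r_def)
  have ev: "eventually (\<lambda>n. r < norm (X n)) sequentially"
    using order_tendstoD(1)[OF tendsto_norm[OF X] r(2)] .
  have "(\<lambda>n. \<integral>Q. (if r < norm (X n) then ?N (X n) Q else 0) \<partial>?\<mu>) \<longlonglongrightarrow> (\<integral>Q. ?N \<xi> Q \<partial>?\<mu>)"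
  proof (rule integral_dominated_convergence)
    show "integrable ?\<mu> (\<lambda>Q. C * r powr (- 2 * 1) * Q powr (real DIM('a) / 2 + 1 - 1))"
      using a by (intro integrable_mult_right integrable_tail_measure_powr) auto
    show "AE Q in ?\<mu>. (\<lambda>n. if r < norm (X n) then ?N (X n) Q else 0) \<longlonglongrightarrow> ?N \<xi> Q"
      using AE_tail_measure
    proof eventually_elim
      case (elim Q)
      have "integrable lborel (truncated_power 1 (\<rho> * Q) :: 'a \<Rightarrow> real)"
        using \<rho> elim by (intro integrable_truncated_power) auto
      from continuous_cosine_transform[OF this, of \<xi>] X
      have "(\<lambda>n. ?N (X n) Q) \<longlonglongrightarrow> ?N \<xi> Q"
        by (rule isCont_tendsto_compose)
      then show ?case
        by (rule Lim_transform_eventually) (use ev in eventually_elim, auto)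
    qed
    show "AE Q in ?\<mu>. norm (if r < norm (X n) then ?N (X n) Q else 0)
      \<le> C * r powr (- 2 * 1) * Q powr (real DIM('a) / 2 + 1 - 1)" for n
      using AE_tail_measure
    proof eventually_elim
      case (elim Q)
      show ?case
      proof (cases "r < norm (X n)")
        case True
        then have "X n \<noteq> 0" using r by auto
        then have "\<bar>?N (X n) Q\<bar> \<le> C * Q powr (real DIM('a) / 2 + 1 - 1) * norm (X n) powr (- 2 * 1)"
          using C(2)[of 1 Q "X n"] elim by simp
        also have "\<dots> \<le> C * Q powr (real DIM('a) / 2 + 1 - 1) * r powr (- 2 * 1)"
          using True r C(1) by (intro mult_left_mono powr_mono2') auto
        finally show ?thesis using True by (simp add: mult_ac)
      qed (use C(1) in simp)
    qed
    show "?N \<xi> \<in> borel_measurable ?\<mu>"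
      using integrable_tail_cosine_transform[OF a \<rho> \<xi>] by auto
    show "(\<lambda>Q. if r < norm (X n) then ?N (X n) Q else 0) \<in> borel_measurable ?\<mu>" for n
    proof (cases "r < norm (X n)")
      case True
      then have "X n \<noteq> 0" using r by auto
      from integrable_tail_cosine_transform[OF a \<rho> this] True show ?thesis by auto
    qed simp
  qed
  then show "(\<lambda>n. tail_potential a \<rho> (X n)) \<longlonglongrightarrow> tail_potential a \<rho> \<xi>"
    unfolding tail_potential_def
    by (rule Lim_transform_eventually) (use ev in eventually_elim, auto)
qed

text \<open>
  The bound with exponent \<open>\<theta>\<close> has product form, which justifies Fubini.  It holds for \<open>\<xi> \<noteq> 0\<close> and
  \<open>Q > 1\<close> only; \<open>f 0 = 0\<close> and the factor \<open>indicator {1<..} Q\<close>, which is \<open>1\<close> for \<open>\<mu>\<close>-almost every \<open>Q\<close>, take care of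
  the other points.
\<close>

lemma integrable_times_tail_cosine_transform:
  fixes f :: "'a::euclidean_space \<Rightarrow> 'b::{banach, second_countable_topology}"
  assumes a: "a < 1" "0 < real DIM('a) / 2 + a" and \<rho>: "0 < \<rho>" and \<theta>: "0 < \<theta>" "\<theta> \<le> 1" "1 < \<theta> + a"
    and [measurable]: "f \<in> borel_measurable borel" and f0: "f 0 = 0"
    and f: "integrable lborel (\<lambda>\<xi>. norm \<xi> powr (- 2 * \<theta>) * norm (f \<xi>))"
  shows "integrable (lborel \<Otimes>\<^sub>M tail_measure a (real DIM('a) / 2))
    (\<lambda>(\<xi>, Q). cosine_transform (truncated_power 1 (\<rho> * Q)) \<xi> *\<^sub>R f \<xi>)"
proof -
  let ?\<mu> = "tail_measure a (real DIM('a) / 2)"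
  interpret \<mu>: finite_measure ?\<mu>
    using a by (intro finite_measure_tail_measure) auto
  interpret P: pair_sigma_finite "lborel :: 'a measure" ?\<mu> ..
  let ?N = "\<lambda>\<xi>::'a. \<lambda>Q. cosine_transform (truncated_power 1 (\<rho> * Q)) \<xi>"
  obtain C where C: "0 \<le> C"
    "\<And>\<theta> Q (\<xi>::'a). 0 \<le> \<theta> \<Longrightarrow> \<theta> \<le> 1 \<Longrightarrow> 0 < Q \<Longrightarrow> \<xi> \<noteq> 0 \<Longrightarrow>
      \<bar>?N \<xi> Q\<bar> \<le> C * Q powr (real DIM('a) / 2 + 1 - \<theta>) * norm \<xi> powr (- 2 * \<theta>)"
    using cosine_transform_interpolated[OF \<rho>] by blast
  let ?f = "\<lambda>\<xi>::'a. \<lambda>Q. (indicator {1<..} Q * ?N \<xi> Q) *\<^sub>R f \<xi>"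
  have meas [measurable]: "(\<lambda>x. ?N (fst x) (snd x)) \<in> borel_measurable (borel \<Otimes>\<^sub>M borel)"
    using measurable_cosine_transform_truncated[of \<rho>, where 'a='a] by (simp add: case_prod_beta')
  have [measurable]: "(\<lambda>x. ?N (fst x) (snd x)) \<in> borel_measurable (lborel \<Otimes>\<^sub>M ?\<mu>)"
    using meas by (simp add: measurable_cong_sets[OF sets_pair_measure_cong[OF sets_lborel sets_tail_measure] refl])
  have "integrable (lborel \<Otimes>\<^sub>M ?\<mu>) (case_prod ?f)"
  proof (rule P.integrable_dominated_by_product[OF _ f])
    show "integrable ?\<mu> (\<lambda>Q. C * Q powr (real DIM('a) / 2 + 1 - \<theta>))"
      using a \<theta> by (intro integrable_mult_right integrable_tail_measure_powr) auto
    show "norm (?f \<xi> Q) \<le> norm \<xi> powr (- 2 * \<theta>) * norm (f \<xi>) * (C * Q powr (real DIM('a) / 2 + 1 - \<theta>))" for \<xi> Q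
    proof (cases "\<xi> \<noteq> 0 \<and> 1 < Q")
      case True
      then have "\<bar>?N \<xi> Q\<bar> \<le> C * Q powr (real DIM('a) / 2 + 1 - \<theta>) * norm \<xi> powr (- 2 * \<theta>)"
        using C(2)[of \<theta> Q \<xi>] \<theta> by simp
      then have "\<bar>?N \<xi> Q\<bar> * norm (f \<xi>) \<le> C * Q powr (real DIM('a) / 2 + 1 - \<theta>) * norm \<xi> powr (- 2 * \<theta>) * norm (f \<xi>)"
        by (intro mult_right_mono) auto
      then show ?thesis using True by (simp add: mult_ac)
    next
      case False
      then show ?thesis using C(1) f0 by auto
    qed
    show "case_prod ?f \<in> borel_measurable (lborel \<Otimes>\<^sub>M ?\<mu>)"
      by (simp add: case_prod_beta') measurable
  qed
  moreover have "AE x in lborel \<Otimes>\<^sub>M ?\<mu>. case_prod ?f x = (\<lambda>(\<xi>, Q). ?N \<xi> Q *\<^sub>R f \<xi>) x"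
  proof -
    have "AE x in (lborel :: 'a measure) \<Otimes>\<^sub>M ?\<mu>. 1 < snd x"
    proof (rule P.AE_pair_measure[where P="\<lambda>x. 1 < snd x"])
      show "{x \<in> space ((lborel :: 'a measure) \<Otimes>\<^sub>M ?\<mu>). 1 < snd x} \<in> sets (lborel \<Otimes>\<^sub>M ?\<mu>)" by measurable
    qed (use AE_tail_measure[of a "real DIM('a) / 2"] in auto)
    then show ?thesis by eventually_elim (auto simp: case_prod_beta')
  qed
  ultimately show ?thesis
    by (subst integrable_cong_AE[symmetric, where f="case_prod ?f"]) (auto simp: case_prod_beta')
qed

lemma gaussian_test_tail_potential:
  assumes a: "0 < a" "a < 1" and \<rho>: "0 < \<rho>" and s: "0 < s"
  defines "D \<equiv> real DIM('a::euclidean_space) / 2"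
  defines "I \<equiv> (LBINT \<xi>. (norm \<xi>)\<^sup>2 * exp (- (s * (norm \<xi>)\<^sup>2)) * tail_potential a \<rho> (\<xi>::'a))"
  shows "integrable lborel (\<lambda>\<xi>::'a. (norm \<xi>)\<^sup>2 * exp (- (s * (norm \<xi>)\<^sup>2)) * tail_potential a \<rho> \<xi>)"
    and "0 \<le> I"
    and "ennreal I = ennreal (pi powr (2 * D) / Gamma D * s powr (- D - 1) * Gamma (1 - a) * (4 * s) powr (1 - a)) * incomplete_gamma D a \<rho> s"
proof -
  have D: "0 < D" by (simp add: D_def)
  have G: "0 < Gamma (1 - a)" "0 < Gamma D" using a D by (auto intro!: Gamma_real_pos)
  let ?\<mu> = "tail_measure a D"
  interpret \<mu>: finite_measure ?\<mu>
    using a D by (intro finite_measure_tail_measure) auto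
  interpret P: pair_sigma_finite "lborel :: 'a measure" ?\<mu> ..
  let ?F = "\<lambda>\<xi>::'a. \<lambda>Q. (norm \<xi>)\<^sup>2 * exp (- (s * (norm \<xi>)\<^sup>2)) * cosine_transform (truncated_power 1 (\<rho> * Q)) \<xi>"
  have int: "integrable (lborel \<Otimes>\<^sub>M ?\<mu>) (case_prod ?F)"
  proof -
    let ?f = "\<lambda>\<xi>::'a. (norm \<xi>)\<^sup>2 * exp (- (s * (norm \<xi>)\<^sup>2))"
    have "integrable lborel (\<lambda>\<xi>::'a. norm \<xi> powr (- 2 * 1) * norm (?f \<xi>))"
    proof (rule Bochner_Integration.integrable_bound[OF integrable_gaussian[OF s]])
      have "norm (norm \<xi> powr (- 2 * 1) * norm (?f \<xi>)) \<le> norm (exp (- (s * (norm \<xi>)\<^sup>2)))" for \<xi> :: 'a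
        by (cases "\<xi> = 0") (simp_all add: abs_mult powr_neg_numeral)
      then show "AE \<xi>::'a in lborel. norm (norm \<xi> powr (- 2 * 1) * norm (?f \<xi>)) \<le> norm (exp (- (s * (norm \<xi>)\<^sup>2)))"
        by (intro AE_I2)
    qed measurable
    then have "integrable (lborel \<Otimes>\<^sub>M ?\<mu>) (\<lambda>(\<xi>, Q). cosine_transform (truncated_power 1 (\<rho> * Q)) \<xi> *\<^sub>R ?f \<xi>)"
      unfolding D_def using a \<rho>
      by (intro integrable_times_tail_cosine_transform[where \<theta>=1]) auto
    then show ?thesis by (simp add: mult.commute)
  qed
  have eq: "(\<integral>Q. ?F \<xi> Q \<partial>?\<mu>) = (norm \<xi>)\<^sup>2 * exp (- (s * (norm \<xi>)\<^sup>2)) * tail_potential a \<rho> \<xi>" for \<xi> :: 'a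
    unfolding tail_potential_def D_def by simp
  show "integrable lborel (\<lambda>\<xi>::'a. (norm \<xi>)\<^sup>2 * exp (- (s * (norm \<xi>)\<^sup>2)) * tail_potential a \<rho> \<xi>)"
    using P.integrable_fst[OF int] unfolding eq .
  define J where "J = (\<lambda>Q. LBINT \<xi>. ?F \<xi> Q)"
  have I: "I = (\<integral>Q. J Q \<partial>?\<mu>)"
    unfolding I_def J_def P.Fubini_integral[OF int] eq ..
  have J: "0 \<le> J Q" "ennreal (J Q) = ennreal (pi powr (2 * D) / Gamma D * 1 * s powr (- D - 1)) * gaussian_test D 1 (\<rho> * Q) s"
    if "1 < Q" for Q
    using gaussian_test_truncated_power[OF zero_less_one _ s, of "\<rho> * Q", where 'a='a] \<rho> that
    unfolding J_def D_def by simp_all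
  have AE: "AE Q in ?\<mu>. 0 \<le> J Q"
    using AE_tail_measure by eventually_elim (rule J(1))
  show "0 \<le> I" unfolding I by (rule integral_nonneg_AE[OF AE])
  have Jint: "integrable ?\<mu> J"
    unfolding J_def by (rule P.integrable_snd[OF int])
  have meas: "(\<lambda>Q. gaussian_test D 1 (\<rho> * Q) s) \<in> borel_measurable ?\<mu>"
    unfolding gaussian_test_def indicator_def greaterThanLessThan_iff by measurable
  have "ennreal I = (\<integral>\<^sup>+Q. ennreal (J Q) \<partial>?\<mu>)"
    unfolding I by (rule nn_integral_eq_integral[OF Jint AE, symmetric])
  also have "\<dots> = (\<integral>\<^sup>+Q. ennreal (pi powr (2 * D) / Gamma D * 1 * s powr (- D - 1)) * gaussian_test D 1 (\<rho> * Q) s \<partial>?\<mu>)"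
    by (rule nn_integral_cong_AE) (use AE_tail_measure in eventually_elim, rule J(2))
  also have "\<dots> = ennreal (pi powr (2 * D) / Gamma D * 1 * s powr (- D - 1)) * (ennreal (Gamma (1 - a) * (4 * s) powr (1 - a)) * incomplete_gamma D a \<rho> s)"
    using meas by (subst nn_integral_cmult) (simp_all only: gaussian_test_tail[OF a D \<rho> s])
  also have "\<dots> = ennreal (pi powr (2 * D) / Gamma D * s powr (- D - 1) * Gamma (1 - a) * (4 * s) powr (1 - a)) * incomplete_gamma D a \<rho> s"
    using G by (subst mult.assoc[symmetric]) (simp add: ennreal_mult'[symmetric] mult_ac)
  finally show "ennreal I = \<dots>" .
qed

lemma nn_integral_Gamma_minus:
  fixes a q :: real
  assumes "a < 1" "0 < q"
  shows "(\<integral>\<^sup>+\<tau>\<in>{0<..}. ennreal (\<tau> powr (- a) * exp (- (q * \<tau>))) \<partial>lborel) = ennreal (Gamma (1 - a) * q powr (a - 1))"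
  using nn_integral_Gamma_shifted[OF assms, of 0] by simp

text \<open>
  The multiplier is a superposition of Gaussians:
  \<open>Gamma (1 - a) |\<xi>| powr (2 a - 2)\<close> is the integral of \<open>\<tau> powr (- a) exp (- \<tau> |\<xi>|\<^sup>2)\<close> over
  \<open>\<tau> > 0\<close>.  Each Gaussian only shifts the parameter \<open>s\<close> of the weight to \<open>s + \<tau>\<close>.
\<close>

lemma gaussian_test_riesz_potential:
  assumes a: "0 < a" "a < 1" and \<rho>: "0 < \<rho>" and s: "0 < s"
  defines "D \<equiv> real DIM('a::euclidean_space) / 2"
  defines "R \<equiv> (\<lambda>\<xi>::'a. norm \<xi> powr (2 * a - 2) * cosine_transform (truncated_power a \<rho>) \<xi>)"
  defines "I \<equiv> (LBINT \<xi>. (norm \<xi>)\<^sup>2 * exp (- (s * (norm \<xi>)\<^sup>2)) * R \<xi>)"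
  shows "integrable lborel (\<lambda>\<xi>::'a. (norm \<xi>)\<^sup>2 * exp (- (s * (norm \<xi>)\<^sup>2)) * R \<xi>)"
    and "0 \<le> I"
    and "ennreal I = ennreal (pi powr (2 * D) / Gamma D * Gamma (a + 1) * s powr (- a - D)) * incomplete_gamma D a \<rho> s"
proof -
  have D: "0 < D" by (simp add: D_def)
  have G: "0 < Gamma (1 - a)" "0 < Gamma D" "0 < Gamma a" using a D by (auto intro!: Gamma_real_pos)
  let ?v = "truncated_power a \<rho> :: 'a \<Rightarrow> real"
  have v: "integrable lborel ?v" using a \<rho> by (intro integrable_truncated_power) auto
  have [measurable]: "cosine_transform ?v \<in> borel_measurable borel"
    unfolding cosine_transform_def by measurable
  define C where "C = (LBINT y. \<bar>?v y\<bar>)"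
  have C: "\<bar>cosine_transform ?v \<xi>\<bar> \<le> C" for \<xi>
    unfolding C_def by (rule abs_cosine_transform_le[OF v])
  have R_bound: "(norm \<xi>)\<^sup>2 * \<bar>R \<xi>\<bar> \<le> C * (1 + (norm \<xi>)\<^sup>2)" for \<xi>
  proof (cases "\<xi> = 0")
    case False
    have "norm \<xi> powr (2 * a) \<le> 1 + (norm \<xi>)\<^sup>2"
    proof (cases "norm \<xi> \<le> 1")
      case True
      then have "norm \<xi> powr (2 * a) \<le> 1 powr (2 * a)" using a by (intro powr_mono2) auto
      then show ?thesis by (simp add: add_increasing2)
    next
      case False
      then have "norm \<xi> powr (2 * a) \<le> norm \<xi> powr 2" using a by (intro powr_mono) auto
      also have "norm \<xi> powr 2 = (norm \<xi>)\<^sup>2" by (simp add: powr_numeral)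
      finally show ?thesis by simp
    qed
    moreover have "(norm \<xi>)\<^sup>2 * norm \<xi> powr (2 * a - 2) = norm \<xi> powr (2 * a)"
      using False by (simp add: powr_diff powr_numeral)
    ultimately have "((norm \<xi>)\<^sup>2 * norm \<xi> powr (2 * a - 2)) * \<bar>cosine_transform ?v \<xi>\<bar> \<le> (1 + (norm \<xi>)\<^sup>2) * C"
      using C[of \<xi>] by (intro mult_mono) auto
    then show ?thesis by (simp add: R_def abs_mult mult_ac)
  qed (simp add: C_def)
  show int: "integrable lborel (\<lambda>\<xi>::'a. (norm \<xi>)\<^sup>2 * exp (- (s * (norm \<xi>)\<^sup>2)) * R \<xi>)"
  proof (rule integrable_gaussian_bounded[OF s, where C=C])
    show "(\<lambda>\<xi>::'a. (norm \<xi>)\<^sup>2 * exp (- (s * (norm \<xi>)\<^sup>2)) * R \<xi>) \<in> borel_measurable borel"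
      unfolding R_def by measurable
    show "\<bar>(norm \<xi>)\<^sup>2 * exp (- (s * (norm \<xi>)\<^sup>2)) * R \<xi>\<bar> \<le> C * ((1 + (norm \<xi>)\<^sup>2) * exp (- (s * (norm \<xi>)\<^sup>2)))" for \<xi>
      using mult_right_mono[OF R_bound[of \<xi>], of "exp (- (s * (norm \<xi>)\<^sup>2))"] by (simp add: abs_mult mult_ac)
  qed
  let ?F = "\<lambda>\<xi>::'a. \<lambda>\<tau>. (norm \<xi>)\<^sup>2 * exp (- (s * (norm \<xi>)\<^sup>2)) * cosine_transform ?v \<xi> * (indicator {0<..} \<tau> * (\<tau> powr (- a) * exp (- ((norm \<xi>)\<^sup>2 * \<tau>))))"
  have \<tau>: "has_bochner_integral lborel (\<lambda>\<tau>. indicator {0<..} \<tau> * (\<tau> powr (- a) * exp (- ((norm \<xi>)\<^sup>2 * \<tau>)))) (Gamma (1 - a) * norm \<xi> powr (2 * a - 2))"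
    if "\<xi> \<noteq> 0" for \<xi> :: 'a
  proof (rule has_bochner_integral_nn_integral)
    have "(\<integral>\<^sup>+\<tau>. ennreal (indicator {0<..} \<tau> * (\<tau> powr (- a) * exp (- ((norm \<xi>)\<^sup>2 * \<tau>)))) \<partial>lborel)
       = (\<integral>\<^sup>+\<tau>\<in>{0<..}. ennreal (\<tau> powr (- a) * exp (- ((norm \<xi>)\<^sup>2 * \<tau>))) \<partial>lborel)"
      by (intro nn_integral_cong) (auto split: split_indicator)
    also have "\<dots> = ennreal (Gamma (1 - a) * ((norm \<xi>)\<^sup>2) powr (a - 1))"
      using a that by (intro nn_integral_Gamma_minus) auto
    also have "((norm \<xi>)\<^sup>2) powr (a - 1) = norm \<xi> powr (2 * a - 2)"
    proof -
      have "(norm \<xi>)\<^sup>2 = norm \<xi> powr 2" using that by simp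
      then have "((norm \<xi>)\<^sup>2) powr (a - 1) = norm \<xi> powr (2 * (a - 1))"
        by (simp only: powr_powr)
      then show ?thesis by (simp add: right_diff_distrib)
    qed
    finally show "(\<integral>\<^sup>+\<tau>. ennreal (indicator {0<..} \<tau> * (\<tau> powr (- a) * exp (- ((norm \<xi>)\<^sup>2 * \<tau>)))) \<partial>lborel) = ennreal (Gamma (1 - a) * norm \<xi> powr (2 * a - 2))" .
  qed (use G in auto)
  have F: "(LBINT \<tau>. ?F \<xi> \<tau>) = Gamma (1 - a) * ((norm \<xi>)\<^sup>2 * exp (- (s * (norm \<xi>)\<^sup>2)) * R \<xi>)" for \<xi>
  proof (cases "\<xi> = 0")
    case False
    show ?thesis
      unfolding integral_mult_right_zero has_bochner_integral_integral_eq[OF \<tau>[OF False]] R_def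
      by (simp only: mult_ac)
  qed simp
  have nF: "(LBINT \<tau>. norm (?F \<xi> \<tau>)) = \<bar>Gamma (1 - a) * ((norm \<xi>)\<^sup>2 * exp (- (s * (norm \<xi>)\<^sup>2)) * R \<xi>)\<bar>" for \<xi>
  proof (cases "\<xi> = 0")
    case False
    have *: "norm (?F \<xi> \<tau>) = \<bar>(norm \<xi>)\<^sup>2 * exp (- (s * (norm \<xi>)\<^sup>2)) * cosine_transform ?v \<xi>\<bar> * (indicator {0<..} \<tau> * (\<tau> powr (- a) * exp (- ((norm \<xi>)\<^sup>2 * \<tau>))))" for \<tau>
      by (simp add: abs_mult)
    show ?thesis
      unfolding * integral_mult_right_zero has_bochner_integral_integral_eq[OF \<tau>[OF False]] R_def
      using G by (simp add: abs_mult mult_ac)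
  qed simp
  have int2: "integrable (lborel \<Otimes>\<^sub>M lborel) (case_prod ?F)"
  proof (rule lborel_pair.Fubini_integrable)
    show "integrable lborel (\<lambda>\<xi>. LBINT \<tau>. norm (case (\<xi>, \<tau>) of (\<xi>, \<tau>) \<Rightarrow> ?F \<xi> \<tau>))"
      using int by (simp only: case_prod_conv nF) (intro integrable_abs integrable_mult_right)
    show "AE \<xi> in lborel. integrable lborel (\<lambda>\<tau>. case (\<xi>, \<tau>) of (\<xi>, \<tau>) \<Rightarrow> ?F \<xi> \<tau>)"
    proof (rule AE_I2)
      fix \<xi> :: 'a
      show "integrable lborel (\<lambda>\<tau>. case (\<xi>, \<tau>) of (\<xi>, \<tau>) \<Rightarrow> ?F \<xi> \<tau>)"
      proof (cases "\<xi> = 0")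
        case False
        from integrable.intros[OF \<tau>[OF this]] show ?thesis
          unfolding case_prod_conv by (rule integrable_mult_right)
      qed simp
    qed
  qed measurable
  have inner: "(LBINT \<xi>. ?F \<xi> \<tau>) = indicator {0<..} \<tau> * \<tau> powr (- a) *
      (LBINT \<xi>. (norm \<xi>)\<^sup>2 * exp (- ((s + \<tau>) * (norm \<xi>)\<^sup>2)) * cosine_transform ?v \<xi>)" for \<tau>
  proof -
    have "exp (- (s * q)) * exp (- (q * \<tau>)) = exp (- ((s + \<tau>) * q))" for q
      by (simp flip: exp_add add: algebra_simps)
    then have *: "?F \<xi> \<tau> = indicator {0<..} \<tau> * \<tau> powr (- a) * ((norm \<xi>)\<^sup>2 * exp (- ((s + \<tau>) * (norm \<xi>)\<^sup>2)) * cosine_transform ?v \<xi>)" for \<xi>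
      by (simp only: mult_ac flip: \<open>\<And>q. exp (- (s * q)) * exp (- (q * \<tau>)) = exp (- ((s + \<tau>) * q))\<close>)
    show ?thesis unfolding * integral_mult_right_zero ..
  qed
  define J where "J = (\<lambda>\<tau>. LBINT \<xi>. ?F \<xi> \<tau>)"
  define K where "K = pi powr (2 * D) / Gamma D * a"
  have K: "0 < K" using a G by (simp add: K_def)
  have J: "0 \<le> J \<tau>" "ennreal (J \<tau>) = ennreal K * (ennreal (\<tau> powr (- a) * (s + \<tau>) powr (- D - 1)) * gaussian_test D a \<rho> (s + \<tau>) * indicator {0<..} \<tau>)" for \<tau>
  proof -
    have "0 \<le> J \<tau> \<and> ennreal (J \<tau>) = ennreal K * (ennreal (\<tau> powr (- a) * (s + \<tau>) powr (- D - 1)) * gaussian_test D a \<rho> (s + \<tau>) * indicator {0<..} \<tau>)"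
    proof (cases "0 < \<tau>")
      case True
      then have s\<tau>: "0 < s + \<tau>" using s by simp
      let ?L = "LBINT \<xi>::'a. (norm \<xi>)\<^sup>2 * exp (- ((s + \<tau>) * (norm \<xi>)\<^sup>2)) * cosine_transform ?v \<xi>"
      note L = gaussian_test_truncated_power[OF a(1) \<rho> s\<tau>, where 'a='a, folded D_def]
      have JL: "J \<tau> = \<tau> powr (- a) * ?L" unfolding J_def inner using True by simp
      have "ennreal (J \<tau>) = ennreal (\<tau> powr (- a)) * (ennreal (K * (s + \<tau>) powr (- D - 1)) * gaussian_test D a \<rho> (s + \<tau>))"
        unfolding JL K_def using L(2) by (simp add: ennreal_mult')
      also have "\<dots> = ennreal K * (ennreal (\<tau> powr (- a) * (s + \<tau>) powr (- D - 1)) * gaussian_test D a \<rho> (s + \<tau>))"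
        using K by (simp add: ennreal_mult' mult_ac)
      finally show ?thesis using True L(1) unfolding JL by simp
    qed (simp add: J_def inner)
    then show "0 \<le> J \<tau>" "ennreal (J \<tau>) = ennreal K * (ennreal (\<tau> powr (- a) * (s + \<tau>) powr (- D - 1)) * gaussian_test D a \<rho> (s + \<tau>) * indicator {0<..} \<tau>)"
      by blast+
  qed
  have GI: "Gamma (1 - a) * I = (LBINT \<tau>. J \<tau>)"
    unfolding J_def lborel_pair.Fubini_integral[OF int2] F I_def by simp
  have "0 \<le> Gamma (1 - a) * I"
    unfolding GI using J(1) by simp
  then show I0: "0 \<le> I" using G by (simp add: zero_le_mult_iff)
  have Jint: "integrable lborel J" unfolding J_def by (rule lborel_pair.integrable_snd[OF int2])
  have meas: "(\<lambda>\<tau>. gaussian_test D a \<rho> (s + \<tau>)) \<in> borel_measurable borel"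
    unfolding gaussian_test_def by measurable
  have "ennreal (Gamma (1 - a) * I) = (\<integral>\<^sup>+\<tau>. ennreal (J \<tau>) \<partial>lborel)"
    unfolding GI using Jint J(1) by (intro nn_integral_eq_integral[symmetric]) auto
  also have "\<dots> = ennreal K * (\<integral>\<^sup>+\<tau>\<in>{0<..}. ennreal (\<tau> powr (- a) * (s + \<tau>) powr (- D - 1)) * gaussian_test D a \<rho> (s + \<tau>) \<partial>lborel)"
    unfolding J(2) using meas by (intro nn_integral_cmult) simp
  also have "\<dots> = ennreal K * (ennreal (Gamma a * Gamma (1 - a) * s powr (- a - D)) * incomplete_gamma D a \<rho> s)"
    unfolding gaussian_test_potential[OF a D \<rho> s] ..
  finally have *: "ennreal (Gamma (1 - a) * I) = ennreal K * (ennreal (Gamma a * Gamma (1 - a) * s powr (- a - D)) * incomplete_gamma D a \<rho> s)" .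
  have Ga: "Gamma (a + 1) = a * Gamma a"
    using a by (intro Gamma_plus1) (auto dest: nonpos_Ints_nonpos)
  have "ennreal I = ennreal (1 / Gamma (1 - a)) * ennreal (Gamma (1 - a) * I)"
    using G by (subst ennreal_mult'[symmetric]) auto
  also have "\<dots> = ennreal (1 / Gamma (1 - a)) * ennreal K * ennreal (Gamma a * Gamma (1 - a) * s powr (- a - D)) * incomplete_gamma D a \<rho> s"
    unfolding * by (simp only: mult.assoc)
  also have "ennreal (1 / Gamma (1 - a)) * ennreal K * ennreal (Gamma a * Gamma (1 - a) * s powr (- a - D))
      = ennreal (1 / Gamma (1 - a) * K * (Gamma a * Gamma (1 - a) * s powr (- a - D)))"
  proof -
    have "ennreal A * ennreal B * ennreal E = ennreal (A * B * E)" if "0 \<le> A" "0 \<le> B" for A B E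
      using that by (simp add: ennreal_mult')
    then show ?thesis using G K by simp
  qed
  also have "1 / Gamma (1 - a) * K * (Gamma a * Gamma (1 - a) * s powr (- a - D)) = pi powr (2 * D) / Gamma D * Gamma (a + 1) * s powr (- a - D)"
    unfolding Ga K_def using G by (simp add: field_simps)
  finally show "ennreal I = ennreal (pi powr (2 * D) / Gamma D * Gamma (a + 1) * s powr (- a - D)) * incomplete_gamma D a \<rho> s" .
qed

text \<open>
  If \<open>h \<xi>0\<close> were not \<open>0\<close>, then by continuity and radiality \<open>h\<close> would have a constant sign on a shell
  around \<open>|\<xi>| = |\<xi>0|\<close>; a bump function of \<open>exp (- |\<xi>|\<^sup>2)\<close> supported in this shell would have a nonzero
  integral against it, contrary to \<open>exponential_moments_zero\<close>.
\<close>

lemma radial_gaussian_moments_zero: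
  fixes h :: "'a::euclidean_space \<Rightarrow> real"
  assumes radial: "\<And>\<xi> \<xi>'. norm \<xi> = norm \<xi>' \<Longrightarrow> h \<xi> = h \<xi>'"
    and [measurable]: "h \<in> borel_measurable borel"
    and cont: "isCont h \<xi>0" and \<xi>0: "\<xi>0 \<noteq> 0"
    and int: "integrable lborel (\<lambda>\<xi>. (norm \<xi>)\<^sup>2 * exp (- (norm \<xi>)\<^sup>2) * h \<xi>)"
    and moments: "\<And>n. (LBINT \<xi>. (norm \<xi>)\<^sup>2 * exp (- (real (Suc n) * (norm \<xi>)\<^sup>2)) * h \<xi>) = 0"
  shows "h \<xi>0 = 0"
proof (rule ccontr)
  assume h0: "h \<xi>0 \<noteq> 0"
  define g where "g = (\<lambda>\<xi>. sgn (h \<xi>0) * h \<xi>)"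
  have "0 < g \<xi>0" using h0 by (simp add: g_def sgn_if)
  moreover have "g \<midarrow>\<xi>0\<rightarrow> g \<xi>0"
    unfolding g_def using cont by (intro tendsto_intros) (simp add: isCont_def)
  ultimately have "eventually (\<lambda>\<xi>. 0 < g \<xi>) (at \<xi>0)"
    by (intro order_tendstoD)
  then obtain \<delta> where \<delta>: "0 < \<delta>" "\<And>\<xi>. dist \<xi> \<xi>0 < \<delta> \<Longrightarrow> 0 < g \<xi>"
    using \<open>0 < g \<xi>0\<close> unfolding eventually_at by (metis UNIV_I)
  have shell: "0 < g \<xi>" if "\<bar>norm \<xi> - norm \<xi>0\<bar> < \<delta>" for \<xi>
  proof -
    define \<xi>' where "\<xi>' = (norm \<xi> / norm \<xi>0) *\<^sub>R \<xi>0"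
    have "\<xi>' - \<xi>0 = ((norm \<xi> - norm \<xi>0) / norm \<xi>0) *\<^sub>R \<xi>0"
      using \<xi>0 by (simp add: \<xi>'_def diff_divide_distrib scaleR_left_diff_distrib)
    then have "dist \<xi>' \<xi>0 = \<bar>norm \<xi> - norm \<xi>0\<bar>"
      using \<xi>0 by (simp add: dist_norm)
    then have "0 < g \<xi>'" using that \<delta> by simp
    moreover have "h \<xi> = h \<xi>'" using \<xi>0 by (intro radial) (simp add: \<xi>'_def)
    ultimately show ?thesis by (simp add: g_def)
  qed
  let ?z = "\<lambda>\<xi>::'a. exp (- (norm \<xi>)\<^sup>2)"
  let ?w = "?z \<xi>0"
  have "isCont (\<lambda>z. sqrt (- ln z)) ?w"
    by (intro continuous_intros) simp_all
  then obtain \<epsilon> where \<epsilon>: "0 < \<epsilon>" "\<And>z. dist z ?w < \<epsilon> \<Longrightarrow> dist (sqrt (- ln z)) (sqrt (- ln ?w)) < \<delta>"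
    using \<delta>(1) unfolding continuous_at_eps_delta by blast
  define \<phi> where "\<phi> = (\<lambda>z. max 0 (\<epsilon> - \<bar>z - ?w\<bar>))"
  have \<phi>: "0 \<le> \<phi> z" "\<bar>\<phi> z\<bar> \<le> \<epsilon>" for z
    using \<epsilon>(1) by (auto simp: \<phi>_def)
  have [measurable]: "\<phi> \<in> borel_measurable borel"
    unfolding \<phi>_def by measurable
  let ?G = "\<lambda>\<xi>. (norm \<xi>)\<^sup>2 * h \<xi> * ?z \<xi> * \<phi> (?z \<xi>)"
  have "(LBINT \<xi>. ?G \<xi>) = 0"
  proof (rule exponential_moments_zero)
    show "integrable lborel (\<lambda>\<xi>. (norm \<xi>)\<^sup>2 * h \<xi> * exp (- (norm \<xi>)\<^sup>2))"
      using int by (simp only: mult_ac)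
    show "(LBINT \<xi>. (norm \<xi>)\<^sup>2 * h \<xi> * exp (- (real (Suc n) * (norm \<xi>)\<^sup>2))) = 0" for n
      using moments[of n] by (simp only: mult_ac)
    show "continuous_on {0..1} \<phi>"
      unfolding \<phi>_def by (intro continuous_intros)
  qed auto
  then have G0: "(LBINT \<xi>. sgn (h \<xi>0) * ?G \<xi>) = 0"
    by simp
  have G: "sgn (h \<xi>0) * ?G \<xi> = (norm \<xi>)\<^sup>2 * g \<xi> * ?z \<xi> * \<phi> (?z \<xi>)" for \<xi>
    by (simp add: g_def)
  have pos: "0 < g \<xi>" if "0 < \<phi> (?z \<xi>)" for \<xi>
  proof -
    have "dist (?z \<xi>) ?w < \<epsilon>"
      using that by (simp add: \<phi>_def dist_real_def split: if_splits)
    from \<epsilon>(2)[OF this] show ?thesis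
      by (intro shell) (simp add: dist_real_def)
  qed
  have Gnn: "0 \<le> sgn (h \<xi>0) * ?G \<xi>" for \<xi>
    unfolding G using pos[of \<xi>] \<phi>(1)[of "?z \<xi>"] by (cases "\<phi> (?z \<xi>) = 0") (auto intro!: mult_nonneg_nonneg)
  have "integrable lborel ?G"
  proof (rule Bochner_Integration.integrable_bound[OF integrable_mult_right[OF int, of \<epsilon>]])
    show "AE \<xi> in lborel. norm (?G \<xi>) \<le> norm (\<epsilon> * ((norm \<xi>)\<^sup>2 * exp (- (norm \<xi>)\<^sup>2) * h \<xi>))"
    proof (rule AE_I2)
      fix \<xi> :: 'a
      have "\<bar>(norm \<xi>)\<^sup>2 * h \<xi> * ?z \<xi>\<bar> * \<bar>\<phi> (?z \<xi>)\<bar> \<le> \<bar>(norm \<xi>)\<^sup>2 * h \<xi> * ?z \<xi>\<bar> * \<epsilon>"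
        by (intro mult_left_mono \<phi>) simp
      then show "norm (?G \<xi>) \<le> norm (\<epsilon> * ((norm \<xi>)\<^sup>2 * exp (- (norm \<xi>)\<^sup>2) * h \<xi>))"
        using \<epsilon>(1) by (simp add: abs_mult mult_ac)
    qed
  qed measurable
  then have "AE \<xi> in lborel. sgn (h \<xi>0) * ?G \<xi> = 0"
    using G0 Gnn by (subst integral_nonneg_eq_0_iff_AE[symmetric]) auto
  then have AE: "AE \<xi> in lborel. \<xi> \<notin> {\<xi>. \<bar>?z \<xi> - ?w\<bar> < \<epsilon>} \<inter> - {0}"
  proof eventually_elim
    case (elim \<xi>)
    show ?case
    proof
      assume "\<xi> \<in> {\<xi>. \<bar>?z \<xi> - ?w\<bar> < \<epsilon>} \<inter> - {0}"
      then have "0 < \<phi> (?z \<xi>)" "\<xi> \<noteq> 0" by (auto simp: \<phi>_def)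
      then have "0 < (norm \<xi>)\<^sup>2 * g \<xi> * ?z \<xi> * \<phi> (?z \<xi>)"
        using pos by (intro mult_pos_pos) auto
      then show False using elim unfolding G by simp
    qed
  qed
  define U where "U = {\<xi>::'a. \<bar>?z \<xi> - ?w\<bar> < \<epsilon>} \<inter> - {0}"
  have U: "open U"
    unfolding U_def by (intro open_Int open_Collect_less continuous_intros open_Compl)
  have "\<xi>0 \<in> U" using \<xi>0 \<epsilon>(1) by (simp add: U_def)
  moreover have "U \<in> null_sets lborel"
    using AE U unfolding U_def[symmetric] by (subst AE_iff_null_sets) (auto intro: borel_open)
  then have "negligible U"
    by (simp add: negligible_iff_null_sets null_sets_completionI)
  ultimately show False
    using open_not_negligible[OF U] by blast
qed

lemma tail_potential_radial:
  fixes \<xi> \<xi>' :: "'a::euclidean_space"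
  assumes "0 < \<rho>" "norm \<xi> = norm \<xi>'"
  shows "tail_potential a \<rho> \<xi> = tail_potential a \<rho> \<xi>'"
proof -
  have "cosine_transform (truncated_power 1 Q) \<xi> = cosine_transform (truncated_power 1 Q) \<xi>'" for Q
  proof (cases "0 \<le> Q")
    case True
    then show ?thesis using assms by (intro cosine_transform_radial) auto
  next
    case False
    then have "max 0 (Q - (norm y)\<^sup>2) = 0" for y :: 'a
      by (smt (verit) zero_le_power2)
    then show ?thesis by (simp add: cosine_transform_def truncated_power_def)
  qed
  then show ?thesis by (simp add: tail_potential_def)
qed

text \<open>
  The ratio of the two Gaussian tests, \<open>Gamma (a + 1) s powr (- a - D)\<close> for the Riesz potential and
  \<open>s powr (- D - 1) Gamma (1 - a) (4 s) powr (1 - a)\<close> for the superposition.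
\<close>

definition riesz_const :: "real \<Rightarrow> real" where
  "riesz_const a = Gamma (a + 1) * 4 powr (a - 1) / Gamma (1 - a)"

theorem riesz_potential_truncated_power:
  fixes \<xi> :: "'a::euclidean_space"
  assumes a: "0 < a" "a < 1" and \<rho>: "0 < \<rho>" and \<xi>: "\<xi> \<noteq> 0"
  shows "norm \<xi> powr (2 * a - 2) * cosine_transform (truncated_power a \<rho>) \<xi> = riesz_const a * tail_potential a \<rho> \<xi>"
proof -
  define D where "D = real DIM('a) / 2"
  have D: "0 < D" by (simp add: D_def)
  have G: "0 < Gamma (1 - a)" "0 < Gamma D" "0 < Gamma (a + 1)" using a D by (auto intro!: Gamma_real_pos)
  have c: "0 < riesz_const a" using G by (simp add: riesz_const_def)
  let ?v = "truncated_power a \<rho> :: 'a \<Rightarrow> real"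
  define R where "R \<xi> = norm \<xi> powr (2 * a - 2) * cosine_transform ?v \<xi>" for \<xi> :: 'a
  define h where "h = (\<lambda>\<xi>::'a. R \<xi> - riesz_const a * tail_potential a \<rho> \<xi>)"
  have v: "integrable lborel ?v" using a \<rho> by (intro integrable_truncated_power) auto
  interpret \<mu>: finite_measure "tail_measure a D"
    using a D by (intro finite_measure_tail_measure) auto
  have [measurable]: "cosine_transform ?v \<in> borel_measurable borel"
    unfolding cosine_transform_def by measurable
  have [measurable]: "(\<lambda>\<xi>::'a. tail_potential a \<rho> \<xi>) \<in> borel_measurable borel"
    unfolding tail_potential_def D_def[symmetric]
    by (rule \<mu>.borel_measurable_lebesgue_integral)
      (use measurable_cosine_transform_truncated[of \<rho>, where 'a='a] in
        \<open>simp add: measurable_cong_sets[OF sets_pair_measure_cong[OF refl sets_tail_measure] refl]\<close>)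
  have RI: "integrable lborel (\<lambda>\<xi>::'a. (norm \<xi>)\<^sup>2 * exp (- (s * (norm \<xi>)\<^sup>2)) * R \<xi>)"
    and TI: "integrable lborel (\<lambda>\<xi>::'a. (norm \<xi>)\<^sup>2 * exp (- (s * (norm \<xi>)\<^sup>2)) * tail_potential a \<rho> \<xi>)"
    and eq: "(LBINT \<xi>::'a. (norm \<xi>)\<^sup>2 * exp (- (s * (norm \<xi>)\<^sup>2)) * R \<xi>)
      = riesz_const a * (LBINT \<xi>::'a. (norm \<xi>)\<^sup>2 * exp (- (s * (norm \<xi>)\<^sup>2)) * tail_potential a \<rho> \<xi>)"
    if s: "0 < s" for s
  proof -
    note R = gaussian_test_riesz_potential[OF a \<rho> s, where 'a='a, folded R_def D_def]
    note T = gaussian_test_tail_potential[OF a \<rho> s, where 'a='a, folded D_def]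
    show "integrable lborel (\<lambda>\<xi>::'a. (norm \<xi>)\<^sup>2 * exp (- (s * (norm \<xi>)\<^sup>2)) * R \<xi>)" by (rule R(1))
    show "integrable lborel (\<lambda>\<xi>::'a. (norm \<xi>)\<^sup>2 * exp (- (s * (norm \<xi>)\<^sup>2)) * tail_potential a \<rho> \<xi>)" by (rule T(1))
    let ?I = "LBINT \<xi>::'a. (norm \<xi>)\<^sup>2 * exp (- (s * (norm \<xi>)\<^sup>2)) * R \<xi>"
    let ?J = "LBINT \<xi>::'a. (norm \<xi>)\<^sup>2 * exp (- (s * (norm \<xi>)\<^sup>2)) * tail_potential a \<rho> \<xi>"
    have "ennreal (riesz_const a * ?J) = ennreal (riesz_const a * (pi powr (2 * D) / Gamma D * s powr (- D - 1) * Gamma (1 - a) * (4 * s) powr (1 - a))) * incomplete_gamma D a \<rho> s"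
    proof -
      have "ennreal (A * J) = ennreal (A * X) * Y" if "ennreal J = ennreal X * Y" "0 \<le> A" for A J X Y
        using that by (simp add: ennreal_mult' mult.assoc)
      from this[OF T(3)] c show ?thesis by simp
    qed
    also have "riesz_const a * (pi powr (2 * D) / Gamma D * s powr (- D - 1) * Gamma (1 - a) * (4 * s) powr (1 - a))
      = pi powr (2 * D) / Gamma D * Gamma (a + 1) * s powr (- a - D)"
    proof -
      have "(4 * s) powr (1 - a) = 4 powr (1 - a) * s powr (1 - a)"
        using s by (simp add: powr_mult)
      moreover have "4 powr (a - 1) * 4 powr (1 - a) = (1::real)"
        by (simp flip: powr_add)
      moreover have "s powr (- D - 1) * s powr (1 - a) = s powr (- a - D)"
        unfolding powr_add[symmetric] by (rule arg_cong[where f="(powr) s"]) simp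
      moreover have "(A * F / g) * (p * S1 * g * (F' * S2)) = p * A * S" if "F * F' = 1" "S1 * S2 = S" "0 < g" for A F F' g p S1 S2 S :: real
      proof -
        have "(A * F / g) * (p * S1 * g * (F' * S2)) = p * A * (F * F') * (S1 * S2) * (g / g)"
          by (simp only: times_divide_eq_left times_divide_eq_right mult_ac)
        then show ?thesis using that by simp
      qed
      ultimately show ?thesis using G(1) unfolding riesz_const_def by simp
    qed
    finally have "ennreal (riesz_const a * ?J) = ennreal ?I"
      unfolding R(3) .
    then show "?I = riesz_const a * ?J"
      using R(2) T(2) c by simp
  qed
  have "h \<xi> = 0"
  proof (rule radial_gaussian_moments_zero[OF _ _ _ \<xi>])
    show "h \<xi> = h \<xi>'" if "norm \<xi> = norm \<xi>'" for \<xi> \<xi>' :: 'a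
      using that a \<rho> cosine_transform_radial[of a \<rho> \<xi> \<xi>'] tail_potential_radial[of \<rho> \<xi> \<xi>' a]
      by (simp add: h_def R_def)
    show "h \<in> borel_measurable borel" unfolding h_def R_def by measurable
    show "isCont h \<xi>"
      unfolding h_def R_def using \<xi> continuous_cosine_transform[OF v, of \<xi>] continuous_tail_potential[OF a \<rho> \<xi>]
      by (intro continuous_intros) auto
    show "integrable lborel (\<lambda>\<xi>. (norm \<xi>)\<^sup>2 * exp (- (norm \<xi>)\<^sup>2) * h \<xi>)"
      using Bochner_Integration.integrable_diff[OF RI[of 1] integrable_mult_right[OF TI[of 1], of "riesz_const a"]]
      by (simp add: h_def algebra_simps)
    show "(LBINT \<xi>. (norm \<xi>)\<^sup>2 * exp (- (real (Suc n) * (norm \<xi>)\<^sup>2)) * h \<xi>) = 0" for n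
    proof -
      have n: "0 < real (Suc n)" by simp
      have "(norm \<xi>)\<^sup>2 * E * h \<xi> = (norm \<xi>)\<^sup>2 * E * R \<xi> - riesz_const a * ((norm \<xi>)\<^sup>2 * E * tail_potential a \<rho> \<xi>)" for \<xi> E
        by (simp add: h_def algebra_simps)
      then show ?thesis
        using Bochner_Integration.integral_diff[OF RI[OF n] integrable_mult_right[OF TI[OF n], of "riesz_const a"]] eq[OF n]
        by (simp only: integral_mult_right_zero diff_self)
    qed
  qed
  then show ?thesis by (simp add: h_def R_def)
qed

section \<open>Schwartz functions and the Fourier transform\<close>

lemma iterated_deriv_append1:
  "iterated_deriv (vs @ [v]) f = iterated_deriv vs (\<lambda>x. frechet_derivative f (at x) v)"
  by (induction vs) simp_all

lemma iterated_deriv_append: "iterated_deriv (us @ vs) f = iterated_deriv us (iterated_deriv vs f)"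
  by (induction us) simp_all

lemma Ck_on_iterated_deriv:
  "Ck_on (k + length vs) S f \<Longrightarrow> Ck_on k S (iterated_deriv vs f)"
proof (induction vs arbitrary: f rule: rev_induct)
  case (snoc v vs)
  then have "Ck_on (k + length vs) S (\<lambda>x. frechet_derivative f (at x) v)"
    by simp
  from snoc.IH[OF this] show ?case
    unfolding iterated_deriv_append1 .
qed simp

lemma schwartz_iterated_deriv:
  assumes "schwartz \<psi>"
  shows "schwartz (iterated_deriv vs \<psi>)"
  using assms unfolding schwartz_def smooth_on_def
  by (auto intro: Ck_on_iterated_deriv simp flip: iterated_deriv_append)

lemma schwartz_frechet_derivative:
  assumes "schwartz \<psi>"
  shows "schwartz (\<lambda>x. frechet_derivative \<psi> (at x) v)"
  using schwartz_iterated_deriv[OF assms, of "[v]"] by simp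

lemma schwartz_continuous: "schwartz \<psi> \<Longrightarrow> continuous_on UNIV \<psi>"
  unfolding schwartz_def smooth_on_def using Ck_on.simps(1) by blast

lemma measurable_schwartz: "schwartz \<psi> \<Longrightarrow> \<psi> \<in> borel_measurable borel"
  by (intro borel_measurable_continuous_onI schwartz_continuous)

lemma schwartz_differentiable: "schwartz \<psi> \<Longrightarrow> \<psi> differentiable (at x)"
  unfolding schwartz_def smooth_on_def using Ck_on.simps(2) by blast

text \<open>
  The decay of a Schwartz function without its derivatives.  The Fourier transform of a Schwartz function is only
  needed to decay in this sense.
\<close>

definition rapidly_decreasing :: "('a::real_normed_vector \<Rightarrow> 'b::real_normed_vector) \<Rightarrow> bool" where
  "rapidly_decreasing f \<longleftrightarrow> (\<forall>n. \<exists>C. \<forall>x. norm x ^ n * norm (f x) \<le> C)"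

lemma schwartz_rapidly_decreasing:
  assumes "schwartz \<psi>"
  shows "rapidly_decreasing \<psi>"
  unfolding rapidly_decreasing_def
proof
  fix n
  have "bounded (range (\<lambda>x. norm x ^ n *\<^sub>R iterated_deriv [] \<psi> x))"
    using assms unfolding schwartz_def by blast
  then show "\<exists>C. \<forall>x. norm x ^ n * norm (\<psi> x) \<le> C"
    by (auto simp: bounded_iff)
qed

text \<open>
  The factor \<open>1 + |x|\<^sup>2\<close> instead of \<open>|x|\<close> keeps the bound finite at the origin.
\<close>

lemma rapidly_decreasing_bound:
  assumes "rapidly_decreasing f"
  obtains C where "0 \<le> C" "\<And>x. norm (f x) \<le> C * (1 + (norm x)\<^sup>2) powr (- real n)"
proof -
  obtain C0 where C0: "\<And>x. norm (f x) \<le> C0"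
    using assms unfolding rapidly_decreasing_def by (metis power_0 mult_1)
  obtain C1 where C1: "\<And>x. norm x ^ (2 * n) * norm (f x) \<le> C1"
    using assms unfolding rapidly_decreasing_def by metis
  have "0 \<le> C0" by (rule order_trans[OF norm_ge_zero C0[of 0]])
  have "0 \<le> C1" by (rule order_trans[OF _ C1[of 0]]) simp
  have "norm (f x) \<le> 2 ^ n * (C0 + C1) * (1 + (norm x)\<^sup>2) powr (- real n)" for x
  proof -
    let ?q = "(norm x)\<^sup>2"
    have "(1 + ?q) ^ n \<le> 2 ^ n * (1 + ?q ^ n)"
    proof (cases "?q \<le> 1")
      case True
      then have "(1 + ?q) ^ n \<le> 2 ^ n" by (intro power_mono) auto
      then show ?thesis by (simp add: distrib_left add_increasing2)
    next
      case False
      then have "(1 + ?q) ^ n \<le> (2 * ?q) ^ n" by (intro power_mono) auto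
      then show ?thesis by (simp add: distrib_left power_mult_distrib add_increasing)
    qed
    then have "(1 + ?q) ^ n * norm (f x) \<le> 2 ^ n * (1 + ?q ^ n) * norm (f x)"
      by (intro mult_right_mono) auto
    also have "\<dots> = 2 ^ n * (norm (f x) + norm x ^ (2 * n) * norm (f x))"
      unfolding power_mult[of "norm x" 2 n] by (simp only: algebra_simps)
    also have "\<dots> \<le> 2 ^ n * (C0 + C1)"
      by (intro mult_left_mono add_mono C0 C1) auto
    finally have *: "(1 + ?q) ^ n * norm (f x) \<le> 2 ^ n * (C0 + C1)" .
    have pos: "0 < 1 + ?q" by (simp add: add_pos_nonneg)
    have "(1 + ?q) powr (- real n) = 1 / (1 + ?q) ^ n"
      using pos by (simp add: powr_minus_divide powr_realpow)
    moreover have "0 < (1 + ?q) ^ n" using pos by simp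
    ultimately show ?thesis
      using * by (simp add: pos_le_divide_eq mult.commute)
  qed
  then show ?thesis using that \<open>0 \<le> C0\<close> \<open>0 \<le> C1\<close> by (metis add_nonneg_nonneg mult_nonneg_nonneg zero_le_numeral zero_le_power)
qed

text \<open>
  In the variable \<open>Q = 1 + |x|\<^sup>2\<close> this is an instance of \<open>nn_integral_tail\<close>.
\<close>

lemma integrable_norm_powr:
  assumes \<beta>: "- real DIM('a) < \<beta>" and e: "0 < e" "(real DIM('a) + \<beta>) / 2 < e"
  shows "integrable lborel (\<lambda>x::'a::euclidean_space. norm x powr \<beta> * (1 + (norm x)\<^sup>2) powr (- e))"
proof (rule integrableI_bounded)
  define D where "D = real DIM('a) / 2"
  have D: "0 < D" by (simp add: D_def)
  define c where "c = pi powr D / Gamma D"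
  have c: "0 < c" using D by (simp add: c_def Gamma_real_pos)
  define b where "b = 1 - D - \<beta> / 2"
  have b: "b < 1" "1 < e + b" using \<beta> e by (auto simp: b_def D_def add_divide_distrib)
  have sq: "norm x powr \<beta> = ((norm x)\<^sup>2) powr (\<beta> / 2)" for x :: 'a
  proof (cases "x = 0")
    case False
    then have "(norm x)\<^sup>2 = norm x powr 2" by simp
    then show ?thesis by (simp only: powr_powr) simp
  qed simp
  have "(\<integral>\<^sup>+(x::'a). ennreal (norm (norm x powr \<beta> * (1 + (norm x)\<^sup>2) powr (- e))) \<partial>lborel)
    = (\<integral>\<^sup>+(x::'a). (\<lambda>q. ennreal (q powr (\<beta> / 2) * (1 + q) powr (- e))) ((norm x)\<^sup>2) \<partial>lborel)"
    by (simp add: sq abs_mult)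
  also have "\<dots> = (\<integral>\<^sup>+q. ennreal (norm_sq_density D q) * ennreal (q powr (\<beta> / 2) * (1 + q) powr (- e)) \<partial>lborel)"
    unfolding D_def by (rule nn_integral_radial) measurable
  also have "\<dots> = (\<integral>\<^sup>+q. ennreal (c * indicator {0<..} q * (q powr (- b) * (1 + q) powr (- e))) \<partial>lborel)"
  proof (intro nn_integral_cong)
    fix q :: real
    have "q powr (D - 1) * q powr (\<beta> / 2) = q powr (- b)"
      unfolding powr_add[symmetric] by (rule arg_cong[where f="(powr) q"]) (simp add: b_def)
    then have *: "norm_sq_density D q * (q powr (\<beta> / 2) * (1 + q) powr (- e)) = c * indicator {0<..} q * (q powr (- b) * (1 + q) powr (- e))"
      by (simp add: norm_sq_density_def c_def mult.assoc[symmetric])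
    show "ennreal (norm_sq_density D q) * ennreal (q powr (\<beta> / 2) * (1 + q) powr (- e)) = ennreal (c * indicator {0<..} q * (q powr (- b) * (1 + q) powr (- e)))"
      unfolding ennreal_mult'[OF norm_sq_density_nonneg[OF D], symmetric] * ..
  qed
  also have "\<dots> = (\<integral>\<^sup>+Q. ennreal (c * indicator {0<..} (-1 + 1 * Q) * ((-1 + 1 * Q) powr (- b) * (1 + (-1 + 1 * Q)) powr (- e))) \<partial>lborel)"
    by (subst nn_integral_real_affine[of _ 1 "-1"]) simp_all
  also have "\<dots> = (\<integral>\<^sup>+Q. ennreal c * (ennreal (Q powr (- e) * (Q - 1) powr (- b)) * indicator {1<..} Q) \<partial>lborel)"
    using c by (intro nn_integral_cong) (auto simp: ennreal_mult'[symmetric] mult_ac split: split_indicator)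
  also have "\<dots> = ennreal c * (\<integral>\<^sup>+Q\<in>{1<..}. ennreal (Q powr (- e) * (Q - 1) powr (- b)) \<partial>lborel)"
    by (intro nn_integral_cmult) measurable
  also have "\<dots> < \<infinity>"
    unfolding nn_integral_tail[OF b(1) e(1) b(2)] by (simp add: ennreal_mult_less_top)
  finally show "(\<integral>\<^sup>+(x::'a). ennreal (norm (norm x powr \<beta> * (1 + (norm x)\<^sup>2) powr (- e))) \<partial>lborel) < \<infinity>" .
qed measurable

lemma integrable_norm_powr_rapidly_decreasing:
  fixes f :: "'a::euclidean_space \<Rightarrow> 'b::{banach, second_countable_topology}"
  assumes f: "rapidly_decreasing f" and [measurable]: "f \<in> borel_measurable borel"
    and \<beta>: "- real DIM('a) < \<beta>"
  shows "integrable lborel (\<lambda>x. norm x powr \<beta> * norm (f x))"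
proof -
  define n where "n = nat \<lceil>\<bar>\<beta>\<bar>\<rceil> + DIM('a) + 1"
  have n: "0 < real n" "(real DIM('a) + \<beta>) / 2 < real n"
  proof -
    have "\<beta> \<le> real (nat \<lceil>\<bar>\<beta>\<bar>\<rceil>)"
      using real_nat_ceiling_ge[of "\<bar>\<beta>\<bar>"] by linarith
    moreover have "real n = real (nat \<lceil>\<bar>\<beta>\<bar>\<rceil>) + real DIM('a) + 1"
      by (simp only: n_def of_nat_add of_nat_1)
    moreover have aux: "0 < k \<and> (d + \<beta>) / 2 < k" if "\<beta> \<le> N" "k = N + d + 1" "0 \<le> N" "0 < d" for k N d :: real
      using that by (auto simp: field_simps)
    ultimately have "0 < real n \<and> (real DIM('a) + \<beta>) / 2 < real n"
      by (intro aux[of "real (nat \<lceil>\<bar>\<beta>\<bar>\<rceil>)"]) (simp_all only: of_nat_0_le_iff of_nat_0_less_iff DIM_positive)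
    then show "0 < real n" "(real DIM('a) + \<beta>) / 2 < real n"
      by blast+
  qed
  obtain C where C: "0 \<le> C" "\<And>x. norm (f x) \<le> C * (1 + (norm x)\<^sup>2) powr (- real n)"
    using rapidly_decreasing_bound[OF f] by metis
  show ?thesis
  proof (rule Bochner_Integration.integrable_bound[OF integrable_mult_right[OF integrable_norm_powr[OF \<beta> n], of C]])
    show "AE x in lborel. norm (norm x powr \<beta> * norm (f x)) \<le> norm (C * (norm x powr \<beta> * (1 + (norm x)\<^sup>2) powr (- real n)))"
    proof (rule AE_I2)
      fix x :: 'a
      have "norm x powr \<beta> * norm (f x) \<le> norm x powr \<beta> * (C * (1 + (norm x)\<^sup>2) powr (- real n))"
        by (intro mult_left_mono C) auto
      then show "norm (norm x powr \<beta> * norm (f x)) \<le> norm (C * (norm x powr \<beta> * (1 + (norm x)\<^sup>2) powr (- real n)))"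
        using C(1) by (simp add: abs_mult mult_ac)
    qed
  qed measurable
qed

lemma integrable_rapidly_decreasing:
  fixes f :: "'a::euclidean_space \<Rightarrow> 'b::{banach, second_countable_topology}"
  assumes f: "rapidly_decreasing f" and [measurable]: "f \<in> borel_measurable borel"
  shows "integrable lborel f"
proof (rule Bochner_Integration.integrable_bound[OF integrable_norm_powr_rapidly_decreasing[OF assms, of 0]])
  show "AE x in lborel. norm (f x) \<le> norm (norm x powr 0 * norm (f x))"
    using AE_lborel_singleton[of "0::'a"] by eventually_elim simp
qed auto

lemma integrable_schwartz:
  fixes \<psi> :: "'a::euclidean_space \<Rightarrow> complex"
  shows "schwartz \<psi> \<Longrightarrow> integrable lborel \<psi>"
  by (intro integrable_rapidly_decreasing schwartz_rapidly_decreasing measurable_schwartz)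

lemma norm_fourier_kernel [simp]: "norm (exp (- \<i> * complex_of_real r)) = 1"
  by (simp add: norm_exp_eq_Re)

lemma integrable_fourier_kernel:
  fixes v :: "'a::euclidean_space \<Rightarrow> complex"
  assumes "integrable lborel v"
  shows "integrable lborel (\<lambda>x. v x * exp (- \<i> * complex_of_real (x \<bullet> \<xi>)))"
proof -
  have [measurable]: "v \<in> borel_measurable borel" using assms by auto
  show ?thesis
    by (rule Bochner_Integration.integrable_bound[OF assms]) (auto simp: norm_mult)
qed

lemma measurable_fourier [measurable]:
  assumes [measurable]: "v \<in> borel_measurable borel"
  shows "fourier v \<in> borel_measurable borel"
  unfolding fourier_def by measurable

lemma norm_fourier_le:
  fixes v :: "'a::euclidean_space \<Rightarrow> complex"
  assumes "integrable lborel v"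
  shows "norm (fourier v \<xi>) \<le> (2 * pi) powr (- real DIM('a) / 2) * (LBINT x. norm (v x))"
proof -
  have "norm (LBINT x. v x * exp (- \<i> * complex_of_real (x \<bullet> \<xi>))) \<le> (LBINT x. norm (v x * exp (- \<i> * complex_of_real (x \<bullet> \<xi>))))"
    by (rule integral_norm_bound)
  also have "\<dots> = (LBINT x. norm (v x))" by (simp add: norm_mult)
  finally show ?thesis
    unfolding fourier_def norm_scaleR by (simp add: mult_left_mono)
qed

lemma fourier_derivative:
  assumes \<psi>: "schwartz \<psi>"
  shows "fourier (\<lambda>x. frechet_derivative \<psi> (at x) b) \<xi> = \<i> * complex_of_real (b \<bullet> \<xi>) * fourier \<psi> \<xi>"
proof -
  let ?e = "\<lambda>x. exp (- \<i> * complex_of_real (x \<bullet> \<xi>))"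
  let ?d = "\<lambda>x. frechet_derivative \<psi> (at x) b"
  let ?f' = "\<lambda>x. ?d x * ?e x - \<i> * complex_of_real (b \<bullet> \<xi>) * (\<psi> x * ?e x)"
  have i1: "integrable lborel (\<lambda>x. \<psi> x * ?e x)"
    by (intro integrable_fourier_kernel integrable_schwartz \<psi>)
  have i2: "integrable lborel (\<lambda>x. ?d x * ?e x)"
    by (intro integrable_fourier_kernel integrable_schwartz schwartz_frechet_derivative \<psi>)
  have der: "((\<lambda>t. \<psi> (x + t *\<^sub>R b) * ?e (x + t *\<^sub>R b)) has_vector_derivative ?f' (x + t *\<^sub>R b)) (at t)" for x t
  proof -
    have 1: "((\<lambda>t. x + t *\<^sub>R b) has_vector_derivative b) (at t)"
      by (auto intro!: derivative_eq_intros)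
    have "(\<psi> has_derivative frechet_derivative \<psi> (at (x + t *\<^sub>R b))) (at (x + t *\<^sub>R b))"
      using schwartz_differentiable[OF \<psi>] by (simp add: frechet_derivative_works)
    from vector_derivative_diff_chain_within[OF 1 has_derivative_at_withinI[OF this]]
    have d1: "((\<lambda>t. \<psi> (x + t *\<^sub>R b)) has_vector_derivative ?d (x + t *\<^sub>R b)) (at t)"
      by (simp add: o_def)
    have "((\<lambda>t. - \<i> * complex_of_real ((x + t *\<^sub>R b) \<bullet> \<xi>)) has_vector_derivative - \<i> * complex_of_real (b \<bullet> \<xi>)) (at t)"
      by (intro has_vector_derivative_mult_right has_vector_derivative_of_real)
        (auto intro!: derivative_eq_intros simp: inner_add_left)
    from field_vector_diff_chain_at[OF this DERIV_exp]
    have d2: "((\<lambda>t. ?e (x + t *\<^sub>R b)) has_vector_derivative - \<i> * complex_of_real (b \<bullet> \<xi>) * ?e (x + t *\<^sub>R b)) (at t)"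
      by (simp add: o_def)
    from has_vector_derivative_mult[OF d1 d2] show ?thesis
      by (rule has_vector_derivative_eq_rhs) (simp add: algebra_simps)
  qed
  have "(LBINT x. ?f' x) = 0"
  proof (rule integral_directional_derivative_eq_0[where S="\<lambda>_. {}" and b=b, OF i1])
    show "continuous_on {0..1} (\<lambda>t. \<psi> (x + t *\<^sub>R b) * ?e (x + t *\<^sub>R b))" for x
      by (intro continuous_at_imp_continuous_on ballI has_vector_derivative_continuous[OF der])
  qed (use der i1 i2 in auto)
  then have "(LBINT x. ?d x * ?e x) = \<i> * complex_of_real (b \<bullet> \<xi>) * (LBINT x. \<psi> x * ?e x)"
    using i1 i2 by simp
  then show ?thesis by (simp add: fourier_def)
qed

lemma fourier_iterated_deriv:
  assumes \<psi>: "schwartz \<psi>"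
  shows "fourier (iterated_deriv (replicate n b) \<psi>) \<xi> = (\<i> * complex_of_real (b \<bullet> \<xi>)) ^ n * fourier \<psi> \<xi>"
proof (induction n)
  case (Suc n)
  then show ?case
    using fourier_derivative[OF schwartz_iterated_deriv[OF \<psi>], of "replicate n b" b \<xi>]
    by (simp add: mult.assoc)
qed simp

lemma norm_power_le_sum_Basis:
  fixes \<xi> :: "'a::euclidean_space"
  shows "norm \<xi> ^ n \<le> real DIM('a) ^ n * (\<Sum>b\<in>Basis. \<bar>b \<bullet> \<xi>\<bar> ^ n)"
proof -
  obtain c :: 'a where c: "c \<in> Basis" "\<And>b. b \<in> Basis \<Longrightarrow> \<bar>b \<bullet> \<xi>\<bar> \<le> \<bar>c \<bullet> \<xi>\<bar>"
  proof -
    have "finite ((\<lambda>b. \<bar>b \<bullet> \<xi>\<bar>) ` Basis)" "(\<lambda>b. \<bar>b \<bullet> \<xi>\<bar>) ` (Basis :: 'a set) \<noteq> {}" by auto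
    from Max_in[OF this] Max_ge[OF this(1)] show ?thesis
      by (metis (no_types, lifting) image_iff imageI that)
  qed
  have "norm \<xi> \<le> (\<Sum>b\<in>Basis. \<bar>\<xi> \<bullet> b\<bar>)" by (rule norm_le_l1)
  also have "\<dots> \<le> (\<Sum>b\<in>(Basis :: 'a set). \<bar>c \<bullet> \<xi>\<bar>)"
    using c by (intro sum_mono) (simp add: inner_commute)
  finally have "norm \<xi> \<le> real DIM('a) * \<bar>c \<bullet> \<xi>\<bar>" by simp
  then have "norm \<xi> ^ n \<le> (real DIM('a) * \<bar>c \<bullet> \<xi>\<bar>) ^ n"
    by (intro power_mono) auto
  also have "\<dots> = real DIM('a) ^ n * \<bar>c \<bullet> \<xi>\<bar> ^ n" by (rule power_mult_distrib)
  also have "\<dots> \<le> real DIM('a) ^ n * (\<Sum>b\<in>Basis. \<bar>b \<bullet> \<xi>\<bar> ^ n)"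
    using c(1) by (intro mult_left_mono member_le_sum) auto
  finally show ?thesis .
qed

lemma fourier_rapidly_decreasing:
  fixes \<psi> :: "'a::euclidean_space \<Rightarrow> complex"
  assumes \<psi>: "schwartz \<psi>"
  shows "rapidly_decreasing (fourier \<psi>)"
  unfolding rapidly_decreasing_def
proof
  fix n
  define C where "C = (\<lambda>b::'a. (2 * pi) powr (- real DIM('a) / 2) * (LBINT x. norm (iterated_deriv (replicate n b) \<psi> x)))"
  have C: "\<bar>b \<bullet> \<xi>\<bar> ^ n * norm (fourier \<psi> \<xi>) \<le> C b" for b \<xi>
  proof -
    have "integrable lborel (iterated_deriv (replicate n b) \<psi>)"
      by (intro integrable_schwartz schwartz_iterated_deriv \<psi>)
    from norm_fourier_le[OF this, of \<xi>] show ?thesis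
      unfolding fourier_iterated_deriv[OF \<psi>] C_def by (simp add: norm_mult norm_power)
  qed
  have "norm \<xi> ^ n * norm (fourier \<psi> \<xi>) \<le> real DIM('a) ^ n * (\<Sum>b\<in>Basis. C b)" for \<xi> :: 'a
  proof -
    have "norm \<xi> ^ n * norm (fourier \<psi> \<xi>) \<le> real DIM('a) ^ n * (\<Sum>b\<in>Basis. \<bar>b \<bullet> \<xi>\<bar> ^ n) * norm (fourier \<psi> \<xi>)"
      by (intro mult_right_mono norm_power_le_sum_Basis) simp
    also have "\<dots> = real DIM('a) ^ n * (\<Sum>b\<in>Basis. \<bar>b \<bullet> \<xi>\<bar> ^ n * norm (fourier \<psi> \<xi>))"
      by (simp add: sum_distrib_right mult.assoc)
    also have "\<dots> \<le> real DIM('a) ^ n * (\<Sum>b\<in>Basis. C b)"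
      by (intro mult_left_mono sum_mono C) auto
    finally show ?thesis .
  qed
  then show "\<exists>C. \<forall>\<xi>. norm \<xi> ^ n * norm (fourier \<psi> \<xi>) \<le> C" by blast
qed

text \<open>
  For integrable functions the distributional transform is the classical one, by Fubini.
\<close>

lemma has_fourier_integrable:
  fixes v :: "'a::euclidean_space \<Rightarrow> complex"
  assumes v: "integrable lborel v"
  shows "has_fourier v (fourier v)"
  unfolding has_fourier_def
proof (intro allI impI conjI)
  fix \<psi> :: "'a \<Rightarrow> complex" assume \<psi>: "schwartz \<psi>"
  let ?c = "(2 * pi) powr (- real DIM('a) / 2)"
  let ?K = "\<lambda>x \<xi>. exp (- \<i> * complex_of_real (x \<bullet> \<xi>))"
  have [measurable]: "v \<in> borel_measurable borel" using v by auto
  have i\<psi>: "integrable lborel \<psi>" by (rule integrable_schwartz[OF \<psi>])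
  have [measurable]: "\<psi> \<in> borel_measurable borel" using \<psi> by (rule measurable_schwartz)
  have prod: "integrable lborel (\<lambda>x. f x * fourier g x)"
    if f: "integrable lborel f" and g: "integrable lborel g" for f g :: "'a \<Rightarrow> complex"
  proof (rule Bochner_Integration.integrable_bound[OF integrable_mult_right[OF f, of "complex_of_real (?c * (LBINT x. norm (g x)))"]])
    show "AE x in lborel. norm (f x * fourier g x) \<le> norm (complex_of_real (?c * (LBINT x. norm (g x))) * f x)"
    proof (rule AE_I2)
      fix x
      have "norm (f x * fourier g x) \<le> norm (f x) * (?c * (LBINT x. norm (g x)))"
        unfolding norm_mult by (intro mult_left_mono norm_fourier_le g) simp
      also have "\<dots> = norm (complex_of_real (?c * (LBINT x. norm (g x))) * f x)"
        unfolding norm_mult norm_of_real by simp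
      finally show "norm (f x * fourier g x) \<le> norm (complex_of_real (?c * (LBINT x. norm (g x))) * f x)" .
    qed
    show "(\<lambda>x. f x * fourier g x) \<in> borel_measurable lborel"
      using f g by (auto intro!: borel_measurable_times measurable_fourier)
  qed
  show "integrable lborel (\<lambda>x. v x * fourier \<psi> x)"
    by (rule prod[OF v i\<psi>])
  show "integrable lborel (\<lambda>\<xi>. fourier v \<xi> * \<psi> \<xi>)"
    using prod[OF i\<psi> v] by (simp add: mult.commute)
  have int: "integrable (lborel \<Otimes>\<^sub>M lborel) (\<lambda>(x, \<xi>). v x * (\<psi> \<xi> * ?K x \<xi>))"
    by (rule lborel_pair.integrable_dominated_by_product[OF _ integrable_norm[OF v] integrable_norm[OF i\<psi>]])
      (simp_all add: norm_mult)
  have "(LBINT x. v x * (\<psi> \<xi> * ?K x \<xi>)) = (LBINT x. v x * ?K x \<xi>) * \<psi> \<xi>" for \<xi>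
    by (subst integral_mult_left_zero[symmetric]) (simp only: mult_ac)
  then have "(LBINT \<xi>. fourier v \<xi> * \<psi> \<xi>) = (LBINT \<xi>. ?c *\<^sub>R (LBINT x. v x * (\<psi> \<xi> * ?K x \<xi>)))"
    unfolding fourier_def by simp
  also have "\<dots> = ?c *\<^sub>R (LBINT \<xi>. LBINT x. v x * (\<psi> \<xi> * ?K x \<xi>))"
    by simp
  also have "(LBINT \<xi>. LBINT x. v x * (\<psi> \<xi> * ?K x \<xi>)) = (LBINT x. LBINT \<xi>. v x * (\<psi> \<xi> * ?K x \<xi>))"
    using lborel_pair.Fubini_integral[OF int] by simp
  also have "?c *\<^sub>R \<dots> = (LBINT x. v x * fourier \<psi> x)"
    unfolding fourier_def by (simp add: inner_commute)
  finally show "(LBINT \<xi>. fourier v \<xi> * \<psi> \<xi>) = (LBINT x. v x * fourier \<psi> x)" .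
qed

lemma fourier_kernel_eq:
  "exp (- \<i> * complex_of_real r) = complex_of_real (cos r) - \<i> * complex_of_real (sin r)"
proof -
  have "exp (- \<i> * complex_of_real r) = cis (- r)"
    by (simp add: cis_conv_exp)
  then show ?thesis by (simp add: complex_eq_iff)
qed

lemma fourier_of_real:
  fixes f :: "'a::euclidean_space \<Rightarrow> real"
  assumes f: "integrable lborel f"
  shows "fourier (\<lambda>x. complex_of_real (f x)) \<xi> = (2 * pi) powr (- real DIM('a) / 2) *\<^sub>R
    (complex_of_real (LBINT x. f x * cos (x \<bullet> \<xi>)) - \<i> * complex_of_real (LBINT x. f x * sin (x \<bullet> \<xi>)))"
proof -
  have [measurable]: "f \<in> borel_measurable borel" using f by auto
  have c: "integrable lborel (\<lambda>x. f x * cos (x \<bullet> \<xi>))" by (rule integrable_cosine[OF f])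
  have s: "integrable lborel (\<lambda>x. f x * sin (x \<bullet> \<xi>))"
    by (rule Bochner_Integration.integrable_bound[OF f]) (auto simp: abs_mult intro!: mult_left_le)
  have "(LBINT x. complex_of_real (f x) * exp (- \<i> * complex_of_real (x \<bullet> \<xi>)))
      = (LBINT x. complex_of_real (f x * cos (x \<bullet> \<xi>)) - \<i> * complex_of_real (f x * sin (x \<bullet> \<xi>)))"
    unfolding fourier_kernel_eq by (simp add: algebra_simps)
  also have "\<dots> = (LBINT x. complex_of_real (f x * cos (x \<bullet> \<xi>))) - (LBINT x. \<i> * complex_of_real (f x * sin (x \<bullet> \<xi>)))"
    by (intro Bochner_Integration.integral_diff integrable_mult_right integrable_of_real c s)
  also have "\<dots> = complex_of_real (LBINT x. f x * cos (x \<bullet> \<xi>)) - \<i> * complex_of_real (LBINT x. f x * sin (x \<bullet> \<xi>))"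
    by (simp only: integral_mult_right_zero integral_complex_of_real)
  finally show ?thesis unfolding fourier_def by simp
qed

text \<open>
  The sine part is the integral of an odd function.
\<close>

lemma fourier_truncated_power:
  fixes \<xi> :: "'a::euclidean_space"
  assumes "0 < a" "0 \<le> Q"
  shows "fourier (\<lambda>x. complex_of_real (truncated_power a Q x)) \<xi>
    = (2 * pi) powr (- real DIM('a) / 2) *\<^sub>R complex_of_real (cosine_transform (truncated_power a Q) \<xi>)"
proof -
  have "(LBINT x. truncated_power a Q x * sin (x \<bullet> \<xi>)) = 0"
    by (rule integral_lborel_odd) (auto simp: truncated_power_def)
  then show ?thesis
    unfolding fourier_of_real[OF integrable_truncated_power[OF assms]] cosine_transform_def by simp
qed

lemma finite_sphere_line:
  fixes y b :: "'a::euclidean_space"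
  assumes "b \<in> Basis"
  shows "finite {t. (norm (y + t *\<^sub>R b))\<^sup>2 = Q}"
proof -
  define c where "c = Q - (norm y)\<^sup>2 + (y \<bullet> b)\<^sup>2"
  have "(norm (y + t *\<^sub>R b))\<^sup>2 = Q \<longleftrightarrow> (t + y \<bullet> b)\<^sup>2 = c" for t
    using assms unfolding power2_norm_eq_inner c_def
    by (auto simp: inner_simps inner_commute power2_eq_square algebra_simps)
  moreover have "{t. (t + y \<bullet> b)\<^sup>2 = c} \<subseteq> {sqrt c - y \<bullet> b, - sqrt c - y \<bullet> b}"
  proof
    fix t assume "t \<in> {t. (t + y \<bullet> b)\<^sup>2 = c}"
    then have "sqrt c = \<bar>t + y \<bullet> b\<bar>" using real_sqrt_abs[of "t + y \<bullet> b"] by simp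
    then have "t = sqrt c - y \<bullet> b \<or> t = - sqrt c - y \<bullet> b" by linarith
    then show "t \<in> {sqrt c - y \<bullet> b, - sqrt c - y \<bullet> b}" by simp
  qed
  ultimately show ?thesis
    using finite_subset[of "{t. (t + y \<bullet> b)\<^sup>2 = c}" "{sqrt c - y \<bullet> b, - sqrt c - y \<bullet> b}"] by simp
qed

definition ball_moment :: "'a::euclidean_space \<Rightarrow> real \<Rightarrow> 'a \<Rightarrow> real" where
  "ball_moment b Q y = (y \<bullet> b) * indicator {y. (norm y)\<^sup>2 < Q} y"

lemma measurable_ball_moment [measurable]: "ball_moment b Q \<in> borel_measurable borel"
  unfolding ball_moment_def by measurable

lemma integrable_ball_moment:
  assumes b: "b \<in> Basis" and Q: "0 \<le> Q"
  shows "integrable lborel (ball_moment (b::'a::euclidean_space) Q)"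
proof (rule Bochner_Integration.integrable_bound[OF integrable_mult_right[OF integrable_indicator_cball[of "sqrt Q", where 'a='a], of "sqrt Q"]])
  have "\<bar>ball_moment b Q y\<bar> \<le> sqrt Q * indicator (cball 0 (sqrt Q)) y" for y
  proof (cases "(norm y)\<^sup>2 < Q")
    case True
    then have "norm y \<le> sqrt Q" by (intro real_le_rsqrt) simp
    moreover have "\<bar>y \<bullet> b\<bar> \<le> norm y" using Basis_le_norm[OF b] .
    ultimately show ?thesis using True by (simp add: ball_moment_def)
  next
    case False
    then show ?thesis using Q by (simp add: ball_moment_def)
  qed
  then show "AE y in lborel. norm (ball_moment b Q y) \<le> norm (sqrt Q * indicator (cball 0 (sqrt Q)) y)"
    using Q by (auto simp: abs_mult)
qed measurable

text \<open>
  Integration by parts: on the ball the derivative of \<open>Q - |y|\<^sup>2\<close> in the direction \<open>b\<close> is \<open>- 2 (y \<bullet> b)\<close>.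
  A line in the direction \<open>b\<close> meets the sphere, where the truncated power is not differentiable, at most twice.
\<close>

lemma sine_transform_ball_moment:
  fixes \<xi> :: "'a::euclidean_space"
  assumes b: "b \<in> Basis" and Q: "0 < Q"
  shows "(LBINT y. ball_moment b Q y * sin (y \<bullet> \<xi>)) = (\<xi> \<bullet> b) / 2 * cosine_transform (truncated_power 1 Q) \<xi>"
proof -
  let ?f = "truncated_power 1 Q :: 'a \<Rightarrow> real"
  let ?f' = "\<lambda>y. (\<xi> \<bullet> b) * (?f y * cos (y \<bullet> \<xi>)) - 2 * (ball_moment b Q y * sin (y \<bullet> \<xi>))"
  have f: "integrable lborel ?f" using Q by (intro integrable_truncated_power) auto
  have i1: "integrable lborel (\<lambda>y. ?f y * cos (y \<bullet> \<xi>))" by (rule integrable_cosine[OF f])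
  have sin: "integrable lborel (\<lambda>y. g y * sin (y \<bullet> \<xi>))" if "integrable lborel g" for g :: "'a \<Rightarrow> real"
    by (rule Bochner_Integration.integrable_bound[OF that]) (use that in \<open>auto simp: abs_mult intro!: mult_left_le\<close>)
  have i2: "integrable lborel (\<lambda>y. ball_moment b Q y * sin (y \<bullet> \<xi>))"
    using b Q by (intro sin integrable_ball_moment) auto
  have "(LBINT y. ?f' y) = 0"
  proof (rule integral_directional_derivative_eq_0[where f="\<lambda>y. ?f y * sin (y \<bullet> \<xi>)" and b=b and S="\<lambda>y. {t. (norm (y + t *\<^sub>R b))\<^sup>2 = Q}"])
    show "integrable lborel (\<lambda>y. ?f y * sin (y \<bullet> \<xi>))" by (rule sin[OF f])
    show "integrable lborel ?f'"
      by (intro Bochner_Integration.integrable_diff integrable_mult_right i1 i2)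
    show "continuous_on {0..1} (\<lambda>t. ?f (x + t *\<^sub>R b) * sin ((x + t *\<^sub>R b) \<bullet> \<xi>))" for x
      unfolding truncated_power_def by (intro continuous_intros continuous_on_powr') auto
    show "finite {t. (norm (x + t *\<^sub>R b))\<^sup>2 = Q}" for x
      by (rule finite_sphere_line[OF b])
    fix x t assume t: "t \<in> {0<..<1} - {t. (norm (x + t *\<^sub>R b))\<^sup>2 = Q}"
    let ?q = "\<lambda>t. (norm (x + t *\<^sub>R b))\<^sup>2"
    have q: "(?q has_real_derivative 2 * ((x + t *\<^sub>R b) \<bullet> b)) (at t)" for t
      unfolding power2_norm_eq_inner
      by (auto intro!: derivative_eq_intros simp: inner_simps inner_commute)
    have qc: "isCont ?q t" by (rule DERIV_isCont[OF q])
    have sin': "((\<lambda>t. sin ((x + t *\<^sub>R b) \<bullet> \<xi>)) has_real_derivative cos ((x + t *\<^sub>R b) \<bullet> \<xi>) * (b \<bullet> \<xi>)) (at t)"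
      by (auto intro!: derivative_eq_intros simp: inner_simps)
    have f': "((\<lambda>t. ?f (x + t *\<^sub>R b)) has_real_derivative - 2 * ball_moment b Q (x + t *\<^sub>R b)) (at t)"
    proof (cases "?q t < Q")
      case True
      have "eventually (\<lambda>s. ?q s < Q) (at t)"
        using qc True unfolding isCont_def by (rule order_tendstoD)
      then have "eventually (\<lambda>s. ?q s < Q) (nhds t)"
        using True by (simp add: eventually_nhds_conv_at)
      then have "eventually (\<lambda>s. ?f (x + s *\<^sub>R b) = Q - ?q s) (nhds t)"
        by eventually_elim (simp add: truncated_power_def)
      moreover have "((\<lambda>s. Q - ?q s) has_real_derivative - 2 * ball_moment b Q (x + t *\<^sub>R b)) (at t)"
        using DERIV_diff[OF DERIV_const q] True by (simp add: ball_moment_def)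
      ultimately show ?thesis
        by (subst DERIV_cong_ev[OF refl _ refl])
    next
      case False
      then have "Q < ?q t" using t by simp
      then have "eventually (\<lambda>s. Q < ?q s) (at t)"
        using qc unfolding isCont_def by (intro order_tendstoD)
      then have "eventually (\<lambda>s. Q < ?q s) (nhds t)"
        using \<open>Q < ?q t\<close> by (simp add: eventually_nhds_conv_at)
      then have "eventually (\<lambda>s. ?f (x + s *\<^sub>R b) = 0) (nhds t)"
        by eventually_elim (simp add: truncated_power_def)
      moreover have "((\<lambda>s. 0) has_real_derivative - 2 * ball_moment b Q (x + t *\<^sub>R b)) (at t)"
        using False by (simp add: ball_moment_def)
      ultimately show ?thesis
        by (subst DERIV_cong_ev[OF refl _ refl])
    qed
    show "((\<lambda>t. ?f (x + t *\<^sub>R b) * sin ((x + t *\<^sub>R b) \<bullet> \<xi>)) has_vector_derivative ?f' (x + t *\<^sub>R b)) (at t)"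
      unfolding has_real_derivative_iff_has_vector_derivative[symmetric]
      by (rule DERIV_cong[OF DERIV_mult[OF f' sin']]) (simp add: inner_commute)
  qed
  moreover have "(LBINT y. ?f' y) = (\<xi> \<bullet> b) * cosine_transform ?f \<xi> - 2 * (LBINT y. ball_moment b Q y * sin (y \<bullet> \<xi>))"
    using i1 i2 by (simp add: cosine_transform_def)
  ultimately show ?thesis by simp
qed

lemma fourier_ball_moment:
  fixes \<xi> :: "'a::euclidean_space"
  assumes b: "b \<in> Basis" and Q: "0 < Q"
  shows "fourier (\<lambda>y. complex_of_real (ball_moment b Q y)) \<xi>
    = - (\<i> / 2) * complex_of_real (\<xi> \<bullet> b) * fourier (\<lambda>y. complex_of_real (truncated_power 1 Q y)) \<xi>"
proof -
  have "(LBINT y. ball_moment b Q y * cos (y \<bullet> \<xi>)) = 0"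
    by (rule integral_lborel_odd) (auto simp: ball_moment_def indicator_def)
  moreover have "integrable lborel (ball_moment b Q)"
    using b Q by (intro integrable_ball_moment) auto
  ultimately show ?thesis
    using Q fourier_truncated_power[of 1 Q \<xi>]
    by (simp add: fourier_of_real sine_transform_ball_moment[OF b Q] scaleR_conv_of_real)
qed

section \<open>The fractional gradient of a truncated power\<close>

definition tail_mass :: "real \<Rightarrow> real \<Rightarrow> real \<Rightarrow> real" where
  "tail_mass a D z = measure (tail_measure a D) {z<..}"

text \<open>
  The representative of the fractional gradient of \<open>truncated_power a \<rho>\<close>: the superposition of balls for
  \<open>a < 1\<close>, the classical gradient for \<open>a = 1\<close>.  The former is continuous across the sphere, the latter is not.
\<close>

definition truncated_gradient :: "real \<Rightarrow> real \<Rightarrow> 'a::euclidean_space \<Rightarrow> 'a" where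
  "truncated_gradient a \<rho> y =
     (if a < 1 then - (2 * riesz_const a * tail_mass a (real DIM('a) / 2) ((norm y)\<^sup>2 / \<rho>)) *\<^sub>R y
      else - (2 * indicator {y. (norm y)\<^sup>2 < \<rho>} y) *\<^sub>R y)"

lemma continuous_tail_mass:
  assumes "a < 1" "0 < D" "0 < D + a"
  shows "isCont (tail_mass a D) z"
  unfolding continuous_at_sequentially comp_def
proof (intro allI impI)
  fix X assume X: "X \<longlonglongrightarrow> z"
  interpret \<mu>: finite_measure "tail_measure a D"
    using assms by (rule finite_measure_tail_measure)
  have eq: "tail_mass a D z = (\<integral>Q. indicator {z<..} Q \<partial>tail_measure a D)" for z
    by (simp add: tail_mass_def)
  show "(\<lambda>n. tail_mass a D (X n)) \<longlonglongrightarrow> tail_mass a D z"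
    unfolding eq
  proof (rule integral_dominated_convergence[where w="\<lambda>_. 1"])
    have "AE Q in tail_measure a D. Q \<noteq> z"
      unfolding tail_measure_def by (subst AE_density) (use AE_lborel_singleton[of z] in auto)
    then show "AE Q in tail_measure a D. (\<lambda>n. indicator {X n<..} Q :: real) \<longlonglongrightarrow> indicator {z<..} Q"
    proof eventually_elim
      case (elim Q)
      have "eventually (\<lambda>n. indicator {X n<..} Q = (indicator {z<..} Q :: real)) sequentially"
      proof (cases "z < Q")
        case True
        from order_tendstoD(2)[OF X True] show ?thesis
          by eventually_elim (use True in simp)
      next
        case False
        with elim have "Q < z" by simp
        from order_tendstoD(1)[OF X this] show ?thesis
          by eventually_elim (use False in simp)
      qed
      then show ?case by (rule tendsto_eventually)
    qed
  qed auto
qed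

lemma tail_mass_nonneg: "0 \<le> tail_mass a D z"
  by (simp add: tail_mass_def)

text \<open>
  \<open>\<mu>\<close> lives on \<open>Q > 1\<close>.  This is why the fractional gradient is linear inside the ball.
\<close>

lemma tail_mass_le_one:
  assumes "a < 1" "0 < D" "0 < D + a" "z \<le> 1"
  shows "tail_mass a D z = Gamma (1 - a) * Gamma (D + a) / Gamma (D + 1)"
proof -
  interpret \<mu>: finite_measure "tail_measure a D"
    using assms by (intro finite_measure_tail_measure) auto
  have "measure (tail_measure a D) {z<..} = measure (tail_measure a D) UNIV"
  proof (rule \<mu>.finite_measure_eq_AE)
    show "AE Q in tail_measure a D. Q \<in> {z<..} \<longleftrightarrow> Q \<in> UNIV"
      using AE_tail_measure by eventually_elim (use assms in auto)
  qed auto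
  moreover have "0 \<le> Gamma (1 - a) * Gamma (D + a) / Gamma (D + 1)"
    using assms by (intro divide_nonneg_nonneg mult_nonneg_nonneg less_imp_le[OF Gamma_real_pos]) auto
  ultimately show ?thesis
    using emeasure_tail_measure[OF assms(1-3)] by (simp add: tail_mass_def measure_def)
qed

lemma tail_mass_bounded:
  assumes "a < 1" "0 < D" "0 < D + a"
  shows "tail_mass a D z \<le> Gamma (1 - a) * Gamma (D + a) / Gamma (D + 1)"
proof -
  interpret \<mu>: finite_measure "tail_measure a D"
    using assms by (intro finite_measure_tail_measure) auto
  have "tail_mass a D z \<le> tail_mass a D (min z 1)"
    unfolding tail_mass_def by (intro \<mu>.finite_measure_mono) auto
  then show ?thesis using tail_mass_le_one[OF assms, of "min z 1"] by simp
qed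

lemma fourier_cmult: "fourier (\<lambda>x. c * f x) \<xi> = c * fourier f \<xi>"
proof -
  have "(LBINT x. c * f x * exp (- \<i> * complex_of_real (x \<bullet> \<xi>))) = c * (LBINT x. f x * exp (- \<i> * complex_of_real (x \<bullet> \<xi>)))"
    unfolding mult.assoc by (rule integral_mult_right_zero)
  then show ?thesis by (simp add: fourier_def)
qed

lemma truncated_gradient_inner:
  fixes y b :: "'a::euclidean_space"
  assumes a: "0 < a" "a < 1" and \<rho>: "0 < \<rho>"
  shows "truncated_gradient a \<rho> y \<bullet> b
    = - 2 * riesz_const a * (\<integral>Q. ball_moment b (\<rho> * Q) y \<partial>tail_measure a (real DIM('a) / 2))"
proof -
  interpret \<mu>: finite_measure "tail_measure a (real DIM('a) / 2)"
    using a by (intro finite_measure_tail_measure) auto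
  have "ball_moment b (\<rho> * Q) y = (y \<bullet> b) * indicator {(norm y)\<^sup>2 / \<rho><..} Q" for Q
    using \<rho> by (simp add: ball_moment_def indicator_def pos_divide_less_eq mult.commute)
  then have "(\<integral>Q. ball_moment b (\<rho> * Q) y \<partial>tail_measure a (real DIM('a) / 2)) = (y \<bullet> b) * tail_mass a (real DIM('a) / 2) ((norm y)\<^sup>2 / \<rho>)"
    by (simp add: tail_mass_def)
  then show ?thesis using a by (simp add: truncated_gradient_def)
qed

text \<open>
  Both sides of the defining identity are superpositions over the balls \<open>|y|\<^sup>2 < \<rho> Q\<close>.  For one ball the
  identity is \<open>fourier_ball_moment\<close>; the superposition of the right-hand sides is evaluated by
  \<open>riesz_potential_truncated_power\<close>.
\<close>

lemma has_fourier_truncated_gradient: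
  fixes b :: "'a::euclidean_space"
  assumes a: "0 < a" "a < 1" and \<rho>: "0 < \<rho>" and b: "b \<in> Basis"
  shows "has_fourier (\<lambda>y. complex_of_real (truncated_gradient a \<rho> y \<bullet> b))
    (\<lambda>\<xi>. \<i> * complex_of_real ((\<xi> \<bullet> b) * norm \<xi> powr (2 * a - 2)) * fourier (\<lambda>y. complex_of_real (truncated_power a \<rho> y)) \<xi>)"
  unfolding has_fourier_def
proof (intro allI impI)
  fix \<psi> :: "'a \<Rightarrow> complex" assume \<psi>: "schwartz \<psi>"
  let ?\<mu> = "tail_measure a (real DIM('a) / 2)"
  interpret \<mu>: finite_measure ?\<mu>
    using a by (intro finite_measure_tail_measure) auto
  interpret P: pair_sigma_finite "lborel :: 'a measure" ?\<mu> ..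
  have i\<psi>: "integrable lborel \<psi>" and [measurable]: "\<psi> \<in> borel_measurable borel"
    using \<psi> by (auto intro: integrable_schwartz measurable_schwartz)
  let ?G = "fourier \<psi>"
  let ?c = "(2 * pi) powr (- real DIM('a) / 2)"
  let ?N = "\<lambda>\<xi>::'a. \<lambda>Q. cosine_transform (truncated_power 1 (\<rho> * Q)) \<xi>"
  let ?V = "fourier (\<lambda>y::'a. complex_of_real (truncated_power a \<rho> y))"
  define f where "f \<xi> = complex_of_real (\<xi> \<bullet> b) * \<psi> \<xi>" for \<xi>
  define F1 where "F1 y Q = complex_of_real (ball_moment b (\<rho> * Q) y) * ?G y" for y Q
  define F2 where "F2 \<xi> Q = ?N \<xi> Q *\<^sub>R f \<xi>" for \<xi> Q
  have F1: "integrable (lborel \<Otimes>\<^sub>M ?\<mu>) (case_prod F1)"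
  proof (rule P.integrable_dominated_by_product[where h="\<lambda>_. 1"])
    show "integrable lborel (\<lambda>y. norm y powr 1 * norm (?G y))"
      using \<psi> by (intro integrable_norm_powr_rapidly_decreasing fourier_rapidly_decreasing) auto
    show "norm (F1 y Q) \<le> norm y powr 1 * norm (?G y) * 1" for y Q
    proof -
      have "\<bar>ball_moment b (\<rho> * Q) y\<bar> \<le> norm y"
        using Basis_le_norm[OF b, of y] by (simp add: ball_moment_def indicator_def)
      then show ?thesis by (simp add: F1_def norm_mult mult_right_mono)
    qed
    show "case_prod F1 \<in> borel_measurable (lborel \<Otimes>\<^sub>M ?\<mu>)"
      unfolding F1_def ball_moment_def indicator_def mem_Collect_eq by measurable
  qed simp
  have F2: "integrable (lborel \<Otimes>\<^sub>M ?\<mu>) (case_prod F2)"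
    unfolding F2_def
  proof (rule integrable_times_tail_cosine_transform[where \<theta>="1 - a / 2"])
    show "integrable lborel (\<lambda>\<xi>. norm \<xi> powr (- 2 * (1 - a / 2)) * norm (f \<xi>))"
    proof (rule Bochner_Integration.integrable_bound)
      show "integrable lborel (\<lambda>\<xi>. norm \<xi> powr (a - 1) * norm (\<psi> \<xi>))"
      proof (rule integrable_norm_powr_rapidly_decreasing)
        have "1 \<le> real DIM('a)" using DIM_positive[where 'a='a] by linarith
        then show "- real DIM('a) < a - 1" using a by linarith
      qed (auto intro: schwartz_rapidly_decreasing \<psi>)
      show "AE \<xi> in lborel. norm (norm \<xi> powr (- 2 * (1 - a / 2)) * norm (f \<xi>)) \<le> norm (norm \<xi> powr (a - 1) * norm (\<psi> \<xi>))"
      proof (rule AE_I2)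
        fix \<xi> :: 'a
        have "norm \<xi> powr (- 2 * (1 - a / 2)) * \<bar>\<xi> \<bullet> b\<bar> \<le> norm \<xi> powr (- 2 * (1 - a / 2)) * norm \<xi>"
          by (intro mult_left_mono Basis_le_norm b) auto
        also have "\<dots> = norm \<xi> powr (a - 1)"
        proof (cases "\<xi> = 0")
          case False
          then have "norm \<xi> powr (- 2 * (1 - a / 2)) * norm \<xi> powr 1 = norm \<xi> powr (a - 1)"
            unfolding powr_add[symmetric] by (intro arg_cong[where f="(powr) (norm \<xi>)"]) simp
          then show ?thesis using False by simp
        qed simp
        finally have "norm \<xi> powr (- 2 * (1 - a / 2)) * \<bar>\<xi> \<bullet> b\<bar> * norm (\<psi> \<xi>) \<le> norm \<xi> powr (a - 1) * norm (\<psi> \<xi>)"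
          by (intro mult_right_mono) auto
        then show "norm (norm \<xi> powr (- 2 * (1 - a / 2)) * norm (f \<xi>)) \<le> norm (norm \<xi> powr (a - 1) * norm (\<psi> \<xi>))"
          by (simp add: f_def norm_mult mult.assoc)
      qed
      show "(\<lambda>\<xi>. norm \<xi> powr (- 2 * (1 - a / 2)) * norm (f \<xi>)) \<in> borel_measurable lborel"
        unfolding f_def by measurable
    qed
    show "f \<in> borel_measurable borel" unfolding f_def by measurable
  qed (use a \<rho> in \<open>auto simp: f_def\<close>)
  have left: "complex_of_real (truncated_gradient a \<rho> y \<bullet> b) * ?G y = complex_of_real (- 2 * riesz_const a) * (\<integral>Q. F1 y Q \<partial>?\<mu>)" for y
    unfolding truncated_gradient_inner[OF a \<rho>] F1_def integral_mult_left_zero integral_complex_of_real by simp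
  have right: "\<i> * complex_of_real ((\<xi> \<bullet> b) * norm \<xi> powr (2 * a - 2)) * ?V \<xi> * \<psi> \<xi>
      = \<i> * complex_of_real (riesz_const a * ?c) * (\<integral>Q. F2 \<xi> Q \<partial>?\<mu>)" for \<xi>
  proof (cases "\<xi> = 0")
    case False
    have "(\<integral>Q. F2 \<xi> Q \<partial>?\<mu>) = tail_potential a \<rho> \<xi> *\<^sub>R f \<xi>"
      unfolding F2_def tail_potential_def
      by (intro integral_scaleR_left integrable_tail_cosine_transform a \<rho> False)
    moreover have "?V \<xi> = ?c *\<^sub>R complex_of_real (cosine_transform (truncated_power a \<rho>) \<xi>)"
      using a \<rho> by (intro fourier_truncated_power) auto
    moreover have "complex_of_real (norm \<xi> powr (2 * a - 2)) * complex_of_real (cosine_transform (truncated_power a \<rho>) \<xi>)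
        = complex_of_real (riesz_const a) * complex_of_real (tail_potential a \<rho> \<xi>)"
      unfolding of_real_mult[symmetric] riesz_potential_truncated_power[OF a \<rho> False] ..
    moreover have "\<i> * (x * p) * (c * t) * q = \<i> * (r * c) * (T * (x * q))" if "p * t = r * T" for x p c t q r T :: complex
    proof -
      have "\<i> * (x * p) * (c * t) * q = \<i> * x * c * q * (p * t)" by (simp only: mult_ac)
      also have "\<dots> = \<i> * (r * c) * (T * (x * q))" unfolding that by (simp only: mult_ac)
      finally show ?thesis .
    qed
    ultimately show ?thesis by (simp add: f_def scaleR_conv_of_real)
  qed (simp add: F2_def f_def)
  show "integrable lborel (\<lambda>y. complex_of_real (truncated_gradient a \<rho> y \<bullet> b) * ?G y) \<and>
     integrable lborel (\<lambda>\<xi>. \<i> * complex_of_real ((\<xi> \<bullet> b) * norm \<xi> powr (2 * a - 2)) * ?V \<xi> * \<psi> \<xi>) \<and>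
     (LBINT \<xi>. \<i> * complex_of_real ((\<xi> \<bullet> b) * norm \<xi> powr (2 * a - 2)) * ?V \<xi> * \<psi> \<xi>)
       = (LBINT y. complex_of_real (truncated_gradient a \<rho> y \<bullet> b) * ?G y)"
    unfolding left right
  proof (intro conjI)
    show "integrable lborel (\<lambda>y. complex_of_real (- 2 * riesz_const a) * (\<integral>Q. F1 y Q \<partial>?\<mu>))"
      by (intro integrable_mult_right P.integrable_fst F1)
    show "integrable lborel (\<lambda>\<xi>. \<i> * complex_of_real (riesz_const a * ?c) * (\<integral>Q. F2 \<xi> Q \<partial>?\<mu>))"
      by (intro integrable_mult_right P.integrable_fst F2)
    have slice: "(LBINT y. F1 y Q) = - (\<i> / 2) * complex_of_real ?c * (LBINT \<xi>. F2 \<xi> Q)" if Q: "1 < Q" for Q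
    proof -
      have \<rho>Q: "0 < \<rho> * Q" using \<rho> Q by simp
      have "integrable lborel (\<lambda>y. complex_of_real (ball_moment b (\<rho> * Q) y))"
        using \<rho>Q b by (intro integrable_of_real integrable_ball_moment) auto
      from has_fourier_integrable[OF this] \<psi>
      have "(LBINT y. F1 y Q) = (LBINT \<xi>. fourier (\<lambda>y. complex_of_real (ball_moment b (\<rho> * Q) y)) \<xi> * \<psi> \<xi>)"
        unfolding has_fourier_def F1_def by simp
      also have "\<dots> = (LBINT \<xi>. - (\<i> / 2) * complex_of_real ?c * F2 \<xi> Q)"
        unfolding fourier_ball_moment[OF b \<rho>Q] using fourier_truncated_power[where 'a='a, OF zero_less_one less_imp_le[OF \<rho>Q]]
        by (simp add: F2_def f_def scaleR_conv_of_real mult_ac)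
      finally show ?thesis by (simp only: integral_mult_right_zero)
    qed
    have "(\<integral>Q. (LBINT y. F1 y Q) \<partial>?\<mu>) = (\<integral>Q. - (\<i> / 2) * complex_of_real ?c * (LBINT \<xi>. F2 \<xi> Q) \<partial>?\<mu>)"
    proof (rule integral_cong_AE)
      show "AE Q in ?\<mu>. (LBINT y. F1 y Q) = - (\<i> / 2) * complex_of_real ?c * (LBINT \<xi>. F2 \<xi> Q)"
        using AE_tail_measure by eventually_elim (rule slice)
    qed (intro borel_measurable_times borel_measurable_const borel_measurable_integrable P.integrable_snd F1 F2)+
    then have "(LBINT y. \<integral>Q. F1 y Q \<partial>?\<mu>) = - (\<i> / 2) * complex_of_real ?c * (LBINT \<xi>. \<integral>Q. F2 \<xi> Q \<partial>?\<mu>)"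
      unfolding P.Fubini_integral[OF F1] integral_mult_right_zero P.Fubini_integral[OF F2] .
    then show "(LBINT \<xi>. \<i> * complex_of_real (riesz_const a * ?c) * (\<integral>Q. F2 \<xi> Q \<partial>?\<mu>))
      = (LBINT y. complex_of_real (- 2 * riesz_const a) * (\<integral>Q. F1 y Q \<partial>?\<mu>))"
      unfolding integral_mult_right_zero by simp
  qed
qed

theorem is_frac_grad_truncated_power:
  assumes a: "0 < a" "a \<le> 1" and \<rho>: "0 < \<rho>"
  shows "is_frac_grad (2 * a) (truncated_power a \<rho>) (truncated_gradient a \<rho> :: 'a::euclidean_space \<Rightarrow> 'a)"
  unfolding is_frac_grad_def
proof (intro exI conjI ballI)
  show "has_fourier (\<lambda>x::'a. complex_of_real (truncated_power a \<rho> x)) (fourier (\<lambda>x. complex_of_real (truncated_power a \<rho> x)))"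
    using a \<rho> by (intro has_fourier_integrable integrable_of_real integrable_truncated_power) auto
  fix b :: 'a assume b: "b \<in> Basis"
  show "has_fourier (\<lambda>x. complex_of_real (truncated_gradient a \<rho> x \<bullet> b))
    (\<lambda>\<xi>. \<i> * complex_of_real ((\<xi> \<bullet> b) * norm \<xi> powr (2 * a - 2)) * fourier (\<lambda>x. complex_of_real (truncated_power a \<rho> x)) \<xi>)"
  proof (cases "a < 1")
    case True
    then show ?thesis using a \<rho> b by (intro has_fourier_truncated_gradient)
  next
    case False
    then have a1: "a = 1" using a by simp
    have g: "complex_of_real (truncated_gradient a \<rho> x \<bullet> b) = - 2 * complex_of_real (ball_moment b \<rho> x)" for x
      by (simp add: truncated_gradient_def a1 ball_moment_def)
    have int: "integrable lborel (\<lambda>x. - 2 * complex_of_real (ball_moment b \<rho> x))"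
      using b \<rho> by (intro integrable_mult_right integrable_of_real integrable_ball_moment) auto
    have "fourier (\<lambda>x. - 2 * complex_of_real (ball_moment b \<rho> x)) \<xi>
        = \<i> * complex_of_real ((\<xi> \<bullet> b) * norm \<xi> powr (2 * a - 2)) * fourier (\<lambda>x. complex_of_real (truncated_power a \<rho> x)) \<xi>" for \<xi>
      unfolding fourier_cmult fourier_ball_moment[OF b \<rho>] a1 by (cases "\<xi> = 0") simp_all
    then have "fourier (\<lambda>x. - 2 * complex_of_real (ball_moment b \<rho> x))
        = (\<lambda>\<xi>. \<i> * complex_of_real ((\<xi> \<bullet> b) * norm \<xi> powr (2 * a - 2)) * fourier (\<lambda>x. complex_of_real (truncated_power a \<rho> x)) \<xi>)"
      by (rule ext)
    with has_fourier_integrable[OF int] show ?thesis unfolding g by simp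
  qed
qed

lemma has_fourier_cmult:
  assumes "has_fourier v V"
  shows "has_fourier (\<lambda>x. c * v x) (\<lambda>\<xi>. c * V \<xi>)"
  using assms unfolding has_fourier_def mult.assoc by auto

lemma is_frac_grad_cmult:
  assumes "is_frac_grad \<alpha> v w"
  shows "is_frac_grad \<alpha> (\<lambda>x. c * v x) (\<lambda>x. c *\<^sub>R w x)"
proof -
  obtain V where V: "has_fourier (\<lambda>x. complex_of_real (v x)) V"
    "\<And>b. b \<in> Basis \<Longrightarrow> has_fourier (\<lambda>x. complex_of_real (w x \<bullet> b)) (\<lambda>\<xi>. \<i> * complex_of_real ((\<xi> \<bullet> b) * norm \<xi> powr (\<alpha> - 2)) * V \<xi>)"
    using assms unfolding is_frac_grad_def by blast
  show ?thesis
    unfolding is_frac_grad_def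
  proof (intro exI conjI ballI)
    show "has_fourier (\<lambda>x. complex_of_real (c * v x)) (\<lambda>\<xi>. complex_of_real c * V \<xi>)"
      using has_fourier_cmult[OF V(1), of "complex_of_real c"] by simp
    fix b :: 'a assume "b \<in> Basis"
    from has_fourier_cmult[OF V(2)[OF this], of "complex_of_real c"]
    show "has_fourier (\<lambda>x. complex_of_real (c *\<^sub>R w x \<bullet> b))
      (\<lambda>\<xi>. \<i> * complex_of_real ((\<xi> \<bullet> b) * norm \<xi> powr (\<alpha> - 2)) * (complex_of_real c * V \<xi>))"
      by (simp add: mult_ac)
  qed
qed

section \<open>The self-similar solution\<close>

lemma sim_exponent_pos:
  assumes "0 < \<alpha>" "1 < m" "0 < d"
  shows "0 < real d * (m - 1) + \<alpha>"
  using assms by (intro add_pos_pos mult_pos_pos) auto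

lemma k_const_pos:
  assumes "0 < \<alpha>" "1 < m" "0 < d"
  shows "0 < k_const d \<alpha> m"
  unfolding k_const_def using assms sim_exponent_pos[OF assms]
  by (intro divide_pos_pos mult_pos_pos Gamma_real_pos) (auto intro: add_pos_pos)

text \<open>
  The powers of \<open>t\<close> combine to \<open>1 / t\<close> because \<open>l (d (m - 1) + \<alpha>) = 1\<close>.
\<close>

lemma barenblatt_eq:
  fixes x :: "'a::euclidean_space"
  assumes \<alpha>: "0 < \<alpha>" and m: "1 < m" and t: "0 < t"
  defines "l \<equiv> sim_exponent DIM('a) \<alpha> m"
  shows "barenblatt \<alpha> m (t, x) =
    (k_const DIM('a) \<alpha> m / t * truncated_power (\<alpha> / 2) (t powr (2 * l)) x) powr (1 / (m - 1))"
proof -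
  let ?d = "DIM('a)" and ?k = "k_const DIM('a) \<alpha> m" and ?n = "1 / (m - 1)"
  have N: "0 < real ?d * (m - 1) + \<alpha>" using \<alpha> m by (intro sim_exponent_pos) auto
  have k: "0 < ?k" using \<alpha> m by (intro k_const_pos) auto
  define \<rho> where "\<rho> = t powr (2 * l)"
  have \<rho>: "0 < \<rho>" using t by (simp add: \<rho>_def)
  have nsq: "(norm (x /\<^sub>R t powr l))\<^sup>2 = (norm x)\<^sup>2 / \<rho>"
  proof -
    have "\<rho> = t powr l * t powr l" unfolding \<rho>_def powr_add[symmetric] by simp
    then show ?thesis using t by (simp add: power2_eq_square divide_inverse mult_ac)
  qed
  have "max 0 (1 - (norm x)\<^sup>2 / \<rho>) = max 0 (\<rho> - (norm x)\<^sup>2) / \<rho>"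
    using \<rho> by (simp add: max_def divide_simps)
  then have pow: "max 0 (1 - (norm x)\<^sup>2 / \<rho>) powr (\<alpha> / 2) = truncated_power (\<alpha> / 2) \<rho> x / \<rho> powr (\<alpha> / 2)"
    using \<rho> by (simp add: truncated_power_def powr_divide)
  have "t powr (- (real ?d * l)) = (\<rho> powr (\<alpha> / 2) / t) powr ?n"
  proof -
    have "\<rho> powr (\<alpha> / 2) / t = t powr (l * \<alpha> - 1)"
      using t by (simp add: \<rho>_def powr_powr powr_diff)
    moreover have "(l * \<alpha> - 1) * ?n = - (real ?d * l)"
    proof -
      have "l * (real ?d * (m - 1) + \<alpha>) = 1" using N by (simp add: l_def sim_exponent_def)
      then have "l * \<alpha> - 1 = - (real ?d * l) * (m - 1)" by (simp add: algebra_simps)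
      then show ?thesis using m by simp
    qed
    ultimately show ?thesis by (simp add: powr_powr)
  qed
  moreover have "1 / t powr (real ?d * l) = t powr (- (real ?d * l))"
    by (simp add: powr_minus_divide)
  moreover have "barenblatt \<alpha> m (t, x) = 1 / t powr (real ?d * l)
      * (?k * max 0 (1 - (norm (x /\<^sub>R t powr l))\<^sup>2) powr (\<alpha> / 2)) powr ?n"
    by (simp only: barenblatt_def profile_def l_def prod.case)
  ultimately have "barenblatt \<alpha> m (t, x) = (\<rho> powr (\<alpha> / 2) / t) powr ?n * (?k * (truncated_power (\<alpha> / 2) \<rho> x / \<rho> powr (\<alpha> / 2))) powr ?n"
    unfolding nsq pow by (simp only:)
  also have "\<dots> = ((\<rho> powr (\<alpha> / 2) / t) * (?k * (truncated_power (\<alpha> / 2) \<rho> x / \<rho> powr (\<alpha> / 2)))) powr ?n"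
    using t \<rho> k truncated_power_nonneg[of "\<alpha> / 2" \<rho> x] by (intro powr_mult[symmetric])
  also have "(\<rho> powr (\<alpha> / 2) / t) * (?k * (truncated_power (\<alpha> / 2) \<rho> x / \<rho> powr (\<alpha> / 2))) = ?k / t * truncated_power (\<alpha> / 2) \<rho> x"
    using \<rho> by simp
  finally show ?thesis by (simp add: \<rho>_def)
qed

lemma barenblatt_nonneg: "0 \<le> barenblatt \<alpha> m p"
  by (cases p) (simp add: barenblatt_def profile_def)

lemma pressure_barenblatt:
  fixes x :: "'a::euclidean_space"
  assumes \<alpha>: "0 < \<alpha>" and m: "1 < m" and t: "0 < t"
  shows "pressure m (barenblatt \<alpha> m) t x =
    k_const DIM('a) \<alpha> m / t * truncated_power (\<alpha> / 2) (t powr (2 * sim_exponent DIM('a) \<alpha> m)) x"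
proof -
  define X where "X = k_const DIM('a) \<alpha> m / t * truncated_power (\<alpha> / 2) (t powr (2 * sim_exponent DIM('a) \<alpha> m)) x"
  have X: "0 \<le> X"
    unfolding X_def using k_const_pos[of \<alpha> m "DIM('a)"] \<alpha> m t truncated_power_nonneg[of "\<alpha> / 2" _ x]
    by (intro mult_nonneg_nonneg divide_nonneg_nonneg) auto
  have u: "barenblatt \<alpha> m (t, x) = X powr (1 / (m - 1))"
    unfolding X_def by (rule barenblatt_eq[OF \<alpha> m t])
  have "pressure m (barenblatt \<alpha> m) t x = X"
  proof (cases "X = 0")
    case True
    then show ?thesis by (simp add: pressure_def u)
  next
    case False
    with X have "0 < X" by simp
    have "pressure m (barenblatt \<alpha> m) t x = X powr (1 / (m - 1) * (m - 2)) * X powr (1 / (m - 1))"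
      by (simp add: pressure_def u powr_powr)
    also have "\<dots> = X powr (1 / (m - 1) * (m - 2) + 1 / (m - 1))"
      by (rule powr_add[symmetric])
    also have "1 / (m - 1) * (m - 2) + 1 / (m - 1) = 1"
      using m by (simp add: field_simps)
    finally show ?thesis using \<open>0 < X\<close> by simp
  qed
  then show ?thesis by (simp add: X_def)
qed

text \<open>
  Fractional gradient of the pressure.
\<close>

definition barenblatt_gradient :: "real \<Rightarrow> real \<Rightarrow> real \<times> 'a::euclidean_space \<Rightarrow> 'a" where
  "barenblatt_gradient \<alpha> m = (\<lambda>(t, x). (k_const DIM('a) \<alpha> m / t) *\<^sub>R
     truncated_gradient (\<alpha> / 2) (t powr (2 * sim_exponent DIM('a) \<alpha> m)) x)"

lemma truncated_gradient_inside:
  fixes y :: "'a::euclidean_space"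
  assumes a: "0 < a" "a \<le> 1" and y: "(norm y)\<^sup>2 < \<rho>"
  defines "D \<equiv> real DIM('a) / 2"
  shows "truncated_gradient a \<rho> y = - (2 * Gamma (a + 1) * 4 powr (a - 1) * Gamma (D + a) / Gamma (D + 1)) *\<^sub>R y"
proof (cases "a < 1")
  case True
  have \<rho>: "0 < \<rho>" using y by (smt (verit) zero_le_power2)
  have "tail_mass a D ((norm y)\<^sup>2 / \<rho>) = Gamma (1 - a) * Gamma (D + a) / Gamma (D + 1)"
    using a True y \<rho> by (intro tail_mass_le_one) (auto simp: D_def)
  moreover have "Gamma (1 - a) \<noteq> 0"
  proof -
    have "0 < Gamma (1 - a)" using True by (intro Gamma_real_pos) simp
    then show ?thesis by linarith
  qed
  ultimately show ?thesis
    using True by (simp add: truncated_gradient_def D_def[symmetric] riesz_const_def)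
next
  case False
  then have "a = 1" using a by simp
  moreover have "Gamma (D + 1) \<noteq> 0"
  proof -
    have "0 < Gamma (D + 1)" by (intro Gamma_real_pos) (simp add: D_def add_nonneg_pos)
    then show ?thesis by linarith
  qed
  moreover have "Gamma (1 + 1 :: real) = 1" using Gamma_fact[of 1, where 'a=real] by simp
  ultimately show ?thesis
    using y by (simp add: truncated_gradient_def)
qed

text \<open>
  The constant \<open>k\<close> is chosen to make this product the similarity exponent.
\<close>

lemma flux_constant:
  assumes \<alpha>: "0 < \<alpha>" "\<alpha> \<le> 2" and m: "1 < m" and d: "0 < d"
  shows "k_const d \<alpha> m * (2 * Gamma (\<alpha> / 2 + 1) * 4 powr (\<alpha> / 2 - 1) * Gamma (real d / 2 + \<alpha> / 2) / Gamma (real d / 2 + 1))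
    = sim_exponent d \<alpha> m"
proof -
  have N: "0 < real d * (m - 1) + \<alpha>" using \<alpha>(1) m d by (rule sim_exponent_pos)
  have pos: "0 < Gamma (real d / 2)" "0 < Gamma (1 + \<alpha> / 2)" "0 < Gamma ((real d + \<alpha>) / 2)"
    using d \<alpha> by (auto intro!: Gamma_real_pos add_pos_pos)
  have g1: "Gamma (real d / 2 + 1) = real d / 2 * Gamma (real d / 2)"
    using d by (intro Gamma_plus1) (auto dest: nonpos_Ints_nonpos)
  have g2: "Gamma (\<alpha> / 2 + 1) = Gamma (1 + \<alpha> / 2)" "Gamma (real d / 2 + \<alpha> / 2) = Gamma ((real d + \<alpha>) / 2)"
    by (simp_all add: add.commute add_divide_distrib)
  have "4 powr (\<alpha> / 2 - 1) = 4 powr (\<alpha> / 2) / (4::real)"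
    by (simp add: powr_diff)
  moreover have "(4::real) powr (\<alpha> / 2) = 2 powr \<alpha>"
  proof -
    have "(4::real) = 2 powr 2" by simp
    then show ?thesis by (simp only: powr_powr) simp
  qed
  ultimately have p: "4 powr (\<alpha> / 2 - 1) = 2 powr \<alpha> / (4::real)" by simp
  have core: "(x * G / (N * P * A * B)) * (2 * A * (P / 4) * B / (x / 2 * G)) = 1 / N"
    if "0 < x" "0 < G" "0 < N" "0 < P" "0 < A" "0 < B" for x G N P A B :: real
    using that by (simp add: divide_simps)
  show ?thesis
    unfolding k_const_def sim_exponent_def g1 g2 p
    by (rule core[OF _ pos(1) N _ pos(2) pos(3)]) (use d in simp_all)
qed

lemma barenblatt_flux:
  fixes x :: "'a::euclidean_space"
  assumes \<alpha>: "0 < \<alpha>" "\<alpha> \<le> 2" and m: "1 < m" and t: "0 < t"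
  shows "\<bar>barenblatt \<alpha> m (t, x)\<bar> *\<^sub>R barenblatt_gradient \<alpha> m (t, x)
    = - (sim_exponent DIM('a) \<alpha> m / t * barenblatt \<alpha> m (t, x)) *\<^sub>R x"
proof (cases "(norm x)\<^sup>2 < t powr (2 * sim_exponent DIM('a) \<alpha> m)")
  case True
  have a: "0 < \<alpha> / 2" "\<alpha> / 2 \<le> 1" using \<alpha> by auto
  let ?K = "2 * Gamma (\<alpha> / 2 + 1) * 4 powr (\<alpha> / 2 - 1) * Gamma (real DIM('a) / 2 + \<alpha> / 2) / Gamma (real DIM('a) / 2 + 1)"
  have "barenblatt_gradient \<alpha> m (t, x) = - (k_const DIM('a) \<alpha> m * ?K / t) *\<^sub>R x"
    unfolding barenblatt_gradient_def by (simp add: truncated_gradient_inside[OF a True])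
  also have "k_const DIM('a) \<alpha> m * ?K = sim_exponent DIM('a) \<alpha> m"
    using \<alpha> m by (intro flux_constant) auto
  finally show ?thesis by (simp add: barenblatt_nonneg)
next
  case False
  then have "barenblatt \<alpha> m (t, x) = 0"
    using barenblatt_eq[OF \<alpha>(1) m t, of x] by (simp add: truncated_power_def)
  then show ?thesis by simp
qed

lemma barenblatt_factored:
  fixes x :: "'a::euclidean_space"
  assumes \<alpha>: "0 < \<alpha>" and m: "1 < m" and t: "0 < t"
  defines "l \<equiv> sim_exponent DIM('a) \<alpha> m" and "n \<equiv> 1 / (m - 1)"
  shows "barenblatt \<alpha> m (t, x) =
    k_const DIM('a) \<alpha> m powr n * t powr (- n) * max 0 (t powr (2 * l) - (norm x)\<^sup>2) powr (\<alpha> / 2 * n)"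
proof -
  have k: "0 < k_const DIM('a) \<alpha> m" using \<alpha> m by (intro k_const_pos) auto
  have "barenblatt \<alpha> m (t, x) = (k_const DIM('a) \<alpha> m / t) powr n * truncated_power (\<alpha> / 2) (t powr (2 * l)) x powr n"
    unfolding barenblatt_eq[OF \<alpha> m t] l_def n_def
    using k t truncated_power_nonneg[of "\<alpha> / 2" _ x] by (intro powr_mult)
  also have "(k_const DIM('a) \<alpha> m / t) powr n = k_const DIM('a) \<alpha> m powr n * t powr (- n)"
    using k t by (simp add: powr_divide powr_minus_divide)
  finally show ?thesis by (simp add: truncated_power_def powr_powr)
qed

lemma is_frac_grad_barenblatt:
  assumes \<alpha>: "0 < \<alpha>" "\<alpha> \<le> 2" and m: "1 < m" and t: "0 < t"
  shows "is_frac_grad \<alpha> (pressure m (barenblatt \<alpha> m) t) (\<lambda>x::'a::euclidean_space. barenblatt_gradient \<alpha> m (t, x))"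
proof -
  have "is_frac_grad (2 * (\<alpha> / 2)) (truncated_power (\<alpha> / 2) (t powr (2 * sim_exponent DIM('a) \<alpha> m)))
      (truncated_gradient (\<alpha> / 2) (t powr (2 * sim_exponent DIM('a) \<alpha> m)) :: 'a \<Rightarrow> 'a)"
    using \<alpha> t by (intro is_frac_grad_truncated_power) auto
  from is_frac_grad_cmult[OF this, of "k_const DIM('a) \<alpha> m / t"] show ?thesis
    unfolding pressure_barenblatt[OF \<alpha>(1) m t, abs_def] barenblatt_gradient_def by simp
qed

section \<open>Pointwise solution away from the interface\<close>

text \<open>
  For \<open>\<alpha> < 2\<close> the field is continuous also on the interface; for \<open>\<alpha> = 2\<close> it jumps there, but the side of
  the interface is locally constant away from it.
\<close>

lemma isCont_barenblatt_gradient: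
  fixes x :: "'a::euclidean_space"
  assumes \<alpha>: "0 < \<alpha>" "\<alpha> \<le> 2" and t: "0 < t" and x: "(norm x)\<^sup>2 \<noteq> t powr (2 * sim_exponent DIM('a) \<alpha> m)"
  shows "isCont (barenblatt_gradient \<alpha> m) (t, x)"
proof -
  let ?l = "sim_exponent DIM('a) \<alpha> m"
  have fst: "isCont fst (t, x)" and snd: "isCont snd (t, x)"
    by (intro continuous_intros)+
  have \<rho>: "isCont (\<lambda>p::real \<times> 'a. fst p powr (2 * ?l)) (t, x)"
    using t by (intro continuous_intros) auto
  have k: "isCont (\<lambda>p::real \<times> 'a. k_const DIM('a) \<alpha> m / fst p) (t, x)"
    using t by (intro continuous_intros) auto
  have g: "isCont (\<lambda>p::real \<times> 'a. truncated_gradient (\<alpha> / 2) (fst p powr (2 * ?l)) (snd p)) (t, x)"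
  proof (cases "\<alpha> / 2 < 1")
    case True
    have "isCont (\<lambda>p::real \<times> 'a. (norm (snd p))\<^sup>2 / fst p powr (2 * ?l)) (t, x)"
      using t \<rho> by (intro continuous_intros) auto
    from isCont_o2[OF this continuous_tail_mass[of "\<alpha> / 2" "real DIM('a) / 2"]]
    have "isCont (\<lambda>p::real \<times> 'a. tail_mass (\<alpha> / 2) (real DIM('a) / 2) ((norm (snd p))\<^sup>2 / fst p powr (2 * ?l))) (t, x)"
      using True \<alpha> by simp
    then have "isCont (\<lambda>p::real \<times> 'a. - (2 * riesz_const (\<alpha> / 2) * tail_mass (\<alpha> / 2) (real DIM('a) / 2) ((norm (snd p))\<^sup>2 / fst p powr (2 * ?l))) *\<^sub>R snd p) (t, x)"
      by (intro continuous_intros snd)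
    then show ?thesis using True by (simp add: truncated_gradient_def)
  next
    case False
    let ?q = "\<lambda>p::real \<times> 'a. fst p powr (2 * ?l) - (norm (snd p))\<^sup>2"
    have "isCont ?q (t, x)"
      by (intro continuous_diff \<rho> continuous_intros)
    then have "?q \<midarrow>(t, x)\<rightarrow> ?q (t, x)"
      unfolding isCont_def .
    then have "eventually (\<lambda>p. (0 < ?q p) = (0 < ?q (t, x))) (at (t, x))"
    proof (cases "0 < ?q (t, x)")
      case True
      from order_tendstoD(1)[OF \<open>?q \<midarrow>(t, x)\<rightarrow> ?q (t, x)\<close> True] True show ?thesis by simp
    next
      case False
      then have "?q (t, x) < 0" using x by auto
      from order_tendstoD(2)[OF \<open>?q \<midarrow>(t, x)\<rightarrow> ?q (t, x)\<close> this] show ?thesis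
        by eventually_elim (use \<open>?q (t, x) < 0\<close> in auto)
    qed
    then have "eventually (\<lambda>p. - (2 * indicator {p. 0 < ?q p} (t, x)) *\<^sub>R snd p
        = truncated_gradient (\<alpha> / 2) (fst p powr (2 * ?l)) (snd p)) (at (t, x))"
      by eventually_elim (use False in \<open>auto simp: truncated_gradient_def indicator_def\<close>)
    moreover have "isCont (\<lambda>p::real \<times> 'a. - (2 * indicator {p. 0 < ?q p} (t, x)) *\<^sub>R snd p) (t, x)"
      by (intro continuous_intros snd)
    ultimately show ?thesis
      unfolding isCont_def
      by (elim Lim_transform_eventually[rotated]) (use False in \<open>auto simp: truncated_gradient_def indicator_def\<close>)
  qed
  have "isCont (\<lambda>p::real \<times> 'a. (k_const DIM('a) \<alpha> m / fst p) *\<^sub>R truncated_gradient (\<alpha> / 2) (fst p powr (2 * ?l)) (snd p)) (t, x)"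
    by (intro continuous_scaleR k g)
  then show ?thesis unfolding barenblatt_gradient_def case_prod_beta' .
qed

lemma frechet_derivative_at_eq:
  assumes "(f has_derivative f') (at x)"
  shows "frechet_derivative f (at x) = f'"
  using frechet_derivative_at[OF assms] by simp

lemma divergence_scaleR_id:
  fixes x :: "'a::euclidean_space"
  assumes g: "(g has_derivative g') (at x)"
  shows "(\<lambda>x. g x *\<^sub>R x) differentiable (at x)"
    and "divergence (\<lambda>x. g x *\<^sub>R x) x = real DIM('a) * g x + g' x"
proof -
  have F: "((\<lambda>x. g x *\<^sub>R x) has_derivative (\<lambda>h. g x *\<^sub>R h + g' h *\<^sub>R x)) (at x)"
    using has_derivative_scaleR[OF g has_derivative_ident] .
  then show "(\<lambda>x. g x *\<^sub>R x) differentiable (at x)" by (auto simp: differentiable_def)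
  have lin: "linear g'" using g by (rule has_derivative_linear)
  have "divergence (\<lambda>x. g x *\<^sub>R x) x = (\<Sum>b\<in>Basis. g x + g' b * (x \<bullet> b))"
    unfolding divergence_def frechet_derivative_at_eq[OF F]
    by (intro sum.cong) (auto simp: inner_simps inner_Basis)
  also have "\<dots> = real DIM('a) * g x + g' (\<Sum>b\<in>Basis. (x \<bullet> b) *\<^sub>R b)"
    by (simp add: sum.distrib linear_sum[OF lin] linear_cmul[OF lin] mult.commute)
  finally show "divergence (\<lambda>x. g x *\<^sub>R x) x = real DIM('a) * g x + g' x"
    by (simp add: euclidean_representation)
qed

text \<open>
  Inside the ball both sides are rational in \<open>u\<close>, \<open>t\<close>, \<open>|x|\<^sup>2\<close> and
  \<open>P = t powr (2 l) - |x|\<^sup>2\<close>; they agree because of the relation \<open>n = l (d + 2 e)\<close> between the exponents of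
  \<open>u = C t powr (- n) P powr e\<close>.  Outside, \<open>u\<close> vanishes in a neighbourhood.
\<close>

theorem pointwise_solution_barenblatt:
  assumes \<alpha>: "0 < \<alpha>" "\<alpha> \<le> 2" and m: "1 < m"
  shows "pointwise_solution_on \<alpha> m
    {(t, x::'a::euclidean_space). 0 < t \<and> norm x \<noteq> t powr (1 / (real DIM('a) * (m - 1) + \<alpha>))} (barenblatt \<alpha> m)"
  unfolding pointwise_solution_on_def
proof (intro exI conjI ballI)
  let ?S = "{(t, x::'a). 0 < t \<and> norm x \<noteq> t powr (1 / (real DIM('a) * (m - 1) + \<alpha>))}"
  let ?u = "barenblatt \<alpha> m :: real \<times> 'a \<Rightarrow> real" and ?w = "barenblatt_gradient \<alpha> m :: real \<times> 'a \<Rightarrow> 'a"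
  define l where "l = sim_exponent DIM('a) \<alpha> m"
  define n where "n = 1 / (m - 1)"
  define C where "C = k_const DIM('a) \<alpha> m powr n"
  define e where "e = \<alpha> / 2 * n"
  have N: "0 < real DIM('a) * (m - 1) + \<alpha>" using \<alpha> m by (intro sim_exponent_pos) auto
  have l: "l = 1 / (real DIM('a) * (m - 1) + \<alpha>)" by (simp add: l_def sim_exponent_def)
  have exps: "n = l * (real DIM('a) + 2 * e)"
  proof -
    have "n * (m - 1) = 1" using m by (simp add: n_def)
    then have "real DIM('a) * (n * (m - 1)) = real DIM('a)" by simp
    then have "real DIM('a) + 2 * e = n * (real DIM('a) * (m - 1) + \<alpha>)"
      by (simp add: e_def algebra_simps)
    then show ?thesis using N by (simp add: l)
  qed
  have sq: "(norm x)\<^sup>2 \<noteq> t powr (2 * l)" if "0 < t" "norm x \<noteq> t powr l" for t and x :: 'a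
  proof -
    have "t powr (2 * l) = (t powr l)\<^sup>2"
      using that by (simp add: power2_eq_square flip: powr_add)
    then show ?thesis using that by (simp add: power2_eq_iff_nonneg)
  qed
  show "is_frac_grad \<alpha> (pressure m ?u t) (\<lambda>x. ?w (t, x))" if "t \<in> fst ` ?S" for t
    using that \<alpha> m by (intro is_frac_grad_barenblatt) auto
  show "continuous_on ?S ?w"
    using sq \<alpha> by (intro continuous_at_imp_continuous_on ballI) (auto simp: l_def[symmetric] l[symmetric] intro!: isCont_barenblatt_gradient)
  fix p assume "p \<in> ?S"
  then obtain t x where p: "p = (t, x)" and t: "0 < t" and x: "norm x \<noteq> t powr l"
    by (auto simp: l)
  have fl: "(\<lambda>x. \<bar>?u (t, x)\<bar> *\<^sub>R ?w (t, x)) = (\<lambda>x. (- (l / t) * ?u (t, x)) *\<^sub>R x)"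
    using barenblatt_flux[where 'a='a, OF \<alpha> m t] by (simp add: l_def)
  have "(\<lambda>x. \<bar>?u (t, x)\<bar> *\<^sub>R ?w (t, x)) differentiable (at x) \<and>
    ((\<lambda>t. ?u (t, x)) has_real_derivative divergence (\<lambda>x. \<bar>?u (t, x)\<bar> *\<^sub>R ?w (t, x)) x) (at t)"
  proof (cases "(norm x)\<^sup>2 < t powr (2 * l)")
    case True
    define P where "P = t powr (2 * l) - (norm x)\<^sup>2"
    have P: "0 < P" using True by (simp add: P_def)
    define U where "U = C * t powr (- n) * P powr e"
    have Peq: "P powr (e - 1) = P powr e / P" "t powr (- n - 1) = t powr (- n) / t"
        "t powr (2 * l - 1) = t powr (2 * l) / t"
      using P t by (simp_all add: powr_diff)
    have sqd: "((\<lambda>y::'a. (norm y)\<^sup>2) has_derivative (\<lambda>h. 2 * (x \<bullet> h))) (at x)"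
      unfolding power2_norm_eq_inner
      by (auto intro!: derivative_eq_intros simp: inner_commute)
    have ux: "((\<lambda>y. ?u (t, y)) has_derivative (\<lambda>h. - (2 * e * U / P) * (x \<bullet> h))) (at x)"
    proof (rule has_derivative_transform_within_open[where s="{y. (norm y)\<^sup>2 < t powr (2 * l)}"])
      have zp: "((\<lambda>z. z powr e) has_derivative (\<lambda>h. h * (e * P powr (e - 1)))) (at P)"
        using has_real_derivative_powr[OF P, of e] unfolding has_field_derivative_def
        by (rule has_derivative_eq_rhs) (simp add: fun_eq_iff)
      from has_derivative_compose[OF has_derivative_diff[OF has_derivative_const sqd] zp[unfolded P_def]]
      have "((\<lambda>y::'a. (t powr (2 * l) - (norm y)\<^sup>2) powr e) has_derivative (\<lambda>h. (0 - 2 * (x \<bullet> h)) * (e * P powr (e - 1)))) (at x)"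
        unfolding P_def .
      from has_derivative_mult_right[OF this, of "C * t powr (- n)"]
      show "((\<lambda>y. C * t powr (- n) * (t powr (2 * l) - (norm y)\<^sup>2) powr e) has_derivative (\<lambda>h. - (2 * e * U / P) * (x \<bullet> h))) (at x)"
        by (rule has_derivative_eq_rhs) (auto simp: U_def Peq)
      show "C * t powr (- n) * (t powr (2 * l) - (norm y)\<^sup>2) powr e = ?u (t, y)" if "y \<in> {y. (norm y)\<^sup>2 < t powr (2 * l)}" for y
        using that barenblatt_factored[OF \<alpha>(1) m t, of y] by (simp add: C_def n_def l_def e_def)
      show "open {y::'a. (norm y)\<^sup>2 < t powr (2 * l)}"
        by (intro open_Collect_less continuous_intros)
    qed (use True in simp)
    have u: "?u (t, x) = U"
      using True barenblatt_factored[OF \<alpha>(1) m t, of x] by (simp add: C_def n_def l_def e_def U_def P_def)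
    have g: "((\<lambda>y. - (l / t) * ?u (t, y)) has_derivative (\<lambda>h. - (l / t) * (- (2 * e * U / P) * (x \<bullet> h)))) (at x)"
      by (rule has_derivative_mult_right[OF ux])
    have ut: "((\<lambda>s. ?u (s, x)) has_real_derivative - n * U / t + 2 * e * l * t powr (2 * l) * U / (t * P)) (at t)"
    proof (rule has_field_derivative_transform_within_open[where S="{0<..} \<inter> {s. (norm x)\<^sup>2 < s powr (2 * l)}"])
      have d1: "((\<lambda>s. C * s powr (- n)) has_real_derivative C * (- n * t powr (- n - 1))) (at t)"
        using t by (intro DERIV_cmult has_real_derivative_powr)
      have d2: "((\<lambda>s. s powr (2 * l) - (norm x)\<^sup>2) has_real_derivative 2 * l * t powr (2 * l - 1) - 0) (at t)"
        using t by (intro DERIV_diff has_real_derivative_powr DERIV_const)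
      have d3: "((\<lambda>s. (s powr (2 * l) - (norm x)\<^sup>2) powr e) has_real_derivative e * P powr (e - 1) * (2 * l * t powr (2 * l - 1) - 0)) (at t)"
        unfolding P_def by (rule DERIV_chain2[OF has_real_derivative_powr d2]) (use P in \<open>simp add: P_def\<close>)
      from DERIV_mult[OF d1 d3]
      show "((\<lambda>s. C * s powr (- n) * (s powr (2 * l) - (norm x)\<^sup>2) powr e) has_real_derivative - n * U / t + 2 * e * l * t powr (2 * l) * U / (t * P)) (at t)"
        by (rule DERIV_cong) (simp add: U_def Peq P_def[symmetric], simp add: mult_ac)
      show "C * s powr (- n) * (s powr (2 * l) - (norm x)\<^sup>2) powr e = ?u (s, x)"
        if "s \<in> {0<..} \<inter> {s. (norm x)\<^sup>2 < s powr (2 * l)}" for s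
        using that barenblatt_factored[OF \<alpha>(1) m, of s x] by (simp add: C_def n_def l_def e_def)
      have "continuous_on {0<..} (\<lambda>s. s powr (2 * l) - (norm x)\<^sup>2)"
        by (intro continuous_intros) auto
      from continuous_open_preimage[OF this open_greaterThan open_greaterThan[of 0]]
      show "open ({0<..} \<inter> {s. (norm x)\<^sup>2 < s powr (2 * l)})"
        by (simp add: vimage_def)
    qed (use True t in simp)
    have "divergence (\<lambda>x. \<bar>?u (t, x)\<bar> *\<^sub>R ?w (t, x)) x = - (l / t) * (real DIM('a) * U) + 2 * e * (l / t) * U * (norm x)\<^sup>2 / P"
      unfolding fl divergence_scaleR_id(2)[OF g] u by (simp add: power2_norm_eq_inner mult_ac)
    also have "\<dots> = - n * U / t + 2 * e * l * t powr (2 * l) * U / (t * P)"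
    proof -
      have tl: "t powr (2 * l) = P + (norm x)\<^sup>2" by (simp add: P_def)
      show ?thesis
        unfolding tl exps using t P by (simp add: divide_simps) (simp add: algebra_simps)
    qed
    finally show ?thesis
      using ut divergence_scaleR_id(1)[OF g] unfolding fl by simp
  next
    case False
    then have out: "t powr (2 * l) < (norm x)\<^sup>2" using sq[OF t x] by simp
    have zero: "?u (s, y) = 0" if "0 < s" "s powr (2 * l) \<le> (norm y)\<^sup>2" for s y
      using that barenblatt_factored[OF \<alpha>(1) m that(1), of y] by (simp add: l_def)
    have g: "((\<lambda>y. - (l / t) * ?u (t, y)) has_derivative (\<lambda>h. 0)) (at x)"
    proof (rule has_derivative_transform_within_open[where s="{y. t powr (2 * l) < (norm y)\<^sup>2}" and f="\<lambda>_. 0"])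
      show "open {y::'a. t powr (2 * l) < (norm y)\<^sup>2}"
        by (intro open_Collect_less continuous_intros)
    qed (use out zero t in auto)
    have "((\<lambda>s. ?u (s, x)) has_real_derivative 0) (at t)"
    proof (rule has_field_derivative_transform_within_open[where S="{0<..} \<inter> {s. s powr (2 * l) < (norm x)\<^sup>2}" and f="\<lambda>_. 0"])
      have "continuous_on {0<..} (\<lambda>s. (norm x)\<^sup>2 - s powr (2 * l))"
        by (intro continuous_intros) auto
      from continuous_open_preimage[OF this open_greaterThan open_greaterThan[of 0]]
      show "open ({0<..} \<inter> {s. s powr (2 * l) < (norm x)\<^sup>2})"
        by (simp add: vimage_def)
    qed (use out zero t in auto)
    moreover have "divergence (\<lambda>x. \<bar>?u (t, x)\<bar> *\<^sub>R ?w (t, x)) x = 0"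
      unfolding fl divergence_scaleR_id(2)[OF g] using zero[OF t] out by simp
    ultimately show ?thesis
      using divergence_scaleR_id(1)[OF g] unfolding fl by simp
  qed
  then show "case p of (t, x) \<Rightarrow> (\<lambda>x. \<bar>?u (t, x)\<bar> *\<^sub>R ?w (t, x)) differentiable (at x) \<and>
    ((\<lambda>t. ?u (t, x)) has_real_derivative divergence (\<lambda>x. \<bar>?u (t, x)\<bar> *\<^sub>R ?w (t, x)) x) (at t)"
    by (simp add: p)
qed

section \<open>Weak solution\<close>

lemma measurable_borel_prod:
  "f \<in> borel_measurable (borel \<Otimes>\<^sub>M borel) \<Longrightarrow>
    (f :: 'a::second_countable_topology \<times> 'b::second_countable_topology \<Rightarrow> _) \<in> borel_measurable borel"
  by (simp add: borel_prod)

lemma set_integrable_dominated_compact: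
  fixes f :: "'a::euclidean_space \<Rightarrow> 'b::{banach, second_countable_topology}"
  assumes K: "compact K" and [measurable]: "f \<in> borel_measurable borel" and [measurable]: "S \<in> sets borel"
    and bound: "\<And>x. norm (indicator S x *\<^sub>R f x) \<le> B * indicator K x"
  shows "set_integrable lborel S f"
  unfolding set_integrable_def
proof (rule Bochner_Integration.integrable_bound)
  have "integrable lborel (indicator K :: 'a \<Rightarrow> real)"
    using K emeasure_compact_finite[OF K] by (intro integrable_real_indicator) (auto intro: borel_compact)
  then show "integrable lborel (\<lambda>x. B * indicator K x :: real)"
    by (rule integrable_mult_right)
  show "AE x in lborel. norm (indicator S x *\<^sub>R f x) \<le> norm (B * indicator K x :: real)"
    using order_trans[OF bound abs_ge_self] by (intro AE_I2) simp
qed measurable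

lemma loc_integrable_on_bounded:
  fixes f :: "'a::euclidean_space \<Rightarrow> 'b::{banach, second_countable_topology}"
  assumes f: "f \<in> borel_measurable borel"
    and bound: "\<And>K. compact K \<Longrightarrow> K \<subseteq> S \<Longrightarrow> \<exists>B. \<forall>x\<in>K. norm (f x) \<le> B"
  shows "loc_integrable_on S f"
  unfolding loc_integrable_on_def
proof (intro allI impI)
  fix K assume K: "compact K \<and> K \<subseteq> S"
  then obtain B where B: "\<forall>x\<in>K. norm (f x) \<le> B" using bound[of K] by auto
  show "set_integrable lborel K f"
  proof (rule set_integrable_dominated_compact[where K=K and B=B, OF _ f])
    show "compact K" "K \<in> sets borel" using K by (auto intro: borel_compact)
    show "norm (indicator K x *\<^sub>R f x) \<le> B * indicator K x" for x
      using B by (cases "x \<in> K") simp_all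
  qed
qed

lemma profile_nonneg: "0 \<le> profile \<alpha> m y"
  by (simp add: profile_def)

lemma profile_le:
  fixes y :: "'a::euclidean_space"
  assumes "0 < \<alpha>" "1 < m"
  shows "profile \<alpha> m y \<le> k_const DIM('a) \<alpha> m powr (1 / (m - 1)) * indicator (cball 0 1) y"
proof (cases "norm y \<le> 1")
  case True
  have k: "0 < k_const DIM('a) \<alpha> m" using assms by (intro k_const_pos) auto
  have "(norm y)\<^sup>2 \<le> 1" using True by (simp add: power_le_one)
  then have "max 0 (1 - (norm y)\<^sup>2) powr (\<alpha> / 2) \<le> 1 powr (\<alpha> / 2)"
    using assms by (intro powr_mono2) auto
  then have "k_const DIM('a) \<alpha> m * max 0 (1 - (norm y)\<^sup>2) powr (\<alpha> / 2) \<le> k_const DIM('a) \<alpha> m * 1"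
    using k by (intro mult_left_mono) auto
  then show ?thesis
    unfolding profile_def using True k assms by (auto intro!: powr_mono2)
next
  case False
  then have "1 \<le> (norm y)\<^sup>2" by (simp add: one_le_power)
  then show ?thesis using False by (simp add: profile_def)
qed

lemma measurable_profile [measurable]: "profile \<alpha> m \<in> borel_measurable borel"
  unfolding profile_def by measurable

lemma integrable_profile:
  assumes "0 < \<alpha>" "1 < m"
  shows "integrable lborel (profile \<alpha> m :: 'a::euclidean_space \<Rightarrow> real)"
proof (rule Bochner_Integration.integrable_bound)
  show "integrable lborel (\<lambda>y::'a. k_const DIM('a) \<alpha> m powr (1 / (m - 1)) * indicator (cball 0 1) y)"
    by (intro integrable_mult_right integrable_indicator_cball)
  show "AE y::'a in lborel. norm (profile \<alpha> m y) \<le> norm (k_const DIM('a) \<alpha> m powr (1 / (m - 1)) * indicator (cball 0 1) y :: real)"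
    using order_trans[OF profile_le[OF assms] abs_ge_self]
    by (intro AE_I2) (simp only: real_norm_def abs_of_nonneg[OF profile_nonneg])
qed simp

lemma measurable_barenblatt: "barenblatt \<alpha> m \<in> borel_measurable borel"
  by (rule measurable_borel_prod) (simp add: barenblatt_def)

lemma barenblatt_scaled:
  "0 < t \<Longrightarrow> barenblatt \<alpha> m (t, t powr sim_exponent DIM('a) \<alpha> m *\<^sub>R (y::'a::euclidean_space))
    = profile \<alpha> m y / t powr (real DIM('a) * sim_exponent DIM('a) \<alpha> m)"
  by (simp add: barenblatt_def)

lemma sim_exponent_gt_0:
  assumes "0 < \<alpha>" "1 < m" "0 < d"
  shows "0 < sim_exponent d \<alpha> m"
  using sim_exponent_pos[OF assms] by (simp add: sim_exponent_def)

lemma barenblatt_le: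
  fixes x :: "'a::euclidean_space"
  assumes \<alpha>: "0 < \<alpha>" and m: "1 < m" and t: "0 < \<eta>" "\<eta> \<le> t" "t \<le> T"
  defines "l \<equiv> sim_exponent DIM('a) \<alpha> m"
  shows "barenblatt \<alpha> m (t, x) \<le> k_const DIM('a) \<alpha> m powr (1 / (m - 1)) / \<eta> powr (real DIM('a) * l) * indicator (cball 0 (T powr l)) x"
proof -
  have l: "0 < l" unfolding l_def using \<alpha> m by (intro sim_exponent_gt_0) auto
  let ?y = "x /\<^sub>R t powr l"
  have x: "x = t powr l *\<^sub>R ?y" using t by simp
  have "indicator (cball 0 1) ?y \<le> (indicator (cball 0 (T powr l)) x :: real)"
  proof -
    have "norm x \<le> T powr l" if "norm ?y \<le> 1"
    proof -
      have "norm x = t powr l * norm ?y" by (subst x) (simp only: norm_scaleR, simp)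
      also have "\<dots> \<le> t powr l" using that by (simp add: mult_left_le del: norm_scaleR)
      also have "\<dots> \<le> T powr l" using t l by (intro powr_mono2) auto
      finally show ?thesis .
    qed
    then show ?thesis by (simp add: indicator_def del: norm_scaleR)
  qed
  from order_trans[OF profile_le[OF \<alpha> m] mult_left_mono[OF this powr_ge_zero]]
  have "profile \<alpha> m ?y / t powr (real DIM('a) * l)
      \<le> k_const DIM('a) \<alpha> m powr (1 / (m - 1)) * indicator (cball 0 (T powr l)) x / \<eta> powr (real DIM('a) * l)"
    using t l profile_nonneg[of \<alpha> m ?y] by (intro frac_le powr_mono2) auto
  moreover have "barenblatt \<alpha> m (t, x) = profile \<alpha> m ?y / t powr (real DIM('a) * l)"
    unfolding barenblatt_def by (simp add: l_def)
  ultimately show ?thesis by (simp only: times_divide_eq_left)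
qed

lemma integral_lborel_scale:
  fixes h :: "'a::euclidean_space \<Rightarrow> real"
  assumes [measurable]: "h \<in> borel_measurable borel" and c: "0 < c"
  shows "(LBINT x. h x) = c ^ DIM('a) * (LBINT y. h (c *\<^sub>R y))"
  using c by (subst lborel_affine[of c "0::'a"]) (simp_all add: integral_density integral_distr)

text \<open>
  The prefactor of the self-similar form is the Jacobian of the substitution \<open>x = t powr l y\<close>.
\<close>

lemma integral_barenblatt:
  fixes g :: "'a::euclidean_space \<Rightarrow> real"
  assumes g [measurable]: "g \<in> borel_measurable borel" and t: "0 < t"
  shows "(LBINT x. barenblatt \<alpha> m (t, x) * g x) = (LBINT y. profile \<alpha> m y * g (t powr sim_exponent DIM('a) \<alpha> m *\<^sub>R y))"
proof -
  let ?l = "sim_exponent DIM('a) \<alpha> m"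
  have [measurable]: "(\<lambda>x::'a. barenblatt \<alpha> m (t, x)) \<in> borel_measurable borel"
    unfolding barenblatt_def by simp
  have c: "(t powr ?l) ^ DIM('a) = t powr (real DIM('a) * ?l)"
    using t by (simp add: powr_powr mult.commute flip: powr_realpow)
  have "(LBINT x. barenblatt \<alpha> m (t, x) * g x)
    = (t powr ?l) ^ DIM('a) * (LBINT y. barenblatt \<alpha> m (t, t powr ?l *\<^sub>R y) * g (t powr ?l *\<^sub>R y))"
    using t by (intro integral_lborel_scale) auto
  also have "\<dots> = (LBINT y. t powr (real DIM('a) * ?l) * (barenblatt \<alpha> m (t, t powr ?l *\<^sub>R y) * g (t powr ?l *\<^sub>R y)))"
    by (simp only: c integral_mult_right_zero)
  also have "\<dots> = (LBINT y. profile \<alpha> m y * g (t powr ?l *\<^sub>R y))"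
  proof -
    have "c * (p / c * q) = p * q" if "0 < c" for c p q :: real
      using that by simp
    from this[of "t powr (real DIM('a) * ?l)"] show ?thesis
      unfolding barenblatt_scaled[OF t] using t by simp
  qed
  finally show ?thesis .
qed

lemma truncated_gradient_le:
  assumes a: "0 < a" "a \<le> 1"
  obtains M where "0 \<le> M" "\<And>\<rho> x. norm (truncated_gradient a \<rho> (x::'a::euclidean_space)) \<le> M * norm x"
proof (cases "a < 1")
  case True
  define D where "D = real DIM('a) / 2"
  have D: "0 < D" by (simp add: D_def)
  have c: "0 < riesz_const a"
    unfolding riesz_const_def using a True by (intro divide_pos_pos mult_pos_pos Gamma_real_pos) auto
  let ?B = "Gamma (1 - a) * Gamma (D + a) / Gamma (D + 1)"
  have B: "tail_mass a D z \<le> ?B" for z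
    using a True D by (intro tail_mass_bounded) auto
  have B0: "0 \<le> ?B" using order_trans[OF tail_mass_nonneg B] .
  show ?thesis
  proof
    show "0 \<le> 2 * riesz_const a * ?B" using c by (intro mult_nonneg_nonneg B0) auto
    fix \<rho> and x :: 'a
    have "norm (truncated_gradient a \<rho> x) = 2 * riesz_const a * tail_mass a D ((norm x)\<^sup>2 / \<rho>) * norm x"
      using True c tail_mass_nonneg[of a D] by (simp add: truncated_gradient_def D_def[symmetric] abs_mult)
    also have "\<dots> \<le> 2 * riesz_const a * ?B * norm x"
      using c by (intro mult_right_mono mult_left_mono B) auto
    finally show "norm (truncated_gradient a \<rho> x) \<le> 2 * riesz_const a * ?B * norm x" .
  qed
next
  case False
  show ?thesis
    by (rule that[of 2]) (use False in \<open>auto simp: truncated_gradient_def indicator_def\<close>)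
qed

lemma measurable_barenblatt_gradient:
  assumes "0 < \<alpha>" "\<alpha> \<le> 2"
  shows "barenblatt_gradient \<alpha> m \<in> borel_measurable borel"
proof (rule measurable_borel_prod)
  show "barenblatt_gradient \<alpha> m \<in> borel_measurable (borel \<Otimes>\<^sub>M (borel :: 'a measure))"
  proof (cases "\<alpha> / 2 < 1")
    case True
    have [measurable]: "tail_mass (\<alpha> / 2) (real DIM('a) / 2) \<in> borel_measurable borel"
      using True assms
      by (intro borel_measurable_continuous_onI continuous_at_imp_continuous_on ballI continuous_tail_mass) auto
    show ?thesis
      unfolding barenblatt_gradient_def truncated_gradient_def using True by simp
  next
    case False
    then show ?thesis
      unfolding barenblatt_gradient_def truncated_gradient_def indicator_def mem_Collect_eq by simp
  qed
qed

lemma has_vector_derivative_chain: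
  assumes g: "(g has_vector_derivative v) (at t)" and f: "f differentiable (at (g t))"
  shows "((\<lambda>t. f (g t)) has_vector_derivative frechet_derivative f (at (g t)) v) (at t)"
proof -
  have "(f has_derivative frechet_derivative f (at (g t))) (at (g t))"
    using f by (simp add: frechet_derivative_works)
  from vector_derivative_diff_chain_within[OF g has_derivative_at_withinI[OF this]]
  show ?thesis by (simp add: o_def)
qed

lemma frechet_derivative_Pair_split:
  fixes f :: "real \<times> 'a::euclidean_space \<Rightarrow> real"
  assumes "f differentiable (at p)"
  shows "frechet_derivative f (at p) (c, v) = c * frechet_derivative f (at p) (1, 0)
    + (\<Sum>b\<in>Basis. (v \<bullet> b) * frechet_derivative f (at p) (0, b))"
proof -
  have lin: "linear (frechet_derivative f (at p))"
    using assms by (rule linear_frechet_derivative)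
  have "(c, v) = c *\<^sub>R (1, 0) + (\<Sum>b\<in>Basis. (v \<bullet> b) *\<^sub>R (0, b))"
    by (simp add: prod_eq_iff fst_sum snd_sum euclidean_representation)
  then show ?thesis
    by (simp only: linear_add[OF lin] linear_sum[OF lin] linear_cmul[OF lin] real_scaleR_def)
qed

lemma inner_gradient_Pair:
  fixes f :: "real \<times> 'a::euclidean_space \<Rightarrow> real"
  assumes f: "f differentiable (at (t, x))"
  shows "v \<bullet> gradient (\<lambda>x. f (t, x)) x = frechet_derivative f (at (t, x)) (0, v)"
proof -
  have "(f has_derivative frechet_derivative f (at (t, x))) (at (t, x))"
    using f by (simp add: frechet_derivative_works)
  moreover have "((\<lambda>x. (t, x)) has_derivative (\<lambda>h. (0, h))) (at x)"
    by (auto intro!: derivative_eq_intros)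
  ultimately have "((\<lambda>x. f (t, x)) has_derivative (\<lambda>h. frechet_derivative f (at (t, x)) (0, h))) (at x)"
    using has_derivative_compose[of "\<lambda>x. (t, x)" "\<lambda>h. (0, h)" x UNIV f] by simp
  then have "frechet_derivative (\<lambda>x. f (t, x)) (at x) = (\<lambda>h. frechet_derivative f (at (t, x)) (0, h))"
    by (rule frechet_derivative_at_eq)
  then have "v \<bullet> gradient (\<lambda>x. f (t, x)) x = (\<Sum>b\<in>Basis. (v \<bullet> b) * frechet_derivative f (at (t, x)) (0, b))"
    unfolding gradient_def by (simp add: inner_sum_right mult.commute)
  also have "\<dots> = frechet_derivative f (at (t, x)) (0, v)"
    unfolding frechet_derivative_Pair_split[OF f, of 0 v] by simp
  finally show ?thesis .
qed

text \<open>
  Since the flux is \<open>- (l / t) u x\<close>, the integrand is \<open>u\<close> times the derivative of \<open>\<phi>\<close> in the direction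
  \<open>(1, (l / t) x)\<close>, the velocity of the curve \<open>t \<mapsto> (t, t powr l y)\<close> through \<open>(t, x)\<close>.
\<close>

lemma weak_formulation_barenblatt:
  fixes \<phi> :: "real \<times> 'a::euclidean_space \<Rightarrow> real"
  assumes \<alpha>: "0 < \<alpha>" "\<alpha> \<le> 2" and m: "1 < m" and \<eta>: "0 < \<eta>" and \<phi>: "test_function \<eta> T \<phi>"
    and s: "\<eta> < s" "s < T"
  defines "l \<equiv> sim_exponent DIM('a) \<alpha> m"
  shows "(LBINT t:{s<..<T}. LBINT x. barenblatt \<alpha> m (t, x) * deriv (\<lambda>t. \<phi> (t, x)) t
      - (\<bar>barenblatt \<alpha> m (t, x)\<bar> *\<^sub>R barenblatt_gradient \<alpha> m (t, x)) \<bullet> gradient (\<lambda>x. \<phi> (t, x)) x)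
    = - (LBINT y. profile \<alpha> m y * \<phi> (s, s powr l *\<^sub>R y))"
proof -
  let ?I = "\<lambda>t x. barenblatt \<alpha> m (t, x) * deriv (\<lambda>t. \<phi> (t, x)) t - (\<bar>barenblatt \<alpha> m (t, x)\<bar> *\<^sub>R barenblatt_gradient \<alpha> m (t, x)) \<bullet> gradient (\<lambda>x. \<phi> (t, x)) x"
  define d where "d q v = frechet_derivative \<phi> (at q) v" for q v
  define E where "E t y = d (t, t powr l *\<^sub>R y) (1, (l * t powr (l - 1)) *\<^sub>R y)" for t y
  let ?\<Omega> = "{\<eta><..<T} \<times> (UNIV :: 'a set)"
  have open\<Omega>: "open ?\<Omega>" by (intro open_Times) auto
  have "Ck_on (Suc 0) ?\<Omega> \<phi>"
    using \<phi> unfolding test_function_def smooth_on_def by blast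
  then have diff: "\<And>q. q \<in> ?\<Omega> \<Longrightarrow> \<phi> differentiable (at q)" and dcont: "\<And>v. continuous_on ?\<Omega> (\<lambda>q. d q v)"
    by (auto simp: d_def)
  obtain \<tau> where \<tau>: "\<tau> < T" "\<And>t x. t \<in> {\<eta>..T} \<Longrightarrow> \<tau> < t \<Longrightarrow> \<phi> (t, x) = 0"
    using \<phi> unfolding test_function_def by blast
  \<comment> \<open>\<open>\<phi>\<close> vanishes on \<open>(\<tau>', T)\<close>, and \<open>[s, \<tau>']\<close> lies in the open interval where \<open>\<phi>\<close> is smooth.\<close>
  define \<tau>' where "\<tau>' = (max \<tau> s + T) / 2"
  have \<tau>': "\<tau> < \<tau>'" "s < \<tau>'" "\<tau>' < T" using \<tau>(1) s by (auto simp: \<tau>'_def)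
  have path: "((\<lambda>t. \<phi> (t, t powr l *\<^sub>R y)) has_real_derivative E t y) (at t)" if t: "\<eta> < t" "t < T" for t y
  proof -
    have "((\<lambda>t. t powr l) has_real_derivative l * t powr (l - 1)) (at t)"
      using t \<eta> by (intro has_real_derivative_powr) simp
    then have "((\<lambda>t. (t, t powr l *\<^sub>R y)) has_vector_derivative (1, (l * t powr (l - 1)) *\<^sub>R y)) (at t)"
      by (intro has_vector_derivative_Pair has_vector_derivative_id has_vector_derivative_scaleR[THEN has_vector_derivative_eq_rhs])
        (auto intro!: has_vector_derivative_const simp: has_real_derivative_iff_has_vector_derivative)
    from has_vector_derivative_chain[OF this diff] t show ?thesis
      unfolding has_real_derivative_iff_has_vector_derivative E_def d_def by simp
  qed
  have Econt: "continuous_on ?\<Omega> (\<lambda>p. E (fst p) (snd p))"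
  proof -
    have q: "continuous_on ?\<Omega> (\<lambda>p. (fst p, fst p powr l *\<^sub>R snd p))"
      using \<eta> by (intro continuous_intros) auto
    have dq: "continuous_on ?\<Omega> (\<lambda>p. d (fst p, fst p powr l *\<^sub>R snd p) v)" for v
      by (rule continuous_on_compose2[OF dcont q]) auto
    have c: "continuous_on ?\<Omega> (\<lambda>p. l * fst p powr (l - 1))"
      using \<eta> by (intro continuous_intros) auto
    have "continuous_on ?\<Omega> (\<lambda>p. d (fst p, fst p powr l *\<^sub>R snd p) (1, 0)
        + (\<Sum>b\<in>Basis. (((l * fst p powr (l - 1)) *\<^sub>R snd p) \<bullet> b) * d (fst p, fst p powr l *\<^sub>R snd p) (0, b)))"
      by (intro continuous_on_add continuous_on_sum continuous_on_mult continuous_on_inner continuous_on_scaleR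
          dq c continuous_on_snd continuous_on_id continuous_on_const)
    then show ?thesis
    proof (rule continuous_on_eq)
      fix p assume "p \<in> ?\<Omega>"
      then have "\<phi> differentiable (at (fst p, fst p powr l *\<^sub>R snd p))"
        by (intro diff) auto
      from frechet_derivative_Pair_split[OF this, of 1 "(l * fst p powr (l - 1)) *\<^sub>R snd p"]
      show "d (fst p, fst p powr l *\<^sub>R snd p) (1, 0)
        + (\<Sum>b\<in>Basis. (((l * fst p powr (l - 1)) *\<^sub>R snd p) \<bullet> b) * d (fst p, fst p powr l *\<^sub>R snd p) (0, b)) = E (fst p) (snd p)"
        by (simp add: E_def d_def)
    qed
  qed
  have E0: "E t y = 0" if "\<tau>' < t" "t < T" for t y
  proof -
    have "t \<in> {\<tau>'<..<T}" using that by simp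
    moreover have "((\<lambda>t. \<phi> (t, t powr l *\<^sub>R y)) has_real_derivative 0) (at t)"
    proof (rule has_field_derivative_transform_within_open[where S="{\<tau>'<..<T}" and f="\<lambda>_. 0"])
      show "0 = \<phi> (r, r powr l *\<^sub>R y)" if "r \<in> {\<tau>'<..<T}" for r
        using that \<tau>' s \<tau>(2)[of r] by simp
    qed (use that in auto)
    ultimately show ?thesis
      using path[of t y] DERIV_unique that \<tau>' s by fastforce
  qed
  \<comment> \<open>In the variable \<open>y = x / t powr l\<close> the space integral is that of \<open>profile\<close> against a time derivative.\<close>
  have inner: "(LBINT x. ?I t x)
    = (LBINT y. profile \<alpha> m y * E t y)" if t: "\<eta> < t" "t < T" for t
  proof -
    have t0: "0 < t" using t \<eta> by simp
    have dt: "\<phi> differentiable (at (t, x))" for x using t by (intro diff) simp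
    have "deriv (\<lambda>t. \<phi> (t, x)) t = d (t, x) (1, 0)" for x
    proof -
      have "((\<lambda>t. (t, x)) has_vector_derivative (1, 0)) (at t)"
        by (intro has_vector_derivative_Pair has_vector_derivative_id has_vector_derivative_const)
      from has_vector_derivative_chain[OF this dt]
      have "((\<lambda>t. \<phi> (t, x)) has_real_derivative d (t, x) (1, 0)) (at t)"
        unfolding has_real_derivative_iff_has_vector_derivative d_def .
      then show ?thesis by (rule DERIV_imp_deriv)
    qed
    moreover have "d (t, x) (1, 0) + (l / t) * d (t, x) (0, x) = d (t, x) (1, (l / t) *\<^sub>R x)" for x
      unfolding d_def frechet_derivative_Pair_split[OF dt[of x], of 1 "(l / t) *\<^sub>R x"] frechet_derivative_Pair_split[OF dt[of x], of 0 x]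
      by (simp add: sum_distrib_left mult.assoc)
    ultimately have "?I t x
      = barenblatt \<alpha> m (t, x) * d (t, x) (1, (l / t) *\<^sub>R x)" for x
    proof -
      have "(\<bar>barenblatt \<alpha> m (t, x)\<bar> *\<^sub>R barenblatt_gradient \<alpha> m (t, x)) \<bullet> gradient (\<lambda>x. \<phi> (t, x)) x
          = - (l / t * barenblatt \<alpha> m (t, x)) * d (t, x) (0, x)"
        unfolding barenblatt_flux[OF \<alpha> m t0] l_def[symmetric] inner_scaleR_left
        unfolding inner_gradient_Pair[OF dt] d_def ..
      then show ?thesis
        unfolding \<open>\<And>x. deriv (\<lambda>t. \<phi> (t, x)) t = d (t, x) (1, 0)\<close>
          \<open>\<And>x. d (t, x) (1, 0) + (l / t) * d (t, x) (0, x) = d (t, x) (1, (l / t) *\<^sub>R x)\<close>[symmetric]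
        by (simp add: algebra_simps)
    qed
    then have "(LBINT x. ?I t x)
      = (LBINT x. barenblatt \<alpha> m (t, x) * d (t, x) (1, (l / t) *\<^sub>R x))"
      by simp
    also have "\<dots> = (LBINT y. profile \<alpha> m y * d (t, t powr l *\<^sub>R y) (1, (l / t) *\<^sub>R (t powr l *\<^sub>R y)))"
      unfolding l_def
    proof (rule integral_barenblatt[OF _ t0])
      have dx: "continuous_on UNIV (\<lambda>x. d (t, x) v)" for v
        using t by (intro continuous_on_compose2[OF dcont] continuous_intros) auto
      have "continuous_on UNIV (\<lambda>x. d (t, x) (1, 0) + (\<Sum>b\<in>Basis. (((l / t) *\<^sub>R x) \<bullet> b) * d (t, x) (0, b)))"
        by (intro continuous_on_add continuous_on_sum continuous_on_mult continuous_on_inner continuous_on_scaleR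
          dx continuous_on_id continuous_on_const)
      then have "continuous_on UNIV (\<lambda>x. d (t, x) (1, (l / t) *\<^sub>R x))"
      proof (rule continuous_on_eq)
        fix x :: 'a
        show "d (t, x) (1, 0) + (\<Sum>b\<in>Basis. (((l / t) *\<^sub>R x) \<bullet> b) * d (t, x) (0, b)) = d (t, x) (1, (l / t) *\<^sub>R x)"
          using frechet_derivative_Pair_split[OF dt[of x], of 1 "(l / t) *\<^sub>R x"] unfolding d_def mult_1 by (rule sym)
      qed
      then show "(\<lambda>x. d (t, x) (1, (sim_exponent DIM('a) \<alpha> m / t) *\<^sub>R x)) \<in> borel_measurable borel"
        unfolding l_def by (rule borel_measurable_continuous_onI)
    qed
    also have "\<dots> = (LBINT y. profile \<alpha> m y * E t y)"
      using t0 by (simp add: E_def powr_diff)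
    finally show ?thesis .
  qed
  obtain B where B: "\<And>t y. t \<in> {s..\<tau>'} \<Longrightarrow> y \<in> cball 0 1 \<Longrightarrow> \<bar>E t y\<bar> \<le> B"
  proof -
    have "continuous_on ({s..\<tau>'} \<times> cball 0 1) (\<lambda>p. E (fst p) (snd p))"
      using s \<tau>' by (intro continuous_on_subset[OF Econt]) auto
    from compact_imp_bounded[OF compact_continuous_image[OF this]]
    have "bounded ((\<lambda>p. E (fst p) (snd p)) ` ({s..\<tau>'} \<times> cball 0 1))"
      by (simp add: compact_Times)
    then obtain B where "\<forall>z\<in>(\<lambda>p. E (fst p) (snd p)) ` ({s..\<tau>'} \<times> cball 0 1). norm z \<le> B"
      unfolding bounded_iff by blast
    then show ?thesis using that[of B] by force
  qed
  define h where "h t y = indicator {s<..<T} t * (profile \<alpha> m y * E t y)" for t y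
  have hint: "integrable (lborel \<Otimes>\<^sub>M lborel) (case_prod h)"
  proof (rule lborel_pair.integrable_dominated_by_product[where g="\<lambda>t. \<bar>B\<bar> * indicator {s..\<tau>'} t" and h="profile \<alpha> m"])
    have "continuous_on ({s<..<T} \<times> UNIV) (\<lambda>p. E (fst p) (snd p))"
      using s by (intro continuous_on_subset[OF Econt]) auto
    then have "(\<lambda>p. indicator ({s<..<T} \<times> (UNIV :: 'a set)) p *\<^sub>R E (fst p) (snd p)) \<in> borel_measurable borel"
      by (intro borel_measurable_continuous_on_indicator borel_open open_Times) auto
    then have [measurable]: "(\<lambda>p. indicator ({s<..<T} \<times> (UNIV :: 'a set)) p *\<^sub>R E (fst p) (snd p)) \<in> borel_measurable (borel \<Otimes>\<^sub>M borel)"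
      by (simp add: borel_prod)
    have "(\<lambda>p. profile \<alpha> m (snd p) * (indicator ({s<..<T} \<times> (UNIV :: 'a set)) p *\<^sub>R E (fst p) (snd p))) \<in> borel_measurable (borel \<Otimes>\<^sub>M borel)"
      by measurable
    moreover have "case_prod h = (\<lambda>p. profile \<alpha> m (snd p) * (indicator ({s<..<T} \<times> (UNIV :: 'a set)) p *\<^sub>R E (fst p) (snd p)))"
      by (auto simp: h_def fun_eq_iff indicator_def)
    ultimately show "case_prod h \<in> borel_measurable (lborel \<Otimes>\<^sub>M lborel)"
      by (simp add: measurable_cong_sets[OF sets_pair_measure_cong[OF sets_lborel sets_lborel] refl])
    show "integrable lborel (\<lambda>t. \<bar>B\<bar> * indicator {s..\<tau>'} t)"
      by (intro integrable_mult_right integrable_real_indicator) (simp_all add: emeasure_lborel_Icc_eq)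
    show "integrable lborel (profile \<alpha> m :: 'a \<Rightarrow> real)"
      using \<alpha>(1) m by (rule integrable_profile)
    show "norm (h t y) \<le> \<bar>B\<bar> * indicator {s..\<tau>'} t * profile \<alpha> m y" for t y
    proof (cases "s < t \<and> t < T \<and> norm y \<le> 1")
      case True
      show ?thesis
      proof (cases "t \<le> \<tau>'")
        case le: True
        have "\<bar>E t y\<bar> \<le> \<bar>B\<bar>" using B[of t y] True le by auto
        then have "\<bar>E t y\<bar> * profile \<alpha> m y \<le> \<bar>B\<bar> * profile \<alpha> m y"
          by (intro mult_right_mono profile_nonneg)
        then show ?thesis using True le profile_nonneg[of \<alpha> m y] by (simp add: h_def abs_mult mult.commute)
      next
        case False
        then show ?thesis using E0[of t y] True by (simp add: h_def)
      qed
    next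
      case False
      have "norm y \<le> 1 \<or> profile \<alpha> m y = 0"
        using profile_le[OF \<alpha>(1) m, of y] profile_nonneg[of \<alpha> m y]
        by (cases "norm y \<le> 1") simp_all
      then show ?thesis using False profile_nonneg[of \<alpha> m y] by (auto simp: h_def)
    qed
  qed
  have FTC: "(LBINT t. indicator {s<..<T} t * E t y) = - \<phi> (s, s powr l *\<^sub>R y)" for y
  proof -
    have "(LBINT t. E t y * indicator {s..\<tau>'} t) = \<phi> (\<tau>', \<tau>' powr l *\<^sub>R y) - \<phi> (s, s powr l *\<^sub>R y)"
    proof (rule integral_FTC_Icc_real)
      show "s \<le> \<tau>'" using \<tau>' by simp
      fix t assume t: "s \<le> t" "t \<le> \<tau>'"
      show "((\<lambda>t. \<phi> (t, t powr l *\<^sub>R y)) has_real_derivative E t y) (at t)"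
        using t s \<tau>' by (intro path) auto
      have "isCont (\<lambda>p. E (fst p) (snd p)) (t, y)"
        using Econt open\<Omega> t s \<tau>' by (simp add: continuous_on_eq_continuous_at)
      moreover have "isCont (\<lambda>t. (t, y)) t"
        by (intro continuous_intros)
      ultimately show "isCont (\<lambda>t. E t y) t"
        using isCont_o2[of t "\<lambda>t. (t, y)" "\<lambda>p. E (fst p) (snd p)"] by simp
    qed
    moreover have "\<phi> (\<tau>', \<tau>' powr l *\<^sub>R y) = 0"
      using \<tau>' s by (intro \<tau>(2)) auto
    moreover have "(LBINT t. E t y * indicator {s..\<tau>'} t) = (LBINT t. indicator {s<..<T} t * E t y)"
    proof (rule integral_cong_AE)
      show "AE t in lborel. E t y * indicator {s..\<tau>'} t = indicator {s<..<T} t * E t y"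
        using AE_lborel_singleton[of s]
      proof eventually_elim
        case (elim t)
        then show ?case using E0[of t y] \<tau>' s by (auto simp: indicator_def)
      qed
      have meas: "(\<lambda>t. indicator {s<..<T} t *\<^sub>R E t y) \<in> borel_measurable borel"
        using s by (intro borel_measurable_continuous_on_indicator continuous_on_compose2[OF Econt, of _ "\<lambda>t. (t, y)", simplified] continuous_intros) auto
      then show "(\<lambda>t. indicator {s<..<T} t * E t y) \<in> borel_measurable lborel" by simp
      have "(\<lambda>t. indicator {s..\<tau>'} t *\<^sub>R E t y) \<in> borel_measurable borel"
        using s \<tau>' by (intro borel_measurable_continuous_on_indicator continuous_on_compose2[OF Econt, of _ "\<lambda>t. (t, y)", simplified] continuous_intros) auto
      then show "(\<lambda>t. E t y * indicator {s..\<tau>'} t) \<in> borel_measurable lborel" by (simp add: mult.commute)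
    qed
    ultimately show ?thesis by simp
  qed
  have "(LBINT t:{s<..<T}. LBINT x. ?I t x)
    = (LBINT t:{s<..<T}. LBINT y. profile \<alpha> m y * E t y)"
    by (rule set_lebesgue_integral_cong) (use s inner in auto)
  also have "\<dots> = (LBINT t. LBINT y. h t y)"
    unfolding set_lebesgue_integral_def h_def by simp
  also have "\<dots> = (LBINT y. LBINT t. h t y)"
    using lborel_pair.Fubini_integral[OF hint] by simp
  also have "\<dots> = (LBINT y. profile \<alpha> m y * (LBINT t. indicator {s<..<T} t * E t y))"
  proof -
    have "(LBINT t. h t y) = profile \<alpha> m y * (LBINT t. indicator {s<..<T} t * E t y)" for y
      unfolding h_def by (subst integral_mult_right_zero[symmetric]) (simp only: mult_ac)
    then show ?thesis by simp
  qed
  also have "\<dots> = - (LBINT y. profile \<alpha> m y * \<phi> (s, s powr l *\<^sub>R y))"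
    unfolding FTC by simp
  finally show ?thesis .
qed

text \<open>
  A test function is continuous up to \<open>t = \<eta>\<close>, so dominated convergence applies on the fixed support of the
  profile.
\<close>

lemma initial_trace_barenblatt:
  fixes \<phi> :: "real \<times> 'a::euclidean_space \<Rightarrow> real"
  assumes \<alpha>: "0 < \<alpha>" and m: "1 < m" and \<eta>: "0 < \<eta>" "\<eta> < T" and \<phi>: "test_function \<eta> T \<phi>"
  defines "l \<equiv> sim_exponent DIM('a) \<alpha> m"
  shows "integrable lborel (\<lambda>x. barenblatt \<alpha> m (\<eta>, x) * \<phi> (\<eta>, x))"
    and "(LBINT x. barenblatt \<alpha> m (\<eta>, x) * \<phi> (\<eta>, x)) = (LBINT y. profile \<alpha> m y * \<phi> (\<eta>, \<eta> powr l *\<^sub>R y))"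
    and "((\<lambda>s. LBINT y. profile \<alpha> m y * \<phi> (s, s powr l *\<^sub>R y)) \<longlongrightarrow> (LBINT y. profile \<alpha> m y * \<phi> (\<eta>, \<eta> powr l *\<^sub>R y))) (at_right \<eta>)"
proof -
  have l: "0 < l" unfolding l_def using \<alpha> m by (intro sim_exponent_gt_0) auto
  have cont: "continuous_on ({\<eta>..T} \<times> UNIV) \<phi>"
    using \<phi> unfolding test_function_def by blast
  have contx: "continuous_on UNIV (\<lambda>x. \<phi> (t, x))" if "t \<in> {\<eta>..T}" for t
    using that by (intro continuous_on_compose2[OF cont] continuous_intros) auto
  then have measx: "(\<lambda>x. \<phi> (t, x)) \<in> borel_measurable borel" if "t \<in> {\<eta>..T}" for t
    using that by (intro borel_measurable_continuous_onI)
  obtain M where M: "\<And>t x. t \<in> {\<eta>..T} \<Longrightarrow> x \<in> cball 0 (T powr l) \<Longrightarrow> \<bar>\<phi> (t, x)\<bar> \<le> M"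
  proof -
    have "continuous_on ({\<eta>..T} \<times> cball 0 (T powr l)) \<phi>"
      by (rule continuous_on_subset[OF cont]) auto
    from compact_imp_bounded[OF compact_continuous_image[OF this]]
    have "bounded (\<phi> ` ({\<eta>..T} \<times> cball 0 (T powr l)))"
      by (simp add: compact_Times)
    then obtain B where "\<forall>z\<in>\<phi> ` ({\<eta>..T} \<times> cball 0 (T powr l)). norm z \<le> B"
      unfolding bounded_iff by blast
    then show ?thesis using that[of B] by force
  qed
  have \<eta>mem: "\<eta> \<in> {\<eta>..T}" using \<eta> by simp
  show "(LBINT x. barenblatt \<alpha> m (\<eta>, x) * \<phi> (\<eta>, x)) = (LBINT y. profile \<alpha> m y * \<phi> (\<eta>, \<eta> powr l *\<^sub>R y))"
    unfolding l_def using measx[OF \<eta>mem] \<eta>(1) by (rule integral_barenblatt)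
  define B where "B = k_const DIM('a) \<alpha> m powr (1 / (m - 1)) / \<eta> powr (real DIM('a) * l)"
  show "integrable lborel (\<lambda>x. barenblatt \<alpha> m (\<eta>, x) * \<phi> (\<eta>, x))"
  proof (rule Bochner_Integration.integrable_bound[OF integrable_mult_right[OF integrable_indicator_cball[of "T powr l"], of "B * \<bar>M\<bar>"]])
    have [measurable]: "(\<lambda>x::'a. barenblatt \<alpha> m (\<eta>, x)) \<in> borel_measurable borel"
      unfolding barenblatt_def by simp
    note [measurable] = measx[OF \<eta>mem]
    show "(\<lambda>x. barenblatt \<alpha> m (\<eta>, x) * \<phi> (\<eta>, x)) \<in> borel_measurable lborel"
      by measurable
    show "AE x in lborel. norm (barenblatt \<alpha> m (\<eta>, x) * \<phi> (\<eta>, x)) \<le> norm (B * \<bar>M\<bar> * indicator (cball 0 (T powr l)) x)"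
    proof (rule AE_I2)
      fix x :: 'a
      have u: "barenblatt \<alpha> m (\<eta>, x) \<le> B * indicator (cball 0 (T powr l)) x"
        unfolding B_def l_def using \<eta> by (intro barenblatt_le \<alpha> m) auto
      have B: "0 \<le> B" by (simp add: B_def)
      show "norm (barenblatt \<alpha> m (\<eta>, x) * \<phi> (\<eta>, x)) \<le> norm (B * \<bar>M\<bar> * indicator (cball 0 (T powr l)) x)"
      proof (cases "x \<in> cball 0 (T powr l)")
        case True
        then have "\<bar>\<phi> (\<eta>, x)\<bar> \<le> \<bar>M\<bar>" using M[OF \<eta>mem, of x] by simp
        then have "barenblatt \<alpha> m (\<eta>, x) * \<bar>\<phi> (\<eta>, x)\<bar> \<le> B * \<bar>M\<bar>"
          using u True B by (intro mult_mono) auto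
        then show ?thesis using True B barenblatt_nonneg[of \<alpha> m "(\<eta>, x)"] by (simp add: abs_mult)
      next
        case False
        then have "barenblatt \<alpha> m (\<eta>, x) = 0" using u barenblatt_nonneg[of \<alpha> m "(\<eta>, x)"] by simp
        then show ?thesis by simp
      qed
    qed
  qed
  show "((\<lambda>s. LBINT y. profile \<alpha> m y * \<phi> (s, s powr l *\<^sub>R y)) \<longlongrightarrow> (LBINT y. profile \<alpha> m y * \<phi> (\<eta>, \<eta> powr l *\<^sub>R y))) (at_right \<eta>)"
    unfolding tendsto_at_iff_sequentially comp_def
  proof (intro allI impI)
    fix X assume X: "\<forall>i. X i \<in> {\<eta><..} - {\<eta>}" "X \<longlonglongrightarrow> \<eta>"
    \<comment> \<open>\<open>\<phi>\<close> is controlled on \<open>[\<eta>, T]\<close> only, so the sequence is cut off at \<open>T\<close>.\<close>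
    define Y where "Y i = min (X i) T" for i
    have Y: "Y i \<in> {\<eta>..T}" for i
      using X(1)[rule_format, of i] \<eta> by (auto simp: Y_def)
    have "Y \<longlonglongrightarrow> min \<eta> T" unfolding Y_def by (intro tendsto_intros X)
    then have Ylim: "Y \<longlonglongrightarrow> \<eta>" using \<eta> by simp
    have "(\<lambda>i. LBINT y. profile \<alpha> m y * \<phi> (Y i, Y i powr l *\<^sub>R y)) \<longlonglongrightarrow> (LBINT y. profile \<alpha> m y * \<phi> (\<eta>, \<eta> powr l *\<^sub>R y))"
    proof (rule integral_dominated_convergence[where w="\<lambda>y. \<bar>M\<bar> * profile \<alpha> m y"])
      have meas: "(\<lambda>y. \<phi> (t, t powr l *\<^sub>R y)) \<in> borel_measurable borel" if "t \<in> {\<eta>..T}" for t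
        using measurable_compose[OF _ measx[OF that], of "\<lambda>y. t powr l *\<^sub>R y" borel] by simp
      show "(\<lambda>y. profile \<alpha> m y * \<phi> (\<eta>, \<eta> powr l *\<^sub>R y)) \<in> borel_measurable lborel"
        using meas[OF \<eta>mem] by simp
      show "(\<lambda>y. profile \<alpha> m y * \<phi> (Y i, Y i powr l *\<^sub>R y)) \<in> borel_measurable lborel" for i
        using meas[OF Y] by simp
      show "integrable lborel (\<lambda>y::'a. \<bar>M\<bar> * profile \<alpha> m y)"
        using \<alpha> m by (intro integrable_mult_right integrable_profile)
      show "AE y in lborel. (\<lambda>i. profile \<alpha> m y * \<phi> (Y i, Y i powr l *\<^sub>R y)) \<longlonglongrightarrow> profile \<alpha> m y * \<phi> (\<eta>, \<eta> powr l *\<^sub>R y)"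
      proof (rule AE_I2)
        fix y :: 'a
        have "(\<lambda>i. (Y i, Y i powr l *\<^sub>R y)) \<longlonglongrightarrow> (\<eta>, \<eta> powr l *\<^sub>R y)"
          using \<eta> by (intro tendsto_intros Ylim) auto
        then have "(\<lambda>i. \<phi> (Y i, Y i powr l *\<^sub>R y)) \<longlonglongrightarrow> \<phi> (\<eta>, \<eta> powr l *\<^sub>R y)"
          using Y \<eta>mem by (intro continuous_on_tendsto_compose[OF cont]) auto
        then show "(\<lambda>i. profile \<alpha> m y * \<phi> (Y i, Y i powr l *\<^sub>R y)) \<longlonglongrightarrow> profile \<alpha> m y * \<phi> (\<eta>, \<eta> powr l *\<^sub>R y)"
          by (intro tendsto_intros)
      qed
      show "AE y in lborel. norm (profile \<alpha> m y * \<phi> (Y i, Y i powr l *\<^sub>R y)) \<le> \<bar>M\<bar> * profile \<alpha> m y" for i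
      proof (rule AE_I2)
        fix y :: 'a
        show "norm (profile \<alpha> m y * \<phi> (Y i, Y i powr l *\<^sub>R y)) \<le> \<bar>M\<bar> * profile \<alpha> m y"
        proof (cases "norm y \<le> 1")
          case True
          have "Y i powr l * norm y \<le> T powr l * 1"
            using Y[of i] \<eta> l True by (intro mult_mono powr_mono2) auto
          then have "\<bar>\<phi> (Y i, Y i powr l *\<^sub>R y)\<bar> \<le> \<bar>M\<bar>"
            using M[OF Y[of i], of "Y i powr l *\<^sub>R y"] by simp
          then have "profile \<alpha> m y * \<bar>\<phi> (Y i, Y i powr l *\<^sub>R y)\<bar> \<le> profile \<alpha> m y * \<bar>M\<bar>"
            by (intro mult_left_mono profile_nonneg)
          then show ?thesis using profile_nonneg[of \<alpha> m y] by (simp add: abs_mult mult.commute)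
        next
          case False
          then have "profile \<alpha> m y = 0"
            using profile_le[OF \<alpha> m, of y] profile_nonneg[of \<alpha> m y] by simp
          then show ?thesis by simp
        qed
      qed
    qed
    moreover have "eventually (\<lambda>i. (LBINT y. profile \<alpha> m y * \<phi> (Y i, Y i powr l *\<^sub>R y)) = (LBINT y. profile \<alpha> m y * \<phi> (X i, X i powr l *\<^sub>R y))) sequentially"
      using order_tendstoD(2)[OF X(2) \<eta>(2)] by eventually_elim (simp add: Y_def)
    ultimately show "(\<lambda>i. LBINT y. profile \<alpha> m y * \<phi> (X i, X i powr l *\<^sub>R y)) \<longlonglongrightarrow> (LBINT y. profile \<alpha> m y * \<phi> (\<eta>, \<eta> powr l *\<^sub>R y))"
      by (rule Lim_transform_eventually)
  qed
qed

theorem weak_solution_barenblatt: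
  assumes \<alpha>: "0 < \<alpha>" "\<alpha> \<le> 2" and m: "1 < m" and \<eta>: "0 < \<eta>" "\<eta> < T"
  shows "weak_solution \<alpha> m \<eta> T (barenblatt \<alpha> m :: real \<times> 'a::euclidean_space \<Rightarrow> real)"
  unfolding weak_solution_def
proof (intro conjI exI)
  let ?u = "barenblatt \<alpha> m :: real \<times> 'a \<Rightarrow> real" and ?w = "barenblatt_gradient \<alpha> m :: real \<times> 'a \<Rightarrow> 'a"
  let ?\<Omega> = "{\<eta><..<T} \<times> (UNIV :: 'a set)"
  define l where "l = sim_exponent DIM('a) \<alpha> m"
  define B where "B = k_const DIM('a) \<alpha> m powr (1 / (m - 1)) / \<eta> powr (real DIM('a) * l)"
  have B: "0 \<le> B" by (simp add: B_def)
  have u_le: "?u (t, x) \<le> B * indicator (cball 0 (T powr l)) x" if "t \<in> {\<eta><..<T}" for t x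
    unfolding B_def l_def using that \<eta> by (intro barenblatt_le \<alpha> m) auto
  have u_bd: "\<bar>?u p\<bar> \<le> B" if "p \<in> ?\<Omega>" for p
  proof -
    obtain t x where "p = (t, x)" by (cases p)
    with that have p: "p = (t, x)" "t \<in> {\<eta><..<T}" by simp_all
    have "?u p \<le> B * indicator (cball 0 (T powr l)) x" unfolding p(1) by (rule u_le[OF p(2)])
    also have "\<dots> \<le> B" using B by (simp add: indicator_def)
    finally show ?thesis using barenblatt_nonneg[of \<alpha> m p] by simp
  qed
  show "set_integrable lborel ?\<Omega> ?u"
  proof (rule set_integrable_dominated_compact[where K="{\<eta>..T} \<times> cball 0 (T powr l)" and B=B])
    show "norm (indicator ?\<Omega> p *\<^sub>R ?u p) \<le> B * indicator ({\<eta>..T} \<times> cball 0 (T powr l)) p" for p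
    proof (cases "p \<in> ?\<Omega>")
      case True
      obtain t x where "p = (t, x)" by (cases p)
      with True have p: "p = (t, x)" "t \<in> {\<eta><..<T}" by simp_all
      from u_le[OF p(2), of x] p barenblatt_nonneg[of \<alpha> m p] show ?thesis
        by (auto simp: indicator_def split: if_splits)
    next
      case False
      then show ?thesis using B by simp
    qed
  qed (auto intro!: compact_Times borel_open open_Times measurable_barenblatt)
  obtain M where M: "0 \<le> M" "\<And>\<rho> x. norm (truncated_gradient (\<alpha> / 2) \<rho> (x::'a)) \<le> M * norm x"
    using truncated_gradient_le[of "\<alpha> / 2", where 'a='a] \<alpha> by auto
  have k: "0 < k_const DIM('a) \<alpha> m" using \<alpha> m by (intro k_const_pos) auto
  have w_bd: "\<exists>W\<ge>0. \<forall>p\<in>K. norm (?w p) \<le> W" if K: "compact K" "K \<subseteq> ?\<Omega>" for K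
  proof -
    have "bounded (snd ` K)"
      using K(1) by (intro compact_imp_bounded compact_continuous_image continuous_on_snd continuous_on_id)
    then obtain X where X: "\<And>p. p \<in> K \<Longrightarrow> norm (snd p) \<le> X" unfolding bounded_iff by blast
    have "norm (?w p) \<le> k_const DIM('a) \<alpha> m / \<eta> * (M * \<bar>X\<bar>)" if p: "p \<in> K" for p
    proof -
      have t: "\<eta> < fst p" using p K(2) by auto
      have "norm (?w p) = k_const DIM('a) \<alpha> m / fst p * norm (truncated_gradient (\<alpha> / 2) (fst p powr (2 * sim_exponent DIM('a) \<alpha> m)) (snd p))"
        using t \<eta> k by (simp add: barenblatt_gradient_def case_prod_beta')
      also have "\<dots> \<le> k_const DIM('a) \<alpha> m / \<eta> * (M * \<bar>X\<bar>)"
      proof (rule mult_mono)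
        show "k_const DIM('a) \<alpha> m / fst p \<le> k_const DIM('a) \<alpha> m / \<eta>"
          using t \<eta> k by (intro divide_left_mono) auto
        have "M * norm (snd p) \<le> M * \<bar>X\<bar>" using X[OF p] M(1) by (intro mult_left_mono) auto
        then show "norm (truncated_gradient (\<alpha> / 2) (fst p powr (2 * sim_exponent DIM('a) \<alpha> m)) (snd p)) \<le> M * \<bar>X\<bar>"
          using M(2) by (rule order_trans[rotated])
      qed (use k \<eta> in auto)
      finally show ?thesis .
    qed
    moreover have "0 \<le> k_const DIM('a) \<alpha> m / \<eta> * (M * \<bar>X\<bar>)" using k \<eta> M(1) by simp
    ultimately show ?thesis by blast
  qed
  show "AE t in lborel. t \<in> {\<eta><..<T} \<longrightarrow> is_frac_grad \<alpha> (pressure m ?u t) (\<lambda>x. ?w (t, x))"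
  proof (intro AE_I2 impI)
    fix t assume "t \<in> {\<eta><..<T}"
    then have "0 < t" using \<eta>(1) by simp
    then show "is_frac_grad \<alpha> (pressure m ?u t) (\<lambda>x. ?w (t, x))"
      by (rule is_frac_grad_barenblatt[OF \<alpha> m])
  qed
  have wm: "?w \<in> borel_measurable borel" by (rule measurable_barenblatt_gradient[OF \<alpha>])
  show "loc_integrable_on ?\<Omega> ?w"
  proof (rule loc_integrable_on_bounded[OF wm])
    fix K :: "(real \<times> 'a) set" assume K: "compact K" "K \<subseteq> ?\<Omega>"
    obtain W where "\<forall>p\<in>K. norm (?w p) \<le> W" using w_bd[OF K] by auto
    then show "\<exists>W. \<forall>p\<in>K. norm (?w p) \<le> W" ..
  qed
  show "loc_integrable_on ?\<Omega> (\<lambda>p. \<bar>?u p\<bar> *\<^sub>R ?w p)"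
  proof (rule loc_integrable_on_bounded)
    show "(\<lambda>p. \<bar>?u p\<bar> *\<^sub>R ?w p) \<in> borel_measurable borel"
      using wm measurable_barenblatt[of \<alpha> m, where 'a='a]
      by (intro borel_measurable_scaleR borel_measurable_abs)
    fix K :: "(real \<times> 'a) set" assume K: "compact K" "K \<subseteq> ?\<Omega>"
    obtain W where W: "0 \<le> W" "\<And>p. p \<in> K \<Longrightarrow> norm (?w p) \<le> W" using w_bd[OF K] by blast
    have "norm (\<bar>?u p\<bar> *\<^sub>R ?w p) \<le> B * W" if "p \<in> K" for p
      unfolding norm_scaleR using u_bd[of p] W(2)[OF that] that K(2) B by (intro mult_mono) auto
    then show "\<exists>B. \<forall>p\<in>K. norm (\<bar>?u p\<bar> *\<^sub>R ?w p) \<le> B" by blast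
  qed
  show "\<forall>\<phi>. test_function \<eta> T \<phi> \<longrightarrow>
     integrable lborel (\<lambda>x. ?u (\<eta>, x) * \<phi> (\<eta>, x)) \<and>
     ((\<lambda>s. (LBINT t:{s<..<T}. LBINT x. ?u (t, x) * deriv (\<lambda>t. \<phi> (t, x)) t
          - (\<bar>?u (t, x)\<bar> *\<^sub>R ?w (t, x)) \<bullet> gradient (\<lambda>x. \<phi> (t, x)) x)
        + (LBINT x. ?u (\<eta>, x) * \<phi> (\<eta>, x))) \<longlongrightarrow> 0) (at_right \<eta>)"
  proof (intro allI impI conjI)
    fix \<phi> :: "real \<times> 'a \<Rightarrow> real" assume \<phi>: "test_function \<eta> T \<phi>"
    note trace = initial_trace_barenblatt[OF \<alpha>(1) m \<eta> \<phi>, folded l_def]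
    show "integrable lborel (\<lambda>x. ?u (\<eta>, x) * \<phi> (\<eta>, x))" by (rule trace(1))
    let ?J = "\<lambda>s. LBINT y. profile \<alpha> m y * \<phi> (s, s powr l *\<^sub>R y)"
    have "((\<lambda>s. - ?J s + ?J \<eta>) \<longlongrightarrow> - ?J \<eta> + ?J \<eta>) (at_right \<eta>)"
      by (intro tendsto_intros trace(3))
    then have lim: "((\<lambda>s. - ?J s + ?J \<eta>) \<longlongrightarrow> 0) (at_right \<eta>)" by simp
    have "eventually (\<lambda>s. s \<in> {\<eta><..<T}) (at_right \<eta>)"
      using \<eta>(2) by (rule eventually_at_right_real)
    then have "eventually (\<lambda>s. - ?J s + ?J \<eta> = (LBINT t:{s<..<T}. LBINT x. ?u (t, x) * deriv (\<lambda>t. \<phi> (t, x)) t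
          - (\<bar>?u (t, x)\<bar> *\<^sub>R ?w (t, x)) \<bullet> gradient (\<lambda>x. \<phi> (t, x)) x)
        + (LBINT x. ?u (\<eta>, x) * \<phi> (\<eta>, x))) (at_right \<eta>)"
    proof eventually_elim
      case (elim s)
      then have s: "\<eta> < s" "s < T" by simp_all
      show ?case
        unfolding weak_formulation_barenblatt[OF \<alpha> m \<eta>(1) \<phi> s, folded l_def] trace(2) ..
    qed
    with lim show "((\<lambda>s. (LBINT t:{s<..<T}. LBINT x. ?u (t, x) * deriv (\<lambda>t. \<phi> (t, x)) t
          - (\<bar>?u (t, x)\<bar> *\<^sub>R ?w (t, x)) \<bullet> gradient (\<lambda>x. \<phi> (t, x)) x)
        + (LBINT x. ?u (\<eta>, x) * \<phi> (\<eta>, x))) \<longlongrightarrow> 0) (at_right \<eta>)"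
      by (rule Lim_transform_eventually)
  qed
qed

section \<open>Regularity at the interface\<close>

text \<open>
  Subadditivity of concave powers: \<open>z \<le> z powr e\<close> on \<open>[0, 1]\<close>, applied to the two parts
  \<open>y / x\<close> and \<open>(x - y) / x\<close> of \<open>1\<close>.
\<close>

lemma powr_diff_le_powr:
  fixes x y e :: real
  assumes "0 \<le> x" "0 \<le> y" and e: "0 < e" "e \<le> 1"
  shows "\<bar>x powr e - y powr e\<bar> \<le> \<bar>x - y\<bar> powr e"
proof -
  have *: "x powr e - y powr e \<le> (x - y) powr e" if "0 \<le> y" "y \<le> x" for x y :: real
  proof (cases "x = 0")
    case False
    then have x: "0 < x" using that by simp
    have unit: "z \<le> z powr e" if "0 \<le> z" "z \<le> 1" for z :: real
      using powr_mono'[of e 1 z] that e by (cases "z = 0") auto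
    have "1 = y / x + (x - y) / x" using x by (simp add: field_simps)
    also have "\<dots> \<le> (y / x) powr e + ((x - y) / x) powr e"
      using x that by (intro add_mono unit) auto
    also have "\<dots> = (y powr e + (x - y) powr e) / x powr e"
      using x that by (simp add: powr_divide add_divide_distrib)
    finally have "x powr e \<le> y powr e + (x - y) powr e"
      using x by (simp add: pos_le_divide_eq)
    then show ?thesis by simp
  qed (use that in simp)
  show ?thesis
  proof (cases "y \<le> x")
    case True
    then have "y powr e \<le> x powr e" using assms by (intro powr_mono2) auto
    with *[of y x] True assms show ?thesis by simp
  next
    case False
    then have "x powr e \<le> y powr e" using assms by (intro powr_mono2) auto
    with *[of x y] False assms show ?thesis by (simp add: abs_minus_commute)
  qed
qed

lemma powr_lipschitz_pos:
  fixes a b e :: real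
  assumes "0 < a"
  obtains L where "0 \<le> L" "\<And>x y. x \<in> {a..b} \<Longrightarrow> y \<in> {a..b} \<Longrightarrow> \<bar>x powr e - y powr e\<bar> \<le> L * \<bar>x - y\<bar>"
proof
  let ?L = "\<bar>e\<bar> * (a powr (e - 1) + b powr (e - 1))"
  show "0 \<le> ?L" by simp
  fix x y assume xy: "x \<in> {a..b}" "y \<in> {a..b}"
  have "norm (x powr e - y powr e) \<le> ?L * norm (x - y)"
  proof (rule field_differentiable_bound[where S="{a..b}"])
    show "((\<lambda>x. x powr e) has_field_derivative e * z powr (e - 1)) (at z within {a..b})" if "z \<in> {a..b}" for z
      by (rule has_field_derivative_at_within[OF has_real_derivative_powr]) (use that assms in auto)
    show "norm (e * z powr (e - 1)) \<le> ?L" if z: "z \<in> {a..b}" for z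
    proof -
      have "z powr (e - 1) \<le> a powr (e - 1) + b powr (e - 1)"
      proof (cases "1 \<le> e")
        case True
        then have "z powr (e - 1) \<le> b powr (e - 1)" using z assms by (intro powr_mono2) auto
        then show ?thesis by (simp add: add_increasing)
      next
        case False
        then have "z powr (e - 1) \<le> a powr (e - 1)" using z assms by (intro powr_mono2') auto
        then show ?thesis by (simp add: add_increasing2)
      qed
      then show ?thesis by (simp add: abs_mult mult_left_mono)
    qed
  qed (use xy in auto)
  then show "\<bar>x powr e - y powr e\<bar> \<le> ?L * \<bar>x - y\<bar>" by simp
qed

lemma powr_holder_bounded:
  fixes e b :: real
  assumes e: "0 < e" and b: "1 \<le> b"
  obtains L where "0 \<le> L" "\<And>x y. x \<in> {0..b} \<Longrightarrow> y \<in> {0..b} \<Longrightarrow> \<bar>x powr e - y powr e\<bar> \<le> L * \<bar>x - y\<bar> powr min e 1"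
proof (cases "e \<le> 1")
  case True
  show ?thesis
    by (rule that[of 1]) (use powr_diff_le_powr True e in \<open>auto simp: min_def\<close>)
next
  case False
  let ?L = "e * b powr (e - 1)"
  have L0: "0 \<le> ?L" using e by simp
  have *: "\<bar>x powr e - y powr e\<bar> \<le> ?L * \<bar>x - y\<bar>" if "0 \<le> y" "y \<le> x" "x \<le> b" for x y
  proof (cases "y = 0")
    case True
    have "x powr e = x powr (e - 1) * x" 
      using that True by (cases "x = 0") (simp_all add: powr_diff)
    also have "\<dots> \<le> b powr (e - 1) * x"
      using that True False by (intro mult_right_mono powr_mono2) auto
    also have "\<dots> \<le> ?L * x" using False that True mult_right_mono[of 1 e "b powr (e - 1) * x"] by (simp add: mult.assoc)
    finally show ?thesis using True that by simp
  next
    case y: False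
    have "norm (x powr e - y powr e) \<le> ?L * norm (x - y)"
    proof (rule field_differentiable_bound[where S="{y..x}"])
      show "((\<lambda>x. x powr e) has_field_derivative e * z powr (e - 1)) (at z within {y..x})" if "z \<in> {y..x}" for z
        by (rule has_field_derivative_at_within[OF has_real_derivative_powr]) (use that y \<open>0 \<le> y\<close> in auto)
      show "norm (e * z powr (e - 1)) \<le> ?L" if z: "z \<in> {y..x}" for z
      proof -
        have "z powr (e - 1) \<le> b powr (e - 1)"
          using z y \<open>0 \<le> y\<close> \<open>x \<le> b\<close> False by (intro powr_mono2) auto
        then show ?thesis using e by (simp add: abs_mult mult_left_mono)
      qed
    qed (use that in auto)
    then show ?thesis by simp
  qed
  have "\<bar>x powr e - y powr e\<bar> \<le> ?L * \<bar>x - y\<bar>" if "x \<in> {0..b}" "y \<in> {0..b}" for x y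
  proof (cases "y \<le> x")
    case True
    then show ?thesis using * that by simp
  next
    case False
    then have "\<bar>y powr e - x powr e\<bar> \<le> ?L * \<bar>y - x\<bar>" using *[of x y] that by simp
    then show ?thesis by (simp only: abs_minus_commute)
  qed
  then show ?thesis using L0 False by (intro that[of ?L]) (auto simp: min_def)
qed

text \<open>
  \<open>u = C t powr (- n) P\<^sub>+ powr e\<close> with \<open>P = t powr (2 l) - |x|\<^sup>2\<close> locally Lipschitz; the exponent is that
  of the power \<open>e = \<alpha> / (2 (m - 1))\<close>, at most \<open>1\<close>.
\<close>

theorem holder_continuous_barenblatt:
  fixes x0 :: "'a::euclidean_space"
  assumes \<alpha>: "0 < \<alpha>" and m: "1 < m" and t0: "0 < t0"
  shows "holder_continuous_at (min (\<alpha> / (2 * (m - 1))) 1) (barenblatt \<alpha> m) (t0, x0)"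
proof -
  define l where "l = sim_exponent DIM('a) \<alpha> m"
  define n where "n = 1 / (m - 1)"
  define C where "C = k_const DIM('a) \<alpha> m powr n"
  define e where "e = \<alpha> / 2 * n"
  define \<gamma> where "\<gamma> = min e 1"
  have e: "0 < e" "e = \<alpha> / (2 * (m - 1))" using \<alpha> m by (auto simp: e_def n_def)
  have \<gamma>: "0 < \<gamma>" "\<gamma> \<le> 1" using e by (auto simp: \<gamma>_def)
  define r where "r = min (t0 / 2) (1 / 2)"
  have r: "0 < r" "r \<le> t0 / 2" "r \<le> 1 / 2" using t0 by (auto simp: r_def)
  define a where "a = t0 / 2"
  define b where "b = 2 * t0"
  define X where "X = norm x0 + 1"
  have ab: "0 < a" using t0 by (simp add: a_def)
  obtain L1 where L1: "0 \<le> L1" "\<And>s t. s \<in> {a..b} \<Longrightarrow> t \<in> {a..b} \<Longrightarrow> \<bar>s powr (- n) - t powr (- n)\<bar> \<le> L1 * \<bar>s - t\<bar>"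
    using powr_lipschitz_pos[OF ab] by blast
  obtain L2 where L2: "0 \<le> L2" "\<And>s t. s \<in> {a..b} \<Longrightarrow> t \<in> {a..b} \<Longrightarrow> \<bar>s powr (2 * l) - t powr (2 * l)\<bar> \<le> L2 * \<bar>s - t\<bar>"
    using powr_lipschitz_pos[OF ab] by blast
  define H where "H = max 1 (b powr (2 * l))"
  obtain L3 where L3: "0 \<le> L3" "\<And>x y. x \<in> {0..H} \<Longrightarrow> y \<in> {0..H} \<Longrightarrow> \<bar>x powr e - y powr e\<bar> \<le> L3 * \<bar>x - y\<bar> powr \<gamma>"
    unfolding \<gamma>_def
  proof (rule powr_holder_bounded[OF e(1)])
    show "1 \<le> H" by (simp add: H_def)
  qed blast
  have l: "0 < l" unfolding l_def using \<alpha> m sim_exponent_pos[of \<alpha> m "DIM('a)"] by (simp add: sim_exponent_def)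
  have C: "0 \<le> C" by (simp add: C_def)
  have n: "0 < n" using m by (simp add: n_def)
  define P where "P q = max 0 (fst q powr (2 * l) - (norm (snd q))\<^sup>2)" for q :: "real \<times> 'a"
  define f where "f q = C * fst q powr (- n)" for q :: "real \<times> 'a"
  define h where "h q = P q powr e" for q
  define K where "K = C * L1 * H powr e + C * a powr (- n) * (L3 * (L2 + 2 * X) powr \<gamma>)"
  have mem: "fst q \<in> {a..b}" "norm (snd q) \<le> X" if "q \<in> ball (t0, x0) r" for q :: "real \<times> 'a"
  proof -
    have "dist (fst q) t0 < r" "dist (snd q) x0 < r"
      using that dist_fst_le[of q "(t0, x0)"] dist_snd_le[of q "(t0, x0)"] by (auto simp: dist_commute)
    then show "fst q \<in> {a..b}" "norm (snd q) \<le> X"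
      using r norm_triangle_ineq2[of "snd q" x0] by (auto simp: a_def b_def X_def dist_real_def dist_norm)
  qed
  have u: "barenblatt \<alpha> m q = f q * h q" if "q \<in> ball (t0, x0) r" for q :: "real \<times> 'a"
  proof -
    have "0 < fst q" using mem(1)[OF that] ab by simp
    from barenblatt_factored[OF \<alpha> m this, of "snd q"] show ?thesis
      by (simp add: f_def h_def P_def C_def n_def l_def e_def)
  qed
  have "dist (barenblatt \<alpha> m q) (barenblatt \<alpha> m q') \<le> K * dist q q' powr \<gamma>"
    if q: "q \<in> ball (t0, x0) r" "q' \<in> ball (t0, x0) r" for q q' :: "real \<times> 'a"
  proof -
    let ?d = "dist q q'"
    have d1: "?d \<le> 1"
      using q r dist_triangle2[of q q' "(t0, x0)"] by (simp add: dist_commute)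
    have dt: "\<bar>fst q - fst q'\<bar> \<le> ?d" using dist_fst_le[of q q'] by (simp add: dist_real_def)
    have dx: "\<bar>norm (snd q) - norm (snd q')\<bar> \<le> ?d"
      using dist_snd_le[of q q'] norm_triangle_ineq3[of "snd q" "snd q'"] by (simp add: dist_norm)
    have d\<gamma>: "?d \<le> ?d powr \<gamma>"
      using powr_mono'[of \<gamma> 1 ?d] \<gamma> d1 by (cases "?d = 0") auto
    have Pm: "P q \<in> {0..H}" if "q \<in> ball (t0, x0) r" for q
    proof -
      have "fst q powr (2 * l) \<le> b powr (2 * l)"
        using mem(1)[OF that] ab l by (intro powr_mono2) auto
      then have "fst q powr (2 * l) - (norm (snd q))\<^sup>2 \<le> H"
        unfolding H_def using zero_le_power2[of "norm (snd q)"] by linarith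
      then show ?thesis by (auto simp: P_def H_def)
    qed
    have f_diff: "\<bar>f q - f q'\<bar> \<le> C * L1 * ?d powr \<gamma>"
    proof -
      have "\<bar>f q - f q'\<bar> = C * \<bar>fst q powr (- n) - fst q' powr (- n)\<bar>"
        using C by (simp add: f_def abs_mult flip: right_diff_distrib)
      also have "\<dots> \<le> C * (L1 * \<bar>fst q - fst q'\<bar>)"
        using C q by (intro mult_left_mono L1 mem)
      also have "\<dots> \<le> C * (L1 * ?d powr \<gamma>)"
        using C L1(1) dt d\<gamma> by (intro mult_left_mono) auto
      finally show ?thesis by (simp add: mult.assoc)
    qed
    have P_diff: "\<bar>P q - P q'\<bar> \<le> (L2 + 2 * X) * ?d"
    proof -
      have "\<bar>max 0 u - max 0 v\<bar> \<le> \<bar>u - v\<bar>" for u v :: real by linarith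
      then have "\<bar>P q - P q'\<bar> \<le> \<bar>(fst q powr (2 * l) - (norm (snd q))\<^sup>2) - (fst q' powr (2 * l) - (norm (snd q'))\<^sup>2)\<bar>"
        unfolding P_def .
      also have "\<dots> \<le> \<bar>fst q powr (2 * l) - fst q' powr (2 * l)\<bar> + \<bar>(norm (snd q))\<^sup>2 - (norm (snd q'))\<^sup>2\<bar>"
        by linarith
      also have "\<bar>fst q powr (2 * l) - fst q' powr (2 * l)\<bar> \<le> L2 * ?d"
        using L2(2)[OF mem(1)[OF q(1)] mem(1)[OF q(2)]] mult_left_mono[OF dt L2(1)] by linarith
      also have "\<bar>(norm (snd q))\<^sup>2 - (norm (snd q'))\<^sup>2\<bar> \<le> 2 * X * ?d"
      proof -
        have "\<bar>(norm (snd q))\<^sup>2 - (norm (snd q'))\<^sup>2\<bar> = (norm (snd q) + norm (snd q')) * \<bar>norm (snd q) - norm (snd q')\<bar>"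
          by (simp add: power2_eq_square square_diff_square_factored abs_mult)
        also have "\<dots> \<le> (2 * X) * ?d"
          using mem(2)[OF q(1)] mem(2)[OF q(2)] dx by (intro mult_mono) (auto simp: X_def)
        finally show ?thesis .
      qed
      finally show ?thesis by (simp add: distrib_right)
    qed
    have X0: "0 \<le> X" by (simp add: X_def)
    have h_diff: "\<bar>h q - h q'\<bar> \<le> L3 * (L2 + 2 * X) powr \<gamma> * ?d powr \<gamma>"
    proof -
      have "\<bar>h q - h q'\<bar> \<le> L3 * \<bar>P q - P q'\<bar> powr \<gamma>"
        unfolding h_def using q by (intro L3 Pm)
      also have "\<dots> \<le> L3 * ((L2 + 2 * X) * ?d) powr \<gamma>"
        using L3(1) P_diff \<gamma> by (intro mult_left_mono powr_mono2) auto
      also have "((L2 + 2 * X) * ?d) powr \<gamma> = (L2 + 2 * X) powr \<gamma> * ?d powr \<gamma>"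
        using L2(1) X0 by (intro powr_mult)
      finally show ?thesis by (simp add: mult.assoc)
    qed
    have h_bd: "\<bar>h q\<bar> \<le> H powr e"
      using Pm[OF q(1)] e(1) by (auto simp: h_def intro!: powr_mono2)
    have f_bd: "\<bar>f q'\<bar> \<le> C * a powr (- n)"
      using mem(1)[OF q(2)] ab n C by (auto simp: f_def abs_mult intro!: mult_left_mono powr_mono2')
    have split: "f q * h q - f q' * h q' = (f q - f q') * h q + f q' * (h q - h q')"
      by (simp add: algebra_simps)
    have "\<bar>f q * h q - f q' * h q'\<bar> \<le> \<bar>f q - f q'\<bar> * \<bar>h q\<bar> + \<bar>f q'\<bar> * \<bar>h q - h q'\<bar>"
      unfolding split abs_mult[symmetric] by (rule abs_triangle_ineq)
    also have "\<dots> \<le> (C * L1 * ?d powr \<gamma>) * H powr e + (C * a powr (- n)) * (L3 * (L2 + 2 * X) powr \<gamma> * ?d powr \<gamma>)"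
      using f_diff h_bd f_bd h_diff C L1(1) by (intro add_mono mult_mono) auto
    also have "\<dots> = K * ?d powr \<gamma>"
      by (simp add: K_def algebra_simps)
    finally show ?thesis
      unfolding u[OF q(1)] u[OF q(2)] dist_real_def .
  qed
  then have "\<exists>r>0. \<exists>C. \<forall>q\<in>ball (t0, x0) r. \<forall>q'\<in>ball (t0, x0) r.
      dist (barenblatt \<alpha> m q) (barenblatt \<alpha> m q') \<le> C * dist q q' powr \<gamma>"
    using r(1) by blast
  then show ?thesis
    unfolding holder_continuous_at_def \<gamma>_def e(2) .
qed

theorem theorem2p2:
  fixes \<alpha> m :: real and u :: "real \<times> 'a::euclidean_space \<Rightarrow> real"
  assumes "0 < \<alpha>" and "\<alpha> \<le> 2" and "1 < m"
    and "u = barenblatt \<alpha> m"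
  shows "(\<forall>\<eta> T. 0 < \<eta> \<and> \<eta> < T \<longrightarrow> weak_solution \<alpha> m \<eta> T u) \<and>
    pointwise_solution_on \<alpha> m
      {(t, x). 0 < t \<and> norm x \<noteq> t powr (1 / (real DIM('a) * (m - 1) + \<alpha>))} u \<and>
    (\<forall>t x. 0 < t \<and> norm x = t powr (1 / (real DIM('a) * (m - 1) + \<alpha>)) \<longrightarrow>
      holder_continuous_at (min (\<alpha> / (2 * (m - 1))) 1) u (t, x))"
proof (intro conjI allI impI)
  show "weak_solution \<alpha> m \<eta> T u" if "0 < \<eta> \<and> \<eta> < T" for \<eta> T
    unfolding assms(4) using that assms(1-3) by (intro weak_solution_barenblatt) auto
  show "pointwise_solution_on \<alpha> m {(t, x). 0 < t \<and> norm x \<noteq> t powr (1 / (real DIM('a) * (m - 1) + \<alpha>))} u"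
    unfolding assms(4) using assms(1-3) by (rule pointwise_solution_barenblatt)
  show "holder_continuous_at (min (\<alpha> / (2 * (m - 1))) 1) u (t, x)"
    if "0 < t \<and> norm x = t powr (1 / (real DIM('a) * (m - 1) + \<alpha>))" for t x
    unfolding assms(4) using that assms(1,3) by (intro holder_continuous_barenblatt) auto
qed

end
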